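(* Let $\lambda\in\tfrac12\mathbb Z$ with $\lambda<\tfrac12$, and $i,j\in\{1,2\}$. Let $\overline F^{T_i}(\lambda/z)=\mathrm{Ker}_{F^{T_i}}\Phi(\tfrac12-\lambda)\cong\bigwedge(\Phi(n)\mid n\in\tfrac12\mathbb Z,\ n<0,\ n\ne\lambda-\tfrac12)$. Then, as $\widehat{sl_2}[\Theta]$-modules, $$\overline F^{T_i}(\lambda/z)\otimes F_{-1}^{T_j}\cong L((2\lambda-2)\Lambda_0-2\lambda\Lambda_1)\quad\text{if } i=j,$$ $$\overline F^{T_i}(\lambda/z)\otimes F_{-1}^{T_j}\cong L(-2\lambda\Lambda_0+(2\lambda-2)\Lambda_1)\quad\text{if } i\ne j.$$
   Context: **The spaces $F^{T_i}$.** Let $CL^{tw}$ be the associative algebra generated by $\Phi(r)$, $r\in\tfrac12\mathbb Z$, with $\{\Phi(r),\Phi(s)\}=-(-1)^{2r}\delta_{r+s,0}$. For $i=1,2$ let $F^{T_i}$ be the irreducible $CL^{tw}$-module generated by $\mathbf 1$ with $\Phi(r)\mathbf 1=0$ for $r>0$ and $\Phi(0)\mathbf 1=(-1)^i\frac1{\sqrt{-2}}\mathbf 1$ (where $\sqrt{-2}=\sqrt2\sqrt{-1}$); as a vector space $F^{T_i}=\bigwedge(\Phi(r)\mid r\in\frac12\mathbb Z,\ r<0)$. On $F^{T_i}(\lambda/z):=F^{T_i}$ define $G(r)=(\lambda-r-\tfrac12)\Phi(r)$ for $r\in\frac12\mathbb Z$ and $G(z)=\sum_{r\in\frac12\mathbb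 Z}G(r)z^{-r-3/2}$. The subspace $\overline F^{T_i}(\lambda/z)$ is invariant under all $G(r)$. **The modules $F_{-1}^{T_j}$.** Let $[\beta(k),\beta(l)]=-k\delta_{k+l,0}$, $k,l\in\frac12+\mathbb Z$, with Fock space $M_{\frac12+\mathbb Z}(1)=\mathbb C[\beta(-\frac12),\beta(-\frac32),\dots]$. $F_{-1}^{T_j}=M_{\frac12+\mathbb Z}(1)$ with $\beta(z)=\sum_{k\in\frac12+\mathbb Z}\beta(k)z^{-k-1}$ and $$Y_{tw}(e^{\beta},z)=-(2\sqrt{-1})(-1)^j z^{1/2}\exp\Big(\sum_{k\in\frac12+\mathbb Z_{\ge0}}\tfrac{\beta(-k)}{k}z^{k}\Big)\exp\Big(-\sum_{k\in\frac12+\mathbb Z_{\ge0}}\tfrac{\beta(k)}{k}z^{-k}\Big).$$ **The Lie algebra $\widehat{sl_2}[\Theta]$** has basis $K$ (central), $h(m)$, $x^-(m)$ ($m\in\frac12+\mathbb Z$), $x^+(r)$ ($r\in\mathbb Z$), with, for $m,n\in\frac12+\mathbb Z$, $r,s\in\mathbb Z$: $[h(m),h(n)]=2m\delta_{m+n,0}K$, $[h(m),x^+(r)]=2x^-(m+r)$, $[h(m),x^-(n)]=2x^+(m+n)$, $[x^+(r),x^+(s)]=2r\delta_{r+s,0}K$, $[x^+(r),x^-(m)]=-2h(m+r)$, $[x^-(m),x^-(n)]=-2m\delta_{m+n,0}K$. Put $X_+(z)=\frac12\big(\sum_{n\in\mathbb Z}x^+(n)z^{-n-1}+\sum_{n\in\frac12+\mathbb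 Z}x^-(n)z^{-n-1}\big)$, $h(z)=\sum_{n\in\frac12+\mathbb Z}h(n)z^{-n-1}$. **Action.** On $F^{T_i}(\lambda/z)\otimes F_{-1}^{T_j}$ (and on the subspace $\overline F^{T_i}(\lambda/z)\otimes F_{-1}^{T_j}$): $K=-2$, $X_+(z)=\frac1{\sqrt2}G(z)\otimes Y_{tw}(e^\beta,z)$ (factors tensored without signs), $h(z)=-2\beta(z)$. **Highest weight modules.** $L(\frac k2(\Lambda_0+\Lambda_1)+a(\Lambda_1-\Lambda_0))$ is the irreducible module with $K=k$ generated by $v$ with $x^+(n)v=x^-(p)v=h(m)v=0$ for all $n,m,p>0$ and $x^+(0)v=av$.
   Formalization: At the critical level K=-2 the stated highest weight conditions do not determine the irreducible module; L(Λ) is therefore taken as the graded irreducible highest weight module, i.e. one with a degree operator compatible with the modes and vanishing on v. *)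

theory Defs
  imports Complex_Main "HOL-Library.Poly_Mapping"
begin

definition half_ints :: "rat set" where
  "half_ints = {r. 2 * r \<in> \<int>}"

definition half_odds :: "rat set" where
  "half_odds = half_ints - \<int>"

text \<open>
  The Lie algebra is the complex vector space with basis \<open>basis\<close>; an element of it is a finitely
  supported function on \<open>gen\<close>.  The constructors are applied to the actual (rational) mode numbers,
  so that \<open>gen\<close> also contains labels outside the basis, which are never used.
\<close>

datatype gen = K | H rat | Xminus rat | Xplus rat

definition basis :: "gen set" where
  "basis = {K} \<union> H ` half_odds \<union> Xminus ` half_odds \<union> Xplus ` \<int>"

fun bracket :: "gen \<Rightarrow> gen \<Rightarrow> (gen \<Rightarrow>\<^sub>0 complex)" where
  "bracket K y = 0"
| "bracket x K = 0"
| "bracket (H m) (H n) = Poly_Mapping.single K (of_rat (2 * m) when m + n = 0)"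
| "bracket (H m) (Xplus r) = Poly_Mapping.single (Xminus (m + r)) 2"
| "bracket (Xplus r) (H m) = Poly_Mapping.single (Xminus (m + r)) (- 2)"
| "bracket (H m) (Xminus n) = Poly_Mapping.single (Xplus (m + n)) 2"
| "bracket (Xminus n) (H m) = Poly_Mapping.single (Xplus (m + n)) (- 2)"
| "bracket (Xplus r) (Xplus s) = Poly_Mapping.single K (of_rat (2 * r) when r + s = 0)"
| "bracket (Xplus r) (Xminus m) = Poly_Mapping.single (H (m + r)) (- 2)"
| "bracket (Xminus m) (Xplus r) = Poly_Mapping.single (H (m + r)) 2"
| "bracket (Xminus m) (Xminus n) = Poly_Mapping.single K (of_rat (- 2 * m) when m + n = 0)"

fun mode :: "gen \<Rightarrow> rat" where
  "mode K = 0"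
| "mode (H m) = m"
| "mode (Xminus m) = m"
| "mode (Xplus r) = r"

text \<open>
  A module is a subspace \<open>V\<close> of a complex vector space (with scalar multiplication \<open>sc\<close>) together
  with operators on \<open>V\<close>, one for every basis element of the Lie algebra.  The subspace is explicit
  because the modules of interest are subspaces of larger free vector spaces.
\<close>

locale twisted_sl2_module = vector_space sc
  for sc :: "complex \<Rightarrow> 'v::ab_group_add \<Rightarrow> 'v" +
  fixes V :: "'v set" and \<rho> :: "gen \<Rightarrow> 'v \<Rightarrow> 'v"
  assumes subspace_V: "subspace V"
    and \<rho>_closed: "x \<in> basis \<Longrightarrow> v \<in> V \<Longrightarrow> \<rho> x v \<in> V"
    and \<rho>_add: "x \<in> basis \<Longrightarrow> v \<in> V \<Longrightarrow> w \<in> V \<Longrightarrow> \<rho> x (v + w) = \<rho> x v + \<rho> x w"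
    and \<rho>_scale: "x \<in> basis \<Longrightarrow> v \<in> V \<Longrightarrow> \<rho> x (sc c v) = sc c (\<rho> x v)"
    and \<rho>_bracket: "x \<in> basis \<Longrightarrow> y \<in> basis \<Longrightarrow> v \<in> V \<Longrightarrow>
      \<rho> x (\<rho> y v) - \<rho> y (\<rho> x v)
        = (\<Sum>g\<in>Poly_Mapping.keys (bracket x y). sc (Poly_Mapping.lookup (bracket x y) g) (\<rho> g v))"

definition submodule ::
    "(complex \<Rightarrow> 'v::ab_group_add \<Rightarrow> 'v) \<Rightarrow> 'v set \<Rightarrow> (gen \<Rightarrow> 'v \<Rightarrow> 'v) \<Rightarrow> 'v set \<Rightarrow> bool" where
  "submodule sc V \<rho> U \<longleftrightarrow>
     U \<subseteq> V \<and> module.subspace sc U \<and> (\<forall>x\<in>basis. \<forall>u\<in>U. \<rho> x u \<in> U)"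

definition irreducible_module ::
    "(complex \<Rightarrow> 'v::ab_group_add \<Rightarrow> 'v) \<Rightarrow> 'v set \<Rightarrow> (gen \<Rightarrow> 'v \<Rightarrow> 'v) \<Rightarrow> bool" where
  "irreducible_module sc V \<rho> \<longleftrightarrow>
     twisted_sl2_module sc V \<rho> \<and> V \<noteq> {0} \<and> (\<forall>U. submodule sc V \<rho> U \<longrightarrow> U = {0} \<or> U = V)"

definition generated_by ::
    "(complex \<Rightarrow> 'v::ab_group_add \<Rightarrow> 'v) \<Rightarrow> 'v set \<Rightarrow> (gen \<Rightarrow> 'v \<Rightarrow> 'v) \<Rightarrow> 'v \<Rightarrow> bool" where
  "generated_by sc V \<rho> v \<longleftrightarrow> v \<in> V \<and> (\<forall>U. submodule sc V \<rho> U \<and> v \<in> U \<longrightarrow> U = V)"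

definition highest_weight_vector ::
    "(complex \<Rightarrow> 'v::ab_group_add \<Rightarrow> 'v) \<Rightarrow> 'v set \<Rightarrow> (gen \<Rightarrow> 'v \<Rightarrow> 'v) \<Rightarrow> complex \<Rightarrow> 'v \<Rightarrow> bool" where
  "highest_weight_vector sc V \<rho> a v \<longleftrightarrow>
     v \<in> V \<and> v \<noteq> 0 \<and> (\<forall>x\<in>basis. mode x > 0 \<longrightarrow> \<rho> x v = 0) \<and> \<rho> (Xplus 0) v = sc a v"

text \<open>
  A degree operator normalized to vanish on \<open>v\<close>; it grades a module generated by \<open>v\<close> compatibly with
  the mode numbers.
\<close>

definition has_degree_operator ::
    "(complex \<Rightarrow> 'v::ab_group_add \<Rightarrow> 'v) \<Rightarrow> 'v set \<Rightarrow> (gen \<Rightarrow> 'v \<Rightarrow> 'v) \<Rightarrow> 'v \<Rightarrow> bool" where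
  "has_degree_operator sc V \<rho> v \<longleftrightarrow>
     (\<exists>D. (\<forall>u\<in>V. D u \<in> V)
        \<and> (\<forall>u\<in>V. \<forall>w\<in>V. D (u + w) = D u + D w)
        \<and> (\<forall>c. \<forall>u\<in>V. D (sc c u) = sc c (D u))
        \<and> (\<forall>x\<in>basis. \<forall>u\<in>V. D (\<rho> x u) - \<rho> x (D u) = sc (of_rat (mode x)) (\<rho> x u))
        \<and> D v = 0)"

text \<open>
  \<open>is_L c\<^sub>0 c\<^sub>1 sc V \<rho>\<close> says that the module is \<open>L(c\<^sub>0 \<Lambda>\<^sub>0 + c\<^sub>1 \<Lambda>\<^sub>1)\<close>, where
  \<open>c\<^sub>0 \<Lambda>\<^sub>0 + c\<^sub>1 \<Lambda>\<^sub>1 = k/2 (\<Lambda>\<^sub>0 + \<Lambda>\<^sub>1) + a (\<Lambda>\<^sub>1 - \<Lambda>\<^sub>0)\<close>.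

  The usual meaning of \<open>L(\<Lambda>)\<close> is the graded irreducible highest weight module, i.e. the quotient of
  the Verma module by its maximal graded submodule, and the degree operator is what makes it unique
  up to isomorphism.  At the critical level \<open>k = -2\<close> it cannot be omitted there: the modes of negative
  degree of the Sugawara field act on the Verma module as free central variables, and specializing
  them to nonzero constants yields further, non-graded irreducible modules generated by a vector
  that satisfies the same highest weight conditions.
\<close>

definition is_L ::
    "complex \<Rightarrow> complex \<Rightarrow> (complex \<Rightarrow> 'v::ab_group_add \<Rightarrow> 'v) \<Rightarrow> 'v set \<Rightarrow> (gen \<Rightarrow> 'v \<Rightarrow> 'v) \<Rightarrow> bool" where
  "is_L c\<^sub>0 c\<^sub>1 sc V \<rho> \<longleftrightarrow>
     (\<exists>k a v. c\<^sub>0 = k / 2 - a \<and> c\<^sub>1 = k / 2 + a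
        \<and> irreducible_module sc V \<rho>
        \<and> (\<forall>u\<in>V. \<rho> K u = sc k u)
        \<and> highest_weight_vector sc V \<rho> a v
        \<and> generated_by sc V \<rho> v
        \<and> has_degree_operator sc V \<rho> v)"

definition module_iso ::
    "(complex \<Rightarrow> 'v::ab_group_add \<Rightarrow> 'v) \<Rightarrow> 'v set \<Rightarrow> (gen \<Rightarrow> 'v \<Rightarrow> 'v) \<Rightarrow>
     (complex \<Rightarrow> 'w::ab_group_add \<Rightarrow> 'w) \<Rightarrow> 'w set \<Rightarrow> (gen \<Rightarrow> 'w \<Rightarrow> 'w) \<Rightarrow> bool" where
  "module_iso sc V \<rho> sc' V' \<rho>' \<longleftrightarrow>
     (\<exists>f. bij_betw f V V'
        \<and> (\<forall>u\<in>V. \<forall>w\<in>V. f (u + w) = f u + f w)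
        \<and> (\<forall>c. \<forall>u\<in>V. f (sc c u) = sc' c (f u))
        \<and> (\<forall>x\<in>basis. \<forall>u\<in>V. f (\<rho> x u) = \<rho>' x (f u)))"

text \<open>The complex vector space with basis \<open>'b\<close> is \<open>'b \<Rightarrow>\<^sub>0 complex\<close>.\<close>

definition smul :: "complex \<Rightarrow> ('b \<Rightarrow>\<^sub>0 complex) \<Rightarrow> ('b \<Rightarrow>\<^sub>0 complex)" where
  "smul c f = Poly_Mapping.map ((*) c) f"

definition basis_vec :: "'b \<Rightarrow> ('b \<Rightarrow>\<^sub>0 complex)" where
  "basis_vec b = Poly_Mapping.single b 1"

definition lin_ext :: "('a \<Rightarrow> ('b \<Rightarrow>\<^sub>0 complex)) \<Rightarrow> ('a \<Rightarrow>\<^sub>0 complex) \<Rightarrow> ('b \<Rightarrow>\<^sub>0 complex)" where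
  "lin_ext F f = (\<Sum>a\<in>Poly_Mapping.keys f. smul (Poly_Mapping.lookup f a) (F a))"

text \<open>The tensor product of the free vector spaces on \<open>'a\<close> and \<open>'b\<close> is the one on \<open>'a \<times> 'b\<close>.\<close>

definition tensor :: "('a \<Rightarrow>\<^sub>0 complex) \<Rightarrow> ('b \<Rightarrow>\<^sub>0 complex) \<Rightarrow> ('a \<times> 'b \<Rightarrow>\<^sub>0 complex)"
    (infixr "\<otimes>\<^sub>v" 70) where
  "f \<otimes>\<^sub>v g = lin_ext (\<lambda>a. lin_ext (\<lambda>b. basis_vec (a, b)) g) f"

definition tensor_space ::
    "('a \<Rightarrow>\<^sub>0 complex) set \<Rightarrow> ('b \<Rightarrow>\<^sub>0 complex) set \<Rightarrow> ('a \<times> 'b \<Rightarrow>\<^sub>0 complex) set" where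
  "tensor_space U W = module.span smul {f \<otimes>\<^sub>v g | f g. f \<in> U \<and> g \<in> W}"

definition tensor_map ::
    "(('a \<Rightarrow>\<^sub>0 complex) \<Rightarrow> ('c \<Rightarrow>\<^sub>0 complex)) \<Rightarrow> (('b \<Rightarrow>\<^sub>0 complex) \<Rightarrow> ('d \<Rightarrow>\<^sub>0 complex)) \<Rightarrow>
     ('a \<times> 'b \<Rightarrow>\<^sub>0 complex) \<Rightarrow> ('c \<times> 'd \<Rightarrow>\<^sub>0 complex)" where
  "tensor_map A B = lin_ext (\<lambda>(a, b). A (basis_vec a) \<otimes>\<^sub>v B (basis_vec b))"

text \<open>
  The exterior algebra on generators indexed by rationals: the basis vector of a finite set
  \<open>{s\<^sub>1 < \<dots> < s\<^sub>n}\<close> of indices is \<open>\<Phi>(s\<^sub>1) \<and> \<dots> \<and> \<Phi>(s\<^sub>n)\<close>.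
\<close>

type_synonym ext = "rat set \<Rightarrow>\<^sub>0 complex"

definition ext_alg :: "rat set \<Rightarrow> ext set" where
  "ext_alg N = {f. \<forall>S\<in>Poly_Mapping.keys f. finite S \<and> S \<subseteq> N}"

text \<open>The underlying space is the same for both values of \<open>i\<close>; only the action of \<open>\<Phi>(0)\<close> differs.\<close>

definition FT :: "ext set" where
  "FT = ext_alg {r \<in> half_ints. r < 0}"

text \<open>
  \<open>\<Phi>(r)\<close> multiplies by the generator for \<open>r < 0\<close> and is \<open>-(-1)\<^sup>2\<^sup>r\<close> times the contraction with the
  generator of index \<open>-r\<close> for \<open>r > 0\<close>.  The square root of \<open>-2\<close> is \<open>sqrt 2 * \<i>\<close>.
\<close>

definition Phi_basis :: "nat \<Rightarrow> rat \<Rightarrow> rat set \<Rightarrow> ext" where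
  "Phi_basis i r S =
     (if r < 0 then
        (if r \<in> S then 0 else smul ((- 1) ^ card {s \<in> S. s < r}) (basis_vec (insert r S)))
      else if r > 0 then
        (if - r \<in> S then
           smul (- ((- 1) powi \<lfloor>2 * r\<rfloor>) * (- 1) ^ card {s \<in> S. s < - r}) (basis_vec (S - {- r}))
         else 0)
      else smul ((- 1) ^ card S * ((- 1) ^ i * (1 / (of_real (sqrt 2) * \<i>)))) (basis_vec S))"

definition Phi :: "nat \<Rightarrow> rat \<Rightarrow> ext \<Rightarrow> ext" where
  "Phi i r = lin_ext (Phi_basis i r)"

definition G :: "nat \<Rightarrow> rat \<Rightarrow> rat \<Rightarrow> ext \<Rightarrow> ext" where
  "G i l r f = smul (of_rat (l - r - 1 / 2)) (Phi i r f)"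

definition FTbar :: "nat \<Rightarrow> rat \<Rightarrow> ext set" where
  "FTbar i l = {f \<in> FT. Phi i (1 / 2 - l) f = 0}"

text \<open>
  Polynomials in variables indexed by rationals, where the variable of index \<open>k\<close> stands for
  \<open>\<beta>(-k)\<close>; multiplication is that of \<open>\<Rightarrow>\<^sub>0\<close>.
\<close>

type_synonym fock = "(rat \<Rightarrow>\<^sub>0 nat) \<Rightarrow>\<^sub>0 complex"

definition Fock :: "fock set" where
  "Fock = {f. \<forall>m\<in>Poly_Mapping.keys f. Poly_Mapping.keys m \<subseteq> {k \<in> half_odds. k > 0}}"

definition pderiv_var :: "rat \<Rightarrow> fock \<Rightarrow> fock" where
  "pderiv_var k = lin_ext (\<lambda>m. smul (of_nat (Poly_Mapping.lookup m k))
     (basis_vec (m - Poly_Mapping.single k 1)))"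

definition beta :: "rat \<Rightarrow> fock \<Rightarrow> fock" where
  "beta k f = (if k < 0 then basis_vec (Poly_Mapping.single (- k) 1) * f
               else smul (of_rat (- k)) (pderiv_var k f))"

text \<open>
  For a formal power series \<open>A(w) = \<Sum>\<^sub>n A\<^sub>n w\<^sup>n\<close> of operators, \<open>series_pow A l n\<close> is the coefficient of
  \<open>w\<^sup>n\<close> in \<open>A(w)\<^sup>l\<close>, and, provided that \<open>A\<^sub>0 = 0\<close>, \<open>series_exp A n\<close> is the one in \<open>exp (A(w))\<close>.
\<close>

primrec series_pow :: "(nat \<Rightarrow> fock \<Rightarrow> fock) \<Rightarrow> nat \<Rightarrow> nat \<Rightarrow> fock \<Rightarrow> fock" where
  "series_pow A 0 n f = (if n = 0 then f else 0)"
| "series_pow A (Suc l) n f = (\<Sum>k\<le>n. A k (series_pow A l (n - k) f))"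

definition series_exp :: "(nat \<Rightarrow> fock \<Rightarrow> fock) \<Rightarrow> nat \<Rightarrow> fock \<Rightarrow> fock" where
  "series_exp A n f = (\<Sum>l\<le>n. smul (1 / fact l) (series_pow A l n f))"

text \<open>
  The exponents of the two exponentials in \<open>Y\<^sub>t\<^sub>w(e\<^sup>\<beta>, z)\<close>, as power series in \<open>w = z\<^sup>1\<^sup>/\<^sup>2\<close> and
  \<open>w = z\<^sup>-\<^sup>1\<^sup>/\<^sup>2\<close> respectively; the mode number is \<open>k = n/2\<close>.
\<close>

definition creation_exponent :: "nat \<Rightarrow> fock \<Rightarrow> fock" where
  "creation_exponent n f =
     (if odd n then smul (1 / of_rat (of_nat n / 2)) (beta (- (of_nat n / 2)) f) else 0)"

definition annihilation_exponent :: "nat \<Rightarrow> fock \<Rightarrow> fock" where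
  "annihilation_exponent n f =
     (if odd n then smul (- 1 / of_rat (of_nat n / 2)) (beta (of_nat n / 2) f) else 0)"

text \<open>\<open>Ytw j q\<close> is the coefficient of \<open>z\<^sup>q\<close> in \<open>Y\<^sub>t\<^sub>w(e\<^sup>\<beta>, z)\<close>.\<close>

definition Ytw :: "nat \<Rightarrow> rat \<Rightarrow> fock \<Rightarrow> fock" where
  "Ytw j q f = smul (- (2 * \<i>) * (- 1) ^ j)
     (Sum_any (\<lambda>(a, b).
        series_exp creation_exponent a (series_exp annihilation_exponent b f)
          when 1 / 2 + of_nat a / 2 - of_nat b / 2 = q))"

type_synonym tens = "rat set \<times> (rat \<Rightarrow>\<^sub>0 nat) \<Rightarrow>\<^sub>0 complex"

text \<open>
  \<open>X_coeff i j l n\<close> is the coefficient of \<open>z\<^sup>-\<^sup>n\<^sup>-\<^sup>1\<close> in \<open>X\<^sub>+(z) = 1/\<surd>2 G(z) \<otimes> Y\<^sub>t\<^sub>w(e\<^sup>\<beta>, z)\<close>: the summand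
  \<open>G(r) z\<^sup>-\<^sup>r\<^sup>-\<^sup>3\<^sup>/\<^sup>2\<close> is paired with the coefficient of \<open>z\<^sup>q\<close>, where \<open>q = r + 1/2 - n\<close>.  Applied to a
  fixed vector, only finitely many \<open>r\<close> contribute.
\<close>

definition X_coeff :: "nat \<Rightarrow> nat \<Rightarrow> rat \<Rightarrow> rat \<Rightarrow> tens \<Rightarrow> tens" where
  "X_coeff i j l n t = smul (1 / of_real (sqrt 2))
     (Sum_any (\<lambda>r. tensor_map (G i l r) (Ytw j (r + 1 / 2 - n)) t when r \<in> half_ints))"

fun action :: "nat \<Rightarrow> nat \<Rightarrow> rat \<Rightarrow> gen \<Rightarrow> tens \<Rightarrow> tens" where
  "action i j l K t = smul (- 2) t"
| "action i j l (H m) t = smul (- 2) (tensor_map id (beta m) t)"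
| "action i j l (Xminus m) t = smul 2 (X_coeff i j l m t)"
| "action i j l (Xplus r) t = smul 2 (X_coeff i j l r t)"

text \<open>
  The facts below confirm that the concrete spaces are the modules they stand for: \<open>FT\<close> with the
  operators \<open>Phi i\<close> is the irreducible module of the twisted Clifford algebra generated by its vacuum
  vector (\<open>Phi_Clifford\<close>, \<open>Phi_vacuum\<close>, \<open>FT_irreducible\<close>), and the operators \<open>beta k\<close> satisfy the
  Heisenberg relations (\<open>Heisenberg\<close>).
\<close>

lemma lookup_smul [simp]: "Poly_Mapping.lookup (smul c f) a = c * Poly_Mapping.lookup f a"
  by (simp add: smul_def Poly_Mapping.map.rep_eq when_def)

lemma vector_space_smul: "vector_space smul"
  by unfold_locales (auto intro!: poly_mapping_eqI simp: lookup_add algebra_simps)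

lemma smul_simps: "smul c (f + g) = smul c f + smul c g" "smul (c + d) f = smul c f + smul d f"
    "smul c (smul d f) = smul (c * d) f" "smul 0 f = 0" "smul c 0 = 0" "smul 1 f = f"
  by (auto intro!: poly_mapping_eqI simp: lookup_add algebra_simps)

lemma lin_ext_superset:
  assumes "finite A" "Poly_Mapping.keys f \<subseteq> A"
  shows "lin_ext F f = (\<Sum>a\<in>A. smul (Poly_Mapping.lookup f a) (F a))"
  unfolding lin_ext_def
  by (rule sum.mono_neutral_left) (use assms in \<open>auto simp: in_keys_iff smul_simps\<close>)

lemma lin_ext_add: "lin_ext F (f + g) = lin_ext F f + lin_ext F g"
proof -
  let ?A = "Poly_Mapping.keys f \<union> Poly_Mapping.keys g"
  have "Poly_Mapping.keys (f + g) \<subseteq> ?A" by (rule Poly_Mapping.keys_add)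
  then show ?thesis
    by (simp add: lin_ext_superset[of ?A] lookup_add smul_simps sum.distrib)
qed

lemma lin_ext_smul: "lin_ext F (smul c f) = smul c (lin_ext F f)"
proof -
  have "Poly_Mapping.keys (smul c f) \<subseteq> Poly_Mapping.keys f" by (auto simp: in_keys_iff)
  then have "lin_ext F (smul c f) = (\<Sum>a\<in>Poly_Mapping.keys f. smul (c * Poly_Mapping.lookup f a) (F a))"
    by (subst lin_ext_superset[of "Poly_Mapping.keys f"]) auto
  also have "\<dots> = smul c (lin_ext F f)"
    unfolding lin_ext_def
    by (rule poly_mapping_eqI) (simp add: lookup_sum sum_distrib_left mult.assoc)
  finally show ?thesis .
qed

lemma lin_ext_basis_vec: "lin_ext F (basis_vec a) = F a"
  by (simp add: lin_ext_def basis_vec_def smul_simps)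

lemma lin_ext_0: "lin_ext F 0 = 0" by (simp add: lin_ext_def)

lemma lin_ext_sum: "lin_ext F (sum g A) = (\<Sum>a\<in>A. lin_ext F (g a))"
  by (induction A rule: infinite_finite_induct) (auto simp: lin_ext_0 lin_ext_add)

lemma lin_ext_cong:
  assumes "\<And>a. a \<in> Poly_Mapping.keys f \<Longrightarrow> F a = F' a"
  shows "lin_ext F f = lin_ext F' f"
  using assms by (simp add: lin_ext_def)

lemma lin_ext_plus_fun: "lin_ext F f + lin_ext F' f = lin_ext (\<lambda>a. F a + F' a) f"
  by (simp add: lin_ext_def sum.distrib smul_simps)

lemma lin_ext_lin_ext: "lin_ext F (lin_ext F' f) = lin_ext (\<lambda>a. lin_ext F (F' a)) f"
  by (simp add: lin_ext_def[of F' f] lin_ext_sum lin_ext_smul) (simp add: lin_ext_def)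

lemma lin_ext_id: "lin_ext (\<lambda>a. smul c (basis_vec a)) f = smul c f"
proof (rule poly_mapping_eqI)
  fix k
  have "(\<Sum>x\<in>Poly_Mapping.keys f. Poly_Mapping.lookup f x * (c * (if x = k then 1 else 0)))
      = (\<Sum>x\<in>Poly_Mapping.keys f. if x = k then Poly_Mapping.lookup f x * c else 0)"
    by (rule sum.cong) auto
  then show "Poly_Mapping.lookup (lin_ext (\<lambda>a. smul c (basis_vec a)) f) k = Poly_Mapping.lookup (smul c f) k"
    by (simp add: lin_ext_def basis_vec_def lookup_sum lookup_single when_def in_keys_iff)
qed

definition eps :: "rat \<Rightarrow> rat set \<Rightarrow> complex" where "eps r S = (- 1) ^ card {s \<in> S. s < r}"

lemma eps_insert: "finite S \<Longrightarrow> s \<notin> S \<Longrightarrow> eps r (insert s S) = (if s < r then - eps r S else eps r S)"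
proof -
  assume "finite S" "s \<notin> S"
  moreover have "{t \<in> insert s S. t < r} = (if s < r then insert s {t \<in> S. t < r} else {t \<in> S. t < r})" by auto
  ultimately show ?thesis by (simp add: eps_def)
qed

lemma eps_remove: assumes "finite S" "s \<in> S" shows "eps r (S - {s}) = (if s < r then - eps r S else eps r S)"
  using eps_insert[of "S - {s}" s r] assms by (auto simp: insert_absorb split: if_splits)

lemma eps_sq: "eps r S * eps r S = 1" by (simp add: eps_def flip: power_add)

lemma eps_sq': "eps r S * (eps r S * x) = x" by (simp add: eps_sq flip: mult.assoc)

lemma minus1_card_insert: "finite S \<Longrightarrow> s \<notin> S \<Longrightarrow> (- 1::complex) ^ card (insert s S) = - ((- 1) ^ card S)" by simp
lemma minus1_card_remove: "finite S \<Longrightarrow> s \<in> S \<Longrightarrow> (- 1::complex) ^ card (S - {s}) = - ((- 1) ^ card S)"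
  using minus1_card_insert[of "S - {s}" s] by (simp add: insert_absorb)

lemma powi_half: assumes "r \<in> half_ints" shows "(- 1::complex) powi \<lfloor>2 * (- r)\<rfloor> = (- 1) powi \<lfloor>2 * r\<rfloor>"
proof -
  obtain m :: int where m: "2 * r = of_int m" using assms by (auto simp: half_ints_def Ints_def)
  have "2 * (- r) = of_int (- m)" using m by simp
  then show ?thesis using m by (cases "even m") (simp_all add: power_int_minus)
qed

definition kap :: "nat \<Rightarrow> complex" where "kap i = (- 1) ^ i * (1 / (of_real (sqrt 2) * \<i>))"
lemma kap_sq: "kap i * kap i = - 1 / 2"
  by (simp add: kap_def field_simps power2_eq_square flip: power_add of_real_mult) 

lemma Phi_basis_alt: "Phi_basis i r S =
     (if r < 0 then (if r \<in> S then 0 else smul (eps r S) (basis_vec (insert r S)))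
      else if r > 0 then
        (if - r \<in> S then smul (- ((- 1) powi \<lfloor>2 * r\<rfloor>) * eps (- r) S) (basis_vec (S - {- r})) else 0)
      else smul ((- 1) ^ card S * kap i) (basis_vec S))"
  by (simp add: Phi_basis_def eps_def kap_def)

lemma Phi_lin: "Phi i r (smul c f) = smul c (Phi i r f)" "Phi i r 0 = 0" "Phi i r (basis_vec S) = Phi_basis i r S"
  by (simp_all add: Phi_def lin_ext_smul lin_ext_0 lin_ext_basis_vec)

lemma clifford_basis:
  assumes S: "finite S" and r: "r \<in> half_ints" and s: "s \<in> half_ints"
  shows "Phi i r (Phi_basis i s S) + Phi i s (Phi_basis i r S)
    = smul (- ((- 1) powi \<lfloor>2 * r\<rfloor>) when r + s = 0) (basis_vec S)"
proof -
  have p: "(- 1::complex) powi \<lfloor>- (r * 2)\<rfloor> = (- 1) powi \<lfloor>r * 2\<rfloor>" using powi_half[OF r] by (simp add: mult.commute)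
  have add0: "smul a x + smul b x = smul (a + b) x" for a b and x :: ext by (simp add: smul_simps)
  consider "r < 0" "s < 0" | "r < 0" "s = 0" | "r < 0" "s > 0" | "r = 0" "s < 0" | "r = 0" "s = 0" | "r = 0" "s > 0" 
    | "r > 0" "s < 0" | "r > 0" "s = 0" | "r > 0" "s > 0" by linarith
  then show ?thesis
  proof cases
    case 1
    then show ?thesis using S
      by (cases r s rule: linorder_cases)
         (auto simp: Phi_basis_alt Phi_lin smul_simps eps_insert insert_commute add0)
  next
    case 2 then show ?thesis using S
      by (auto simp: Phi_basis_alt Phi_lin smul_simps add0 algebra_simps)
  next
    case 4 then show ?thesis using S
      by (auto simp: Phi_basis_alt Phi_lin smul_simps add0 algebra_simps)
  next
    case 5 
    have "(- 1 :: complex) ^ card S * ((- 1) ^ card S * x) = x" for x by (simp flip: mult.assoc power_add)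
    then show ?thesis using S 5 kap_sq[of i]
      by (simp add: Phi_basis_alt Phi_lin smul_simps add0 algebra_simps)
  next
    case 6 then show ?thesis using S
      by (auto simp: Phi_basis_alt Phi_lin smul_simps add0 algebra_simps minus1_card_remove simp del: card_Diff_insert card_Diff_singleton)
  next
    case 8 then show ?thesis using S
      by (auto simp: Phi_basis_alt Phi_lin smul_simps add0 algebra_simps minus1_card_remove simp del: card_Diff_insert card_Diff_singleton)
  next
    case 9
    have rm: "S - {a} - {b} = S - {b} - {a}" for a b by auto
    from 9 show ?thesis using S
      by (cases r s rule: linorder_cases)
         (auto simp: Phi_basis_alt Phi_lin smul_simps eps_remove rm[of "-r" "-s"] add0 algebra_simps)
  next
    case 3
    show ?thesis
    proof (cases "s = - r")
      case True with 3 S show ?thesis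
        by (cases "r \<in> S") (auto simp: Phi_basis_alt Phi_lin smul_simps eps_remove eps_insert add0 algebra_simps eps_sq eps_sq' insert_absorb p)
    next
      case False
      have "insert r (S - {-s}) = insert r S - {-s}" using False by auto
      with 3 S False show ?thesis
        by (cases r "-s" rule: linorder_cases) (auto simp: Phi_basis_alt Phi_lin smul_simps eps_remove eps_insert add0 algebra_simps)
    qed
  next
    case 7
    show ?thesis
    proof (cases "s = - r")
      case True with 7 S show ?thesis
        by (cases "s \<in> S") (auto simp: Phi_basis_alt Phi_lin smul_simps eps_remove eps_insert add0 algebra_simps eps_sq eps_sq' insert_absorb p)
    next
      case False
      have "insert s (S - {-r}) = insert s S - {-r}" using False by auto
      with 7 S False show ?thesis
        by (cases s "-r" rule: linorder_cases) (auto simp: Phi_basis_alt Phi_lin smul_simps eps_remove eps_insert add0 algebra_simps)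
    qed
  qed
qed

lemma Phi_Clifford:
  assumes "f \<in> FT" "r \<in> half_ints" "s \<in> half_ints"
  shows "Phi i r (Phi i s f) + Phi i s (Phi i r f) = smul (- ((- 1) powi \<lfloor>2 * r\<rfloor>) when r + s = 0) f"
proof -
  have "Phi i r (Phi i s f) + Phi i s (Phi i r f) = lin_ext (\<lambda>S. Phi i r (Phi_basis i s S) + Phi i s (Phi_basis i r S)) f"
    by (simp add: Phi_def lin_ext_lin_ext lin_ext_plus_fun)
  also have "\<dots> = lin_ext (\<lambda>S. smul (- ((- 1) powi \<lfloor>2 * r\<rfloor>) when r + s = 0) (basis_vec S)) f"
    by (rule lin_ext_cong) (use assms in \<open>auto simp: FT_def ext_alg_def intro!: clifford_basis\<close>)
  finally show ?thesis by (simp add: lin_ext_id)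
qed

lemma Phi_vacuum:
  "r > 0 \<Longrightarrow> Phi i r (basis_vec {}) = 0"
  "Phi i 0 (basis_vec {}) = smul ((- 1) ^ i * (1 / (of_real (sqrt 2) * \<i>))) (basis_vec {})"
  by (simp_all add: Phi_lin Phi_basis_def)


lemma FT_irreducible:
  assumes U: "module.subspace smul U" "U \<subseteq> FT" "U \<noteq> {0}"
    and closed: "\<And>r f. r \<in> half_ints \<Longrightarrow> f \<in> U \<Longrightarrow> Phi i r f \<in> U"
  shows "U = FT"
proof -
  interpret vector_space smul by (rule vector_space_smul)
  note sub = subspace_0[OF U(1)] subspace_scale[OF U(1)] subspace_sum[OF U(1)]
  have "\<exists>f\<in>U. f \<noteq> 0" using U(3) sub(1) by auto
  then obtain f where f: "f \<in> U" "f \<noteq> 0" by blast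
  have vac: "basis_vec {} \<in> U"
    if "g \<in> U" "g \<noteq> 0" "\<And>S. S \<in> Poly_Mapping.keys g \<Longrightarrow> card S \<le> n" for g n
    using that
  proof (induction n arbitrary: g)
    case 0
    have keys: "finite S" if "S \<in> Poly_Mapping.keys g" for S
      using that 0(1) U(2) by (auto simp: FT_def ext_alg_def)
    have k: "Poly_Mapping.keys g = {{}}"
    proof -
      have e: "S = {}" if "S \<in> Poly_Mapping.keys g" for S using keys[OF that] 0(3)[OF that] by simp
      have "Poly_Mapping.keys g \<noteq> {}" using 0(2) by simp
      then obtain R where "R \<in> Poly_Mapping.keys g" by blast
      with e[OF this] have "{} \<in> Poly_Mapping.keys g" by simp
      with e show ?thesis by blast
    qed
    have c: "Poly_Mapping.lookup g {} \<noteq> 0" using k by (metis in_keys_iff singletonI)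
    have "basis_vec {} = smul (1 / Poly_Mapping.lookup g {}) g"
    proof (rule poly_mapping_eqI)
      fix S
      have "S \<noteq> {} \<Longrightarrow> Poly_Mapping.lookup g S = 0" using k by (metis in_keys_iff singletonD)
      then show "Poly_Mapping.lookup (basis_vec {}) S = Poly_Mapping.lookup (smul (1 / Poly_Mapping.lookup g {}) g) S"
        using c by (cases "S = {}") (simp_all add: basis_vec_def lookup_single)
    qed
    then show ?case using sub(2)[OF 0(1)] by simp
  next
    case (Suc n)
    have keys: "finite S" "S \<subseteq> {r \<in> half_ints. r < 0}" if "S \<in> Poly_Mapping.keys g" for S
      using that Suc(2) U(2) by (auto simp: FT_def ext_alg_def)
    show ?case
    proof (cases "\<forall>S\<in>Poly_Mapping.keys g. card S \<le> n")
      case True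
      then show ?thesis using Suc by auto
    next
      case False
      then obtain S where S: "S \<in> Poly_Mapping.keys g" "card S > n" by auto
      then have "S \<noteq> {}" by auto
      then obtain s where s: "s \<in> S" by blast
      have s0: "s < 0" "- s \<in> half_ints" using s keys[OF S(1)] by (auto simp: half_ints_def)
      let ?h = "Phi i (- s) g"
      have lk: "Poly_Mapping.lookup ?h T = (\<Sum>R\<in>Poly_Mapping.keys g. Poly_Mapping.lookup g R *
          (if s \<in> R \<and> T = R - {s} then - ((- 1) powi \<lfloor>2 * (- s)\<rfloor>) * eps s R else 0))" for T
        unfolding Phi_def lin_ext_def lookup_sum
        by (rule sum.cong) (use s0 in \<open>auto simp: Phi_basis_alt basis_vec_def lookup_single when_def\<close>)
      have "Poly_Mapping.lookup ?h (S - {s}) = (\<Sum>R\<in>{S}. Poly_Mapping.lookup g R *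
          (if s \<in> R \<and> S - {s} = R - {s} then - ((- 1) powi \<lfloor>2 * (- s)\<rfloor>) * eps s R else 0))"
        unfolding lk by (rule sum.mono_neutral_right) (use S s in auto)
      also have "\<dots> \<noteq> 0" using S s by (simp add: eps_def in_keys_iff)
      finally have "?h \<noteq> 0" by auto
      moreover have "?h \<in> U" using closed s0 Suc by blast
      moreover have "card T \<le> n" if T: "T \<in> Poly_Mapping.keys ?h" for T
      proof -
        have "Poly_Mapping.lookup ?h T \<noteq> 0" using T by (simp add: in_keys_iff)
        then obtain R where "R \<in> Poly_Mapping.keys g" "s \<in> R" "T = R - {s}"
          unfolding lk by (rule sum.not_neutral_contains_not_neutral) (simp split: if_splits)
        then show ?thesis using Suc(4)[of R] keys[of R] by simp
      qed
      ultimately show ?thesis using Suc(1) by blast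
    qed
  qed
  have "card S \<le> Max (card ` Poly_Mapping.keys f)" if "S \<in> Poly_Mapping.keys f" for S
    using that by simp
  then have 1: "basis_vec {} \<in> U" by (rule vac[OF f])
  have 2: "basis_vec S \<in> U" if "finite S" "S \<subseteq> {r \<in> half_ints. r < 0}" for S
    using that
  proof (induction S rule: finite_induct)
    case empty show ?case by (rule 1)
  next
    case (insert s S)
    then have "smul (eps s S) (Phi i s (basis_vec S)) \<in> U" by (intro sub(2) closed) auto
    then show ?case using insert by (simp add: Phi_lin Phi_basis_alt smul_simps eps_sq)
  qed
  show ?thesis
  proof (rule antisym[OF U(2)], rule subsetI)
    fix g assume g: "g \<in> FT"
    have "g = lin_ext basis_vec g" using lin_ext_id[of 1 g] by (simp add: smul_simps)
    also have "\<dots> \<in> U" unfolding lin_ext_def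
      by (intro sub(3) sub(2) 2) (use g in \<open>auto simp: FT_def ext_alg_def\<close>)
    finally show "g \<in> U" .
  qed
qed

lemma basis_vec_mult: "basis_vec a * basis_vec b = (basis_vec (a + b) :: fock)"
  by (simp add: basis_vec_def mult_single)

lemma mult_lin_ext: "(basis_vec m :: fock) * f = lin_ext (\<lambda>a. basis_vec (m + a)) f"
proof -
  have f: "f = lin_ext basis_vec f" using lin_ext_id[of 1 f] by (simp add: smul_simps)
  have "smul c g = Poly_Mapping.single 0 c * g" for c and g :: fock
    by (simp add: smul_def mult_map_scale_conv_mult)
  then have "(basis_vec m :: fock) * smul c g = smul c (basis_vec m * g)" for c g
    by (simp add: mult.left_commute)
  then show ?thesis
    by (subst f) (simp add: lin_ext_def[of basis_vec] lin_ext_def[of "\<lambda>a. basis_vec (m + a)"] sum_distrib_left basis_vec_mult)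
qed

lemma Heisenberg:
  assumes "k \<in> half_odds" "l \<in> half_odds"
  shows "beta k (beta l f) - beta l (beta k f) = smul (of_rat (- k) when k + l = 0) f"
proof -
  have nz: "k \<noteq> 0" "l \<noteq> 0" using assms by (auto simp: half_odds_def)
  let ?s = "\<lambda>k. Poly_Mapping.single k (1::nat)"
  have lin: "smul c (lin_ext F f) = lin_ext (\<lambda>a. smul c (F a)) f" for c f and F :: "_ \<Rightarrow> fock"
    by (rule poly_mapping_eqI) (simp add: lin_ext_def lookup_sum sum_distrib_left mult_ac)
  have b: "beta k f = lin_ext (\<lambda>m. if k < 0 then basis_vec (?s (- k) + m) else 
      smul (of_rat (- k) * of_nat (Poly_Mapping.lookup m k)) (basis_vec (m - ?s k))) f" for k f
    by (simp add: beta_def mult_lin_ext pderiv_var_def lin smul_simps)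
  have diff: "lin_ext F f - lin_ext F' f = lin_ext (\<lambda>a. F a - F' a) f" for F F' :: "_ \<Rightarrow> fock"
    by (rule poly_mapping_eqI) (simp add: lin_ext_def lookup_sum lookup_minus sum_subtractf algebra_simps)
  have key: "beta k (beta l f) - beta l (beta k f) = lin_ext (\<lambda>m. smul (of_rat (- k) when k + l = 0) (basis_vec m)) f"
    unfolding b lin_ext_lin_ext diff
  proof (rule lin_ext_cong, goal_cases)
    case (1 m)
    define B where "B = (\<lambda>k m. if k < 0 then basis_vec (?s (- k) + m)
      else smul (of_rat (- k) * of_nat (Poly_Mapping.lookup m k)) (basis_vec (m - ?s k)) :: fock)"
    have mixed: "lin_ext (B p) (B q m) - lin_ext (B q) (B p m) = smul (of_rat (- p) when p + q = 0) (basis_vec m)"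
      if "p < 0" "q > 0" for p q
    proof (cases "q = - p")
      case True
      have 1: "?s q + m - ?s q = m" by simp
      have 2: "smul (c * of_nat (Poly_Mapping.lookup m q)) (basis_vec (?s q + (m - ?s q)))
          = smul (c * of_nat (Poly_Mapping.lookup m q)) (basis_vec m :: fock)" for c
      proof (cases "Poly_Mapping.lookup m q = 0")
        case False
        then have "?s q + (m - ?s q) = m"
          by (intro poly_mapping_eqI) (auto simp: lookup_add lookup_minus lookup_single when_def)
        then show ?thesis by simp
      qed (simp add: smul_simps)
      have 3: "smul x g - smul y g = smul (x - y) g" for x y and g :: fock
        by (rule poly_mapping_eqI) (simp add: lookup_minus algebra_simps)
      have "lin_ext (B p) (B q m) = smul (of_rat (- q) * of_nat (Poly_Mapping.lookup m q)) (basis_vec m)"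
        using that True 2[of "of_rat (- q)"] by (simp add: B_def lin_ext_smul lin_ext_basis_vec)
      moreover have "lin_ext (B q) (B p m) = smul (of_rat (- q) * of_nat (Suc (Poly_Mapping.lookup m q))) (basis_vec m)"
        using that True 1 by (simp add: B_def lin_ext_smul lin_ext_basis_vec lookup_add)
      ultimately show ?thesis using True by (simp add: 3 of_rat_minus algebra_simps)
    next
      case False
      have "?s (- p) + (m - ?s q) = ?s (- p) + m - ?s q" using False
        by (intro poly_mapping_eqI) (auto simp: lookup_add lookup_minus lookup_single when_def)
      moreover have "p + q \<noteq> 0" using False by simp
      moreover have "Poly_Mapping.lookup (?s (- p) + m) q = Poly_Mapping.lookup m q"
        using False by (simp add: lookup_add lookup_single when_def)
      ultimately show ?thesis using that
        by (simp add: B_def lin_ext_smul lin_ext_basis_vec smul_simps)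
    qed
    have "lin_ext (B k) (B l m) - lin_ext (B l) (B k m) = smul (of_rat (- k) when k + l = 0) (basis_vec m)"
    proof -
      consider "k < 0" "l < 0" | "k < 0" "l > 0" | "k > 0" "l < 0" | "k > 0" "l > 0" using nz by linarith
      then show ?thesis
      proof cases
        case 1
        then show ?thesis by (simp add: B_def lin_ext_basis_vec add.left_commute smul_simps)
      next
        case 2
        then show ?thesis by (rule mixed)
      next
        case 3
        have "lin_ext (B k) (B l m) - lin_ext (B l) (B k m) = smul (- (of_rat (- l) when l + k = 0)) (basis_vec m)"
          using mixed[OF 3(2,1)]
          by (simp add: poly_mapping_eq_iff fun_eq_iff lookup_minus) (metis minus_diff_eq)
        moreover have "- (of_rat (- l) when l + k = 0) = (of_rat (- k) when k + l = 0 :: complex)"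
          by (auto simp: when_def of_rat_minus add_eq_0_iff)
        ultimately show ?thesis by simp
      next
        case 4
        have "m - ?s k - ?s l = m - ?s l - ?s k"
          by (intro poly_mapping_eqI) (simp add: lookup_minus)
        then show ?thesis using 4
          by (cases "k = l") (simp_all add: B_def lin_ext_smul lin_ext_basis_vec lookup_minus lookup_single smul_simps mult_ac)
      qed
    qed
    then show ?case by (simp add: B_def)
  qed
  then show ?thesis by (simp add: lin_ext_id)
qed

end

theory Submission
  imports Defs "HOL-Library.Product_Plus"
begin

text \<open>
  The modes \<open>X M\<close> of \<open>X\<^sub>+(z)\<close> satisfy \<open>[\<beta>(k), X(z)] = - z\<^sup>k X(z)\<close>, so the difference between \<open>[X M, X N]\<close> and
  the prescribed bracket is controlled by its vacuum expectation in the Fock factor.  There the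
  contraction \<open>(1 + t) / (1 - t)\<close> of the two vertex operators, with \<open>t\<^sup>2 = w/z\<close>, turns the anticommutators
  of the \<open>G(r)\<close> into a finite alternating sum, from which \<open>\<lambda>\<close> drops out.

  An invariant subspace has the form \<open>U\<^sub>0 \<otimes> Fock\<close> because it is stable under the Heisenberg modes, and
  reading off the lowest term of \<open>X(z) (f \<otimes> 1)\<close> shows that \<open>U\<^sub>0\<close> is stable under all \<open>G(r)\<close>.  As \<open>G(r)\<close>
  is a nonzero multiple of \<open>\<Phi>(r)\<close> for \<open>r \<noteq> \<lambda> - 1/2\<close>, \<open>U\<^sub>0\<close> is \<open>0\<close> or everything.

  For the uniqueness, the submodule of the product generated by the pair of highest weight vectors
  meets the kernel of the degree operator only in the multiples of that pair, hence it contains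
  neither factor and is the graph of an isomorphism.
\<close>

text \<open>The index \<open>l - 1 / 2\<close> governs both the space and its irreducibility:
  \<open>G(l - 1/2)\<close> vanishes, so no \<open>G(r)\<close> can create the index that the kernel
  of \<open>\<Phi>(1/2 - l)\<close> omits, while every other creation mode survives together with
  its annihilation partner. The hypothesis \<open>l < 1 / 2\<close> makes \<open>l - 1 / 2\<close> a
  creation mode. The constants come from the prefactor of the vertex operator: the square of
  \<open>2 * \<i> / sqrt 2\<close> is \<open>- 2\<close>, which matches the level, and its product
  with the eigenvalue of \<open>\<Phi>(0)\<close> is 1 up to a sign that depends on the parity of
  \<open>i + j\<close>. This sign decides between the two weights. Up to the factor 2, the even and
  odd modes of \<open>X(z)\<close> are the operators of \<open>Xplus\<close> and
  \<open>Xminus\<close>, so a single commutator formula for all \<open>X N\<close> covers the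
  brackets among them. The degree operator of an abstract module is not assumed to be
  diagonalizable. Projections to its eigenspaces are therefore replaced by polynomials in
  it.\<close>

section \<open>Uniqueness of graded highest weight modules\<close>

text \<open>\<open>gen\<close> has labels outside \<open>basis\<close>, where nothing is assumed
  about a module. Brackets stay inside because two half-odd modes add up to an integer.\<close>

lemma bracket_keys_basis:
  assumes "x \<in> basis" "y \<in> basis" "g \<in> Poly_Mapping.keys (bracket x y)"
  shows "g \<in> basis"
proof -
  have i: "m + n \<in> \<int>" if "m \<in> half_odds" "n \<in> half_odds" for m n
  proof -
    have "2 * m \<in> \<int>" "2 * n \<in> \<int>" using that by (auto simp: half_odds_def half_ints_def)
    then obtain p q :: int where pq: "2 * m = of_int p" "2 * n = of_int q" by (metis Ints_cases)
    have odd: "odd p" if "2 * m = of_int p" "m \<notin> \<int>" for p :: int and m :: rat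
    proof
      assume "even p"
      then obtain c where "p = 2 * c" by (elim evenE)
      with that have "m = of_int c" by simp
      with that(2) show False by simp
    qed
    have "even (p + q)" using odd[OF pq(1)] odd[OF pq(2)] that by (simp add: half_odds_def)
    then obtain c where "p + q = 2 * c" by (elim evenE)
    then have "2 * (m + n) = 2 * of_int c" using pq by (metis distrib_left of_int_add of_int_mult of_int_numeral)
    then have "m + n = of_int c" by simp
    then show ?thesis by simp
  qed
  have o: "m + r \<in> half_odds" if "m \<in> half_odds" "r \<in> \<int>" for m r
  proof -
    have "2 * m + 2 * r \<in> \<int>" using that by (auto simp: half_odds_def half_ints_def)
    moreover have "m + r \<notin> \<int>" using that Ints_diff[of "m + r" r] by (auto simp: half_odds_def)
    ultimately show ?thesis by (simp add: half_odds_def half_ints_def distrib_left)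
  qed
  show ?thesis
    using assms
    by (cases x; cases y) (auto simp: basis_def when_def i o split: if_splits)
qed

text \<open>Words in negative modes applied to \<open>v\<close>, as in the spanning half of the
  Poincare-Birkhoff-Witt theorem. The letters come in any order, because only the span of the words
  matters.\<close>

inductive_set neg_words ::
    "(gen \<Rightarrow> 'v \<Rightarrow> 'v) \<Rightarrow> 'v \<Rightarrow> 'v set" for \<rho> v where
  vac: "v \<in> neg_words \<rho> v"
| word: "x \<in> basis \<Longrightarrow> mode x < 0 \<Longrightarrow> w \<in> neg_words \<rho> v \<Longrightarrow> \<rho> x w \<in> neg_words \<rho> v"

context twisted_sl2_module
begin

lemma \<rho>_0: "x \<in> basis \<Longrightarrow> \<rho> x 0 = 0"
  using \<rho>_scale[of x 0 0] subspace_0[OF subspace_V] by simp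

lemma \<rho>_span:
  assumes x: "x \<in> basis" and W: "W \<subseteq> V" and U: "subspace U" "\<And>w. w \<in> W \<Longrightarrow> \<rho> x w \<in> U" and u: "u \<in> span W"
  shows "\<rho> x u \<in> U"
proof -
  \<comment> \<open>\<open>\<rho> x\<close> is linear on \<open>V\<close> only, so membership in
    \<open>V\<close> is carried along in the induction.\<close>
  have "u \<in> V \<and> \<rho> x u \<in> U"
    using u
  proof (induction rule: span_induct_alt)
    case base then show ?case using x \<rho>_0 subspace_0[OF U(1)] subspace_0[OF subspace_V] by simp
  next
    case (step c w u)
    then have "w \<in> V" "u \<in> V" "\<rho> x u \<in> U" "\<rho> x w \<in> U" using W U(2) by auto
    then show ?case
      using x subspace_add[OF subspace_V] subspace_add[OF U(1)]
      by (simp add: \<rho>_add \<rho>_scale subspace_scale[OF subspace_V] subspace_scale[OF U(1)])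
  qed
  then show ?thesis by blast
qed

lemma neg_words_V:
  assumes "v \<in> V" shows "neg_words \<rho> v \<subseteq> V"
proof
  fix w assume "w \<in> neg_words \<rho> v"
  then show "w \<in> V" by induction (auto simp: assms \<rho>_closed)
qed

text \<open>A generator of non-negative mode is commuted past the word; the commutators act on shorter words.\<close>

lemma neg_words_closed:
  assumes v: "v \<in> V" "\<And>x. x \<in> basis \<Longrightarrow> mode x \<ge> 0 \<Longrightarrow> \<rho> x v \<in> span {v}"
    and w: "w \<in> neg_words \<rho> v" and x: "x \<in> basis"
  shows "\<rho> x w \<in> span (neg_words \<rho> v)"
  using w x
proof (induction arbitrary: x)
  case vac
  show ?case
  proof (cases "mode x < 0")
    case True
    then show ?thesis using vac by (intro span_base neg_words.word neg_words.vac)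
  next
    case False
    then have "\<rho> x v \<in> span {v}" using v(2) vac by simp
    moreover have "span {v} \<subseteq> span (neg_words \<rho> v)" by (rule span_mono) (simp add: neg_words.vac)
    ultimately show ?thesis by blast
  qed
next
  case (word y w)
  note NV = neg_words_V[OF v(1)]
  have wV: "w \<in> V" using word NV by blast
  have "\<rho> x (\<rho> y w) = \<rho> y (\<rho> x w) +
      (\<Sum>g\<in>Poly_Mapping.keys (bracket x y). sc (Poly_Mapping.lookup (bracket x y) g) (\<rho> g w))"
    using \<rho>_bracket[OF word.prems word.hyps(1) wV] by (simp add: algebra_simps)
  moreover have "\<rho> y (\<rho> x w) \<in> span (neg_words \<rho> v)"
    by (rule \<rho>_span[OF word.hyps(1) NV subspace_span _ word.IH[OF word.prems]])
      (auto intro: span_base neg_words.word word.hyps)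
  moreover have "\<rho> g w \<in> span (neg_words \<rho> v)" if "g \<in> Poly_Mapping.keys (bracket x y)" for g
    using word.IH bracket_keys_basis[OF word.prems word.hyps(1) that] by blast
  ultimately show ?case by (auto intro!: span_add span_sum span_scale)
qed

lemma submodule_span_neg_words:
  assumes v: "v \<in> V" "\<And>x. x \<in> basis \<Longrightarrow> mode x \<ge> 0 \<Longrightarrow> \<rho> x v \<in> span {v}"
  shows "submodule sc V \<rho> (span (neg_words \<rho> v))"
  unfolding submodule_def
  using span_minimal[OF neg_words_V[OF v(1)] subspace_V] \<rho>_span[OF _ neg_words_V[OF v(1)] subspace_span]
    neg_words_closed[OF v] by blast

end

text \<open>Products of factors \<open>D - q\<close> with \<open>q < 0\<close> annihilate the span of the words of negative degree
  but are injective on the kernel of \<open>D\<close>.\<close>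

locale degree_module = twisted_sl2_module sc V \<rho>
  for sc :: "complex \<Rightarrow> 'v::ab_group_add \<Rightarrow> 'v" and V \<rho> +
  fixes D :: "'v \<Rightarrow> 'v"
  assumes D_V: "u \<in> V \<Longrightarrow> D u \<in> V"
    and D_add: "u \<in> V \<Longrightarrow> w \<in> V \<Longrightarrow> D (u + w) = D u + D w"
    and D_scale: "u \<in> V \<Longrightarrow> D (sc c u) = sc c (D u)"
    and D_\<rho>: "x \<in> basis \<Longrightarrow> u \<in> V \<Longrightarrow> D (\<rho> x u) - \<rho> x (D u) = sc (of_rat (mode x)) (\<rho> x u)"
begin

definition shift :: "complex \<Rightarrow> 'v \<Rightarrow> 'v" where "shift q u = D u - sc q u"

lemma shift_V: "u \<in> V \<Longrightarrow> shift q u \<in> V"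
  by (simp add: shift_def subspace_diff[OF subspace_V] D_V subspace_scale[OF subspace_V])

lemma D_minus: "u \<in> V \<Longrightarrow> D (- u) = - D u"
  using D_scale[of u "- 1"] by simp

lemma D_diff: "u \<in> V \<Longrightarrow> w \<in> V \<Longrightarrow> D (u - w) = D u - D w"
  using D_add[of u "- w"] D_minus[of w] subspace_neg[OF subspace_V, of w] by simp

lemma shift_commute: "u \<in> V \<Longrightarrow> shift p (shift q u) = shift q (shift p u)"
  by (simp add: shift_def D_diff D_V D_scale subspace_scale[OF subspace_V] algebra_simps scale_right_diff_distrib mult.commute)

lemma shift_add: "u \<in> V \<Longrightarrow> w \<in> V \<Longrightarrow> shift q (u + w) = shift q u + shift q w"
  by (simp add: shift_def D_add algebra_simps)

lemma shift_scale: "u \<in> V \<Longrightarrow> shift q (sc c u) = sc c (shift q u)"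
  by (simp add: shift_def D_scale scale_right_diff_distrib mult.commute)

text \<open>A polynomial in \<open>D\<close> represented by the list of its roots; concatenation of
  lists is multiplication.\<close>

definition shifts :: "complex list \<Rightarrow> 'v \<Rightarrow> 'v" where "shifts qs = fold shift qs"

lemma shifts_simps [simp]: "shifts [] u = u" "shifts (q # qs) u = shifts qs (shift q u)"
    "shifts (ps @ qs) u = shifts qs (shifts ps u)"
  by (simp_all add: shifts_def)

lemma shifts_V: "u \<in> V \<Longrightarrow> shifts qs u \<in> V"
  by (induction qs arbitrary: u) (auto simp: shift_V)

lemma shifts_add: "u \<in> V \<Longrightarrow> w \<in> V \<Longrightarrow> shifts qs (u + w) = shifts qs u + shifts qs w"
  by (induction qs arbitrary: u w) (auto simp: shift_V shift_add)

lemma shifts_scale: "u \<in> V \<Longrightarrow> shifts qs (sc c u) = sc c (shifts qs u)"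
  by (induction qs arbitrary: u) (auto simp: shift_V shift_scale)

lemma shifts_0: "shifts qs 0 = 0"
  using shifts_scale[of 0 qs 0] subspace_0[OF subspace_V] by simp

lemma shifts_commute: "u \<in> V \<Longrightarrow> shifts ps (shifts qs u) = shifts qs (shifts ps u)"
proof (induction qs arbitrary: u)
  case (Cons q qs)
  have "shifts ps (shift q u) = shift q (shifts ps u)" if "u \<in> V" for u
    using that
  proof (induction ps arbitrary: u)
    case (Cons a ps)
    then show ?case by (simp add: shift_V shift_commute[of u a q])
  qed simp
  with Cons show ?case by (simp add: shift_V)
qed simp

lemma shifts_kernel: "D u = 0 \<Longrightarrow> u \<in> V \<Longrightarrow> shifts qs u = sc (prod_list (map uminus qs)) u"
proof (induction qs)
  case (Cons q qs)
  have "shift q u = sc (- q) u" using Cons by (simp add: shift_def)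
  with Cons show ?case by (simp only: shifts_simps list.map prod_list.Cons shifts_scale scale_scale mult.commute)
qed simp

text \<open>The root 0 is excluded because the factor \<open>D\<close> would kill the kernel of
  \<open>D\<close>. Sums stay inside since the root lists of two summands can be
  concatenated.\<close>

definition negative_part :: "'v set" where
  "negative_part = {u \<in> V. \<exists>qs. 0 \<notin> set qs \<and> shifts qs u = 0}"

lemma subspace_negative_part: "subspace negative_part"
proof (rule subspaceI)
  show "0 \<in> negative_part" using subspace_0[OF subspace_V] by (auto simp: negative_part_def shifts_0 intro!: exI[of _ "[]"])
next
  fix u w assume "u \<in> negative_part" "w \<in> negative_part"
  then obtain ps qs where *: "u \<in> V" "w \<in> V" "0 \<notin> set ps" "0 \<notin> set qs" "shifts ps u = 0" "shifts qs w = 0"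
    by (auto simp: negative_part_def)
  then have "shifts (ps @ qs) (u + w) = 0"
    using shifts_commute[of w qs ps] by (simp add: shifts_add shifts_V shifts_0)
  with * show "u + w \<in> negative_part"
    by (auto simp: negative_part_def subspace_add[OF subspace_V] simp del: shifts_simps intro!: exI[of _ "ps @ qs"])
next
  fix c u assume "u \<in> negative_part"
  then show "sc c u \<in> negative_part"
    by (auto simp: negative_part_def subspace_scale[OF subspace_V] shifts_scale)
qed

lemma negative_part_kernel:
  assumes "u \<in> negative_part" "D u = 0" shows "u = 0"
proof -
  obtain qs where qs: "0 \<notin> set qs" "shifts qs u = 0" and u: "u \<in> V"
    using assms(1) by (auto simp: negative_part_def)
  have "prod_list (map uminus qs) \<noteq> 0" using qs(1) by (induction qs) auto
  moreover have "sc (prod_list (map uminus qs)) u = 0" using shifts_kernel[OF assms(2) u, of qs] qs(2) by simp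
  ultimately show ?thesis by (simp add: scale_eq_0_iff)
qed

lemma neg_words_degree:
  assumes v: "v \<in> V" "D v = 0" and w: "w \<in> neg_words \<rho> v"
  shows "w = v \<or> (\<exists>q<0. D w = sc (of_rat q) w)"
  using w
proof induction
  case vac show ?case by simp
next
  case (word x w)
  have wV: "w \<in> V" using word neg_words_V[OF v(1)] by blast
  have "\<exists>q\<le>0. D w = sc (of_rat q) w"
    using word.IH v by (metis less_imp_le of_rat_0 order_refl scale_zero_left)
  then obtain q where q: "q \<le> 0" "D w = sc (of_rat q) w" by blast
  have "D (\<rho> x w) = sc (of_rat (q + mode x)) (\<rho> x w)"
    using D_\<rho>[OF word.hyps(1) wV] q(2) wV word.hyps(1)
    by (simp add: \<rho>_scale of_rat_add scale_left_distrib algebra_simps)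
  moreover have "q + mode x < 0" using q word.hyps(2) by linarith
  ultimately show ?case by blast
qed

text \<open>Splitting off the multiples of \<open>v\<close> from a combination of words leaves a
  vector of \<open>negative_part\<close>. It inherits the property of being killed by
  \<open>D\<close>, and must then vanish.\<close>

lemma span_neg_words_kernel:
  assumes v: "v \<in> V" "D v = 0" and u: "u \<in> span (neg_words \<rho> v)" "D u = 0"
  shows "\<exists>c. u = sc c v"
proof -
  have "\<exists>c n. u = sc c v + n \<and> n \<in> negative_part"
    using u(1)
  proof (induction rule: span_induct_alt)
    case base
    then show ?case using subspace_0[OF subspace_negative_part] by (auto intro!: exI[of _ 0])
  next
    case (step a w u)
    then obtain c n where cn: "u = sc c v + n" "n \<in> negative_part" by blast
    from neg_words_degree[OF v step(1)] show ?case
    proof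
      assume "w = v"
      then have "sc a w + u = sc (a + c) v + n" using cn by (simp add: scale_left_distrib algebra_simps)
      with cn show ?thesis by blast
    next
      assume "\<exists>q<0. D w = sc (of_rat q) w"
      then obtain q where "q < 0" "D w = sc (of_rat q) w" by blast
      moreover have "w \<in> V" using step neg_words_V[OF v(1)] by blast
      ultimately have "w \<in> negative_part"
        by (auto simp: negative_part_def shift_def intro!: exI[of _ "[of_rat q]"])
      then have "sc a w + n \<in> negative_part"
        using cn by (intro subspace_add[OF subspace_negative_part] subspace_scale[OF subspace_negative_part])
      moreover have "sc a w + u = sc c v + (sc a w + n)" using cn by (simp add: algebra_simps)
      ultimately show ?thesis by blast
    qed
  qed
  then obtain c n where cn: "u = sc c v + n" "n \<in> negative_part" by blast
  have nV: "n \<in> V" using cn by (simp add: negative_part_def)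
  have "D n = 0" using u(2) v nV by (simp add: cn D_add D_scale subspace_scale[OF subspace_V])
  with cn negative_part_kernel[of n] show ?thesis by auto
qed

end

section \<open>Two graded irreducible modules with the same highest weight\<close>

lemma highest_weight_isomorphism:
  fixes sc :: "complex \<Rightarrow> 'v::ab_group_add \<Rightarrow> 'v" and sc' :: "complex \<Rightarrow> 'w::ab_group_add \<Rightarrow> 'w"
  assumes irr: "irreducible_module sc V \<rho>" "irreducible_module sc' V' \<rho>'"
    and k: "\<And>u. u \<in> V \<Longrightarrow> \<rho> K u = sc k u" "\<And>u. u \<in> V' \<Longrightarrow> \<rho>' K u = sc' k u"
    and hw: "highest_weight_vector sc V \<rho> a v" "highest_weight_vector sc' V' \<rho>' a v'"
    and deg: "has_degree_operator sc V \<rho> v" "has_degree_operator sc' V' \<rho>' v'"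
  shows "module_iso sc V \<rho> sc' V' \<rho>'"
proof -
  interpret M: twisted_sl2_module sc V \<rho> using irr(1) by (simp add: irreducible_module_def)
  interpret M': twisted_sl2_module sc' V' \<rho>' using irr(2) by (simp add: irreducible_module_def)
  obtain D where D: "\<forall>u\<in>V. D u \<in> V" "\<forall>u\<in>V. \<forall>w\<in>V. D (u + w) = D u + D w" "\<forall>c. \<forall>u\<in>V. D (sc c u) = sc c (D u)"
    "\<forall>x\<in>basis. \<forall>u\<in>V. D (\<rho> x u) - \<rho> x (D u) = sc (of_rat (mode x)) (\<rho> x u)" "D v = 0"
    using deg(1) unfolding has_degree_operator_def by blast
  obtain D' where D': "\<forall>u\<in>V'. D' u \<in> V'" "\<forall>u\<in>V'. \<forall>w\<in>V'. D' (u + w) = D' u + D' w" "\<forall>c. \<forall>u\<in>V'. D' (sc' c u) = sc' c (D' u)"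
    "\<forall>x\<in>basis. \<forall>u\<in>V'. D' (\<rho>' x u) - \<rho>' x (D' u) = sc' (of_rat (mode x)) (\<rho>' x u)" "D' v' = 0"
    using deg(2) unfolding has_degree_operator_def by blast
  have v: "v \<in> V" "v \<noteq> 0" "\<And>x. x \<in> basis \<Longrightarrow> mode x > 0 \<Longrightarrow> \<rho> x v = 0" "\<rho> (Xplus 0) v = sc a v"
    using hw(1) by (auto simp: highest_weight_vector_def)
  have v': "v' \<in> V'" "v' \<noteq> 0" "\<And>x. x \<in> basis \<Longrightarrow> mode x > 0 \<Longrightarrow> \<rho>' x v' = 0" "\<rho>' (Xplus 0) v' = sc' a v'"
    using hw(2) by (auto simp: highest_weight_vector_def)
  define scp where "scp = (\<lambda>c (u, w). (sc c u, sc' c w))"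
  define \<rho>p where "\<rho>p = (\<lambda>x (u, w). (\<rho> x u, \<rho>' x w))"
  have vs: "vector_space scp"
    by unfold_locales (auto simp: scp_def M.scale_right_distrib M'.scale_right_distrib M.scale_left_distrib M'.scale_left_distrib)
  interpret P: vector_space scp by (rule vs)
  have VV: "P.subspace (V \<times> V')"
    by (rule P.subspaceI) (auto simp: scp_def zero_prod_def M.subspace_0[OF M.subspace_V] M'.subspace_0[OF M'.subspace_V]
        M.subspace_add[OF M.subspace_V] M'.subspace_add[OF M'.subspace_V]
        M.subspace_scale[OF M.subspace_V] M'.subspace_scale[OF M'.subspace_V])
  interpret P: degree_module scp "V \<times> V'" \<rho>p "map_prod D D'"
  proof (unfold_locales, goal_cases)
    case 1 show ?case by (rule VV)
  next
    case 5
    then show ?case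
      by (auto simp: \<rho>p_def scp_def case_prod_unfold prod_eq_iff fst_sum snd_sum M.\<rho>_bracket M'.\<rho>_bracket)
  qed (use D D' in \<open>auto simp: \<rho>p_def scp_def M.\<rho>_closed M'.\<rho>_closed M.\<rho>_add M'.\<rho>_add M.\<rho>_scale M'.\<rho>_scale\<close>)
  define W where "W = P.span (neg_words \<rho>p (v, v'))"
  \<comment> \<open>\<open>K\<close> and \<open>Xplus 0\<close> are the only basis elements of mode
    0. That both modules have the same \<open>k\<close> and the same \<open>a\<close> keeps the pair
    on its own line.\<close>
  have zero_mode: "\<rho>p x (v, v') \<in> P.span {(v, v')}" if x: "x \<in> basis" "mode x \<ge> 0" for x
  proof (cases "mode x > 0")
    case True
    then show ?thesis using v v' x P.span_zero by (simp add: \<rho>p_def zero_prod_def)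
  next
    case False
    then have "x = K \<or> x = Xplus 0" using x by (auto simp: basis_def half_odds_def)
    then have "\<rho>p x (v, v') = scp k (v, v') \<or> \<rho>p x (v, v') = scp a (v, v')"
      using v v' k by (auto simp: \<rho>p_def scp_def)
    then show ?thesis using P.span_scale[OF P.span_base[of "(v, v')" "{(v, v')}"]] by auto
  qed
  have vv: "(v, v') \<in> V \<times> V'" "map_prod D D' (v, v') = 0" using v v' D D' by (auto simp: zero_prod_def)
  have W: "submodule scp (V \<times> V') \<rho>p W"
    unfolding W_def by (rule P.submodule_span_neg_words[OF vv(1) zero_mode])
  then have Wsub: "P.subspace W" "W \<subseteq> V \<times> V'" "\<And>x p. x \<in> basis \<Longrightarrow> p \<in> W \<Longrightarrow> \<rho>p x p \<in> W"
    by (auto simp: submodule_def)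
  have vW: "(v, v') \<in> W" unfolding W_def by (rule P.span_base) (rule neg_words.vac)
  have Wadd: "(u + w, u' + w') \<in> W" if "(u, u') \<in> W" "(w, w') \<in> W" for u u' w w'
    using P.subspace_add[OF Wsub(1) that] by simp
  have Wscale: "(sc c u, sc' c u') \<in> W" if "(u, u') \<in> W" for c u u'
    using P.subspace_scale[OF Wsub(1) that, of c] by (simp add: scp_def)
  have W\<rho>: "(\<rho> x u, \<rho>' x u') \<in> W" if "x \<in> basis" "(u, u') \<in> W" for x u u'
    using Wsub(3)[OF that] by (simp add: \<rho>p_def)
  have W0: "(0, 0) \<in> W" using P.subspace_0[OF Wsub(1)] by (simp add: zero_prod_def)
  have V0: "0 \<in> V" "0 \<in> V'" using M.subspace_0[OF M.subspace_V] M'.subspace_0[OF M'.subspace_V] .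
  have sub1: "{u. \<exists>u'. (u, u') \<in> W} = V"
  proof -
    have "submodule sc V \<rho> {u. \<exists>u'. (u, u') \<in> W}"
      unfolding submodule_def using Wsub(2) W0 Wadd Wscale W\<rho> by (auto intro!: M.subspaceI) blast+
    moreover have "{u. \<exists>u'. (u, u') \<in> W} \<noteq> {0}" using vW v by blast
    ultimately show ?thesis using irr(1) unfolding irreducible_module_def by blast
  qed
  have sub2: "{u'. \<exists>u. (u, u') \<in> W} = V'"
  proof -
    have "submodule sc' V' \<rho>' {u'. \<exists>u. (u, u') \<in> W}"
      unfolding submodule_def using Wsub(2) W0 Wadd Wscale W\<rho> by (auto intro!: M'.subspaceI) blast+
    moreover have "{u'. \<exists>u. (u, u') \<in> W} \<noteq> {0}" using vW v' by blast
    ultimately show ?thesis using irr(2) unfolding irreducible_module_def by blast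
  qed
  \<comment> \<open>An element of \<open>W\<close> killed by the degree operator is a multiple of
    the pair, so both coordinates carry the same scalar. The scalars 1, 0 and 0, 1 are used below to
    exclude both factors from \<open>W\<close>.\<close>
  have ker: "b = d" if "(sc b v, sc' d v') \<in> W" for b d
  proof -
    have "map_prod D D' (sc b v, sc' d v') = 0" using D D' v v' by (simp add: zero_prod_def)
    from P.span_neg_words_kernel[OF vv that[unfolded W_def] this]
    obtain e where "sc b v = sc e v" "sc' d v' = sc' e v'" by (auto simp: scp_def)
    then have "b = e" "d = e" using v(2) v'(2) by simp_all
    then show ?thesis by simp
  qed
  have ker1: "{u. (u, 0) \<in> W} = {0}"
  proof -
    have "(u + w, 0) \<in> W" if "(u, 0) \<in> W" "(w, 0) \<in> W" for u w using Wadd[OF that] by simp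
    moreover have "(sc c u, 0) \<in> W" if "(u, 0) \<in> W" for c u using Wscale[OF that, of c] by simp
    moreover have "(\<rho> x u, 0) \<in> W" if "x \<in> basis" "(u, 0) \<in> W" for x u using W\<rho>[OF that] M'.\<rho>_0[OF that(1)] by simp
    ultimately have "submodule sc V \<rho> {u. (u, 0) \<in> W}"
      unfolding submodule_def using Wsub(2) W0 by (auto intro!: M.subspaceI)
    moreover have "(v, 0) \<notin> W" using ker[of 1 0] by auto
    then have "{u. (u, 0) \<in> W} \<noteq> V" using v(1) by blast
    ultimately show ?thesis using irr(1) unfolding irreducible_module_def by blast
  qed
  have ker2: "{u. (0, u) \<in> W} = {0}"
  proof -
    have "(0, u + w) \<in> W" if "(0, u) \<in> W" "(0, w) \<in> W" for u w using Wadd[OF that] by simp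
    moreover have "(0, sc' c u) \<in> W" if "(0, u) \<in> W" for c u using Wscale[OF that, of c] by simp
    moreover have "(0, \<rho>' x u) \<in> W" if "x \<in> basis" "(0, u) \<in> W" for x u using W\<rho>[OF that] M.\<rho>_0[OF that(1)] by simp
    ultimately have "submodule sc' V' \<rho>' {u. (0, u) \<in> W}"
      unfolding submodule_def using Wsub(2) W0 by (auto intro!: M'.subspaceI)
    moreover have "(0, v') \<notin> W" using ker[of 0 1] by auto
    then have "{u. (0, u) \<in> W} \<noteq> V'" using v'(1) by blast
    ultimately show ?thesis using irr(2) unfolding irreducible_module_def by blast
  qed
  have diff: "(u - w, u' - w') \<in> W" if "(u, u') \<in> W" "(w, w') \<in> W" for u u' w w'
    using P.subspace_diff[OF Wsub(1) that] by simp
  have func: "u' = w'" if "(u, u') \<in> W" "(u, w') \<in> W" for u u' w'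
  proof -
    have "(0, u' - w') \<in> W" using diff[OF that] by simp
    then have "u' - w' = 0" using ker2 by blast
    then show ?thesis by simp
  qed
  have inj: "u = w" if "(u, u') \<in> W" "(w, u') \<in> W" for u w u'
  proof -
    have "(u - w, 0) \<in> W" using diff[OF that] by simp
    then have "u - w = 0" using ker1 by blast
    then show ?thesis by simp
  qed
  define f where "f u = (THE u'. (u, u') \<in> W)" for u
  have f: "(u, f u) \<in> W" if "u \<in> V" for u
  proof -
    have "\<exists>u'. (u, u') \<in> W" using sub1 that by blast
    then obtain u' where "(u, u') \<in> W" ..
    then have "\<exists>!u'. (u, u') \<in> W" using func by blast
    then show ?thesis unfolding f_def by (rule theI')
  qed
  have f_eq: "f u = u'" if "(u, u') \<in> W" for u u'
  proof -
    have "u \<in> V" using that Wsub(2) by blast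
    from func[OF f[OF this] that] show ?thesis .
  qed
  have "bij_betw f V V'"
    unfolding bij_betw_def
  proof
    show "inj_on f V" using f inj by (metis inj_onI)
    show "f ` V = V'"
    proof
      show "f ` V \<subseteq> V'" using f Wsub(2) by blast
      show "V' \<subseteq> f ` V"
      proof
        fix u' assume "u' \<in> V'"
        then obtain u where "(u, u') \<in> W" using sub2 by blast
        moreover from this have "u \<in> V" using Wsub(2) by blast
        ultimately show "u' \<in> f ` V" using f_eq by blast
      qed
    qed
  qed
  moreover have "f (u + w) = f u + f w" if "u \<in> V" "w \<in> V" for u w
    using that by (intro f_eq Wadd f)
  moreover have "f (sc c u) = sc' c (f u)" if "u \<in> V" for c u
    using that by (intro f_eq Wscale f)
  moreover have "f (\<rho> x u) = \<rho>' x (f u)" if "x \<in> basis" "u \<in> V" for x u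
    using that by (intro f_eq W\<rho> f)
  ultimately show ?thesis unfolding module_iso_def by blast
qed

text \<open>The weight determines the level as \<open>k = c\<^sub>0 + c\<^sub>1\<close> and then
  \<open>a\<close>, so the witnesses in the two instances of \<open>is_L\<close> agree.\<close>

lemma is_L_unique:
  assumes "is_L c\<^sub>0 c\<^sub>1 sc V \<rho>" "is_L c\<^sub>0 c\<^sub>1 sc' V' \<rho>'"
  shows "module_iso sc V \<rho> sc' V' \<rho>'"
proof -
  obtain k a v where 1: "c\<^sub>0 = k / 2 - a" "c\<^sub>1 = k / 2 + a" "irreducible_module sc V \<rho>" "\<forall>u\<in>V. \<rho> K u = sc k u"
      "highest_weight_vector sc V \<rho> a v" "has_degree_operator sc V \<rho> v"
    using assms(1) unfolding is_L_def by blast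
  obtain k' a' v' where 2: "c\<^sub>0 = k' / 2 - a'" "c\<^sub>1 = k' / 2 + a'" "irreducible_module sc' V' \<rho>'" "\<forall>u\<in>V'. \<rho>' K u = sc' k' u"
      "highest_weight_vector sc' V' \<rho>' a' v'" "has_degree_operator sc' V' \<rho>' v'"
    using assms(2) unfolding is_L_def by blast
  have "k = c\<^sub>0 + c\<^sub>1" using 1(1,2) by simp
  moreover have "k' = c\<^sub>0 + c\<^sub>1" using 2(1,2) by simp
  moreover from calculation have "a = a'" using 1(1) 2(1) by simp
  ultimately show ?thesis
    using highest_weight_isomorphism[OF 1(3) 2(3) _ _ 1(5) _ 1(6) 2(6), of k] 1(4) 2(4,5) by simp
qed

section \<open>Linear operators on free vector spaces\<close>

interpretation smul: vector_space smul by (rule vector_space_smul)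

abbreviation lin :: "(('a \<Rightarrow>\<^sub>0 complex) \<Rightarrow> ('b \<Rightarrow>\<^sub>0 complex)) \<Rightarrow> bool" where
  "lin \<equiv> module_hom smul smul"

lemma linI:
  assumes "\<And>f g. F (f + g) = F f + F g" "\<And>c f. F (smul c f) = smul c (F f)"
  shows "lin F"
  using assms by (simp add: module_hom_iff smul.module_axioms)

lemmas lin_add = module_hom.add[where ?s1.0 = smul and ?s2.0 = smul]
  and lin_smul = module_hom.scale[where ?s1.0 = smul and ?s2.0 = smul]
  and lin_0 = module_hom.zero[where ?s1.0 = smul and ?s2.0 = smul]
  and lin_neg = module_hom.neg[where ?s1.0 = smul and ?s2.0 = smul]
  and lin_diff = module_hom.diff[where ?s1.0 = smul and ?s2.0 = smul]
  and lin_sum = module_hom.sum[where ?s1.0 = smul and ?s2.0 = smul]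

lemmas lin_apply = lin_add lin_smul lin_0 lin_neg lin_diff lin_sum

lemma lin_lin_ext [simp]: "lin (lin_ext F)"
  by (rule linI) (simp_all add: lin_ext_add lin_ext_smul)

lemma smul_eq_0_iff [simp]: "smul c f = 0 \<longleftrightarrow> c = 0 \<or> f = 0"
  by (rule smul.scale_eq_0_iff)

lemma smul_sum: "smul c (sum g A) = (\<Sum>a\<in>A. smul c (g a))"
  by (rule smul.scale_sum_right)

lemma expand_basis: "f = (\<Sum>a\<in>Poly_Mapping.keys f. smul (Poly_Mapping.lookup f a) (basis_vec a))"
  using lin_ext_id[of 1 f] by (simp add: lin_ext_def)

lemma lin_expand: "lin F \<Longrightarrow> F f = lin_ext (\<lambda>a. F (basis_vec a)) f"
  by (subst (1) expand_basis[of f]) (simp add: lin_sum lin_smul lin_ext_def)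

lemma lin_eqI:
  assumes "lin F" "lin F'" "\<And>a. a \<in> Poly_Mapping.keys f \<Longrightarrow> F (basis_vec a) = F' (basis_vec a)"
  shows "F f = F' f"
proof -
  have "F f = lin_ext (\<lambda>a. F (basis_vec a)) f" by (rule lin_expand[OF assms(1)])
  also have "\<dots> = lin_ext (\<lambda>a. F' (basis_vec a)) f" by (rule lin_ext_cong) (rule assms(3))
  also have "\<dots> = F' f" by (rule lin_expand[OF assms(2), symmetric])
  finally show ?thesis .
qed

lemma lookup_basis_vec: "Poly_Mapping.lookup (basis_vec a) b = (if a = b then 1 else 0)"
  by (simp add: basis_vec_def lookup_single when_def)

lemma keys_basis_vec [simp]: "Poly_Mapping.keys (basis_vec a) = {a}"
  by (simp add: basis_vec_def)

lemma basis_vec_nonzero [simp]: "basis_vec a \<noteq> 0"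
  by (metis keys_basis_vec keys_zero insert_not_empty)

lemma sum_triangle_le: "(\<Sum>k\<le>n. \<Sum>j\<le>n - k. g k j) = (\<Sum>j\<le>n. \<Sum>k\<le>n - j. g k (j::nat))"
proof -
  have "(\<Sum>k\<le>n. \<Sum>j\<le>n - k. g k j) = (\<Sum>(k, j)\<in>{(k, j). k + j \<le> n}. g k j)"
    by (subst sum.Sigma) (auto intro!: sum.cong)
  also have "\<dots> = (\<Sum>(j, k)\<in>{(k, j). k + j \<le> n}. g k j)"
    by (rule sum.reindex_bij_witness[of _ prod.swap prod.swap]) (auto simp: add.commute)
  also have "\<dots> = (\<Sum>j\<le>n. \<Sum>k\<le>n - j. g k j)"
    by (subst sum.Sigma) (auto intro!: sum.cong)
  finally show ?thesis .
qed

subsection \<open>Exponentials of operator series\<close>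

lemma lin_series_pow:
  assumes "\<And>k. lin (A k)" shows "lin (series_pow A l n)"
proof (induction l arbitrary: n)
  case 0 show ?case by (rule linI) auto
next
  case (Suc l)
  show ?case by (rule linI) (simp_all add: lin_apply[OF Suc] lin_apply[OF assms] sum.distrib smul_sum)
qed

lemma lin_series_exp:
  assumes "\<And>k. lin (A k)" shows "lin (series_exp A n)"
  by (rule linI) (simp_all add: series_exp_def lin_apply[OF lin_series_pow[OF assms]]
      smul.scale_right_distrib sum.distrib smul_sum mult.commute)

text \<open>Without a constant term, the power \<open>A(w)^l\<close> starts at \<open>w^l\<close>.
  This is why cutting the exponential series at \<open>l \<le> n\<close> loses nothing.\<close>

lemma series_pow_eq_0:
  assumes "\<And>k. lin (A k)" "\<And>f. A 0 f = 0" "n < l" shows "series_pow A l n f = 0"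
  using assms(3)
proof (induction l arbitrary: n)
  case (Suc l)
  have "A k (series_pow A l (n - k) f) = 0" if "k \<le> n" for k
    using Suc that by (cases "k = 0") (auto simp: assms(2) lin_0[OF assms(1)])
  then show ?case by simp
qed simp

lemma series_exp_0: "series_exp A 0 f = f"
  by (simp add: series_exp_def)

lemma series_exp_superset:
  assumes "\<And>k. lin (A k)" "\<And>f. A 0 f = 0" "n \<le> m"
  shows "series_exp A n f = (\<Sum>l\<le>m. smul (1 / fact l) (series_pow A l n f))"
  unfolding series_exp_def
  by (rule sum.mono_neutral_left) (use assms in \<open>auto simp: series_pow_eq_0\<close>)

text \<open>The commutator \<open>[C, A(w)] = \<alpha> w^k0\<close> is a scalar series, so the
  commutator with \<open>C\<close> behaves like a derivative:
  \<open>[C, A(w)^l] = l \<alpha> w^k0 A(w)^(l-1)\<close>.\<close>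

lemma series_pow_commutator:
  assumes C: "lin C" and A: "\<And>k. lin (A k)"
    and CA: "\<And>k f. C (A k f) = A k (C f) + (if k = k0 then smul \<alpha> f else 0)"
  shows "C (series_pow A l n f) = series_pow A l n (C f)
    + (if k0 \<le> n \<and> l > 0 then smul (of_nat l * \<alpha>) (series_pow A (l - 1) (n - k0) f) else 0)"
proof (induction l arbitrary: n)
  case 0 show ?case by (simp add: lin_0[OF C])
next
  case (Suc l)
  let ?P = "series_pow A"
  have s: "(if k0 \<le> n then ?P l (n - k0) f else 0) = (\<Sum>k\<le>n. if k = k0 then ?P l (n - k) f else 0)"
    by simp
  have "C (?P (Suc l) n f) = (\<Sum>k\<le>n. A k (C (?P l (n - k) f)) + (if k = k0 then smul \<alpha> (?P l (n - k) f) else 0))"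
    by (simp add: lin_sum[OF C] CA)
  also have "\<dots> = (\<Sum>k\<le>n. A k (C (?P l (n - k) f))) + smul \<alpha> (if k0 \<le> n then ?P l (n - k0) f else 0)"
    by (simp add: sum.distrib)
  also have "(\<Sum>k\<le>n. A k (C (?P l (n - k) f))) = (\<Sum>k\<le>n. A k (?P l (n - k) (C f)) +
      (if k0 \<le> n - k \<and> l > 0 then smul (of_nat l * \<alpha>) (A k (?P (l - 1) (n - k - k0) f)) else 0))"
    by (rule sum.cong) (auto simp: Suc lin_apply[OF A])
  also have "\<dots> = ?P (Suc l) n (C f) + (\<Sum>k\<le>n.
      (if k0 \<le> n - k \<and> l > 0 then smul (of_nat l * \<alpha>) (A k (?P (l - 1) (n - k - k0) f)) else 0))"
    by (simp add: sum.distrib)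
  also have "(\<Sum>k\<le>n. (if k0 \<le> n - k \<and> l > 0 then smul (of_nat l * \<alpha>) (A k (?P (l - 1) (n - k - k0) f)) else 0))
      = smul (of_nat l * \<alpha>) (if k0 \<le> n then ?P l (n - k0) f else 0)"
  proof (cases "k0 \<le> n \<and> l > 0")
    case True
    then obtain l' where l: "l = Suc l'" by (cases l) auto
    have "(\<Sum>k\<le>n. (if k0 \<le> n - k \<and> l > 0 then smul (of_nat l * \<alpha>) (A k (?P (l - 1) (n - k - k0) f)) else 0))
      = (\<Sum>k\<le>n - k0. smul (of_nat l * \<alpha>) (A k (?P (l - 1) (n - k0 - k) f)))"
      by (rule sum.mono_neutral_cong_right) (use True in \<open>auto simp: add.commute\<close>)
    then show ?thesis using True by (simp add: l smul_sum)
  next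
    case False
    then show ?thesis by (auto intro!: sum.neutral)
  qed
  finally show ?case by (simp add: algebra_simps smul.scale_left_distrib)
qed

text \<open>The factors \<open>l\<close> from the power rule shift the exponential series by one,
  whence \<open>[C, exp A(w)] = \<alpha> w^k0 exp A(w)\<close>.\<close>

lemma series_exp_commutator:
  assumes C: "lin C" and A: "\<And>k. lin (A k)" and A0: "\<And>f. A 0 f = 0" and k0: "k0 > 0"
    and CA: "\<And>k f. C (A k f) = A k (C f) + (if k = k0 then smul \<alpha> f else 0)"
  shows "C (series_exp A n f) = series_exp A n (C f) + (if k0 \<le> n then smul \<alpha> (series_exp A (n - k0) f) else 0)"
proof -
  let ?P = "series_pow A"
  have "C (series_exp A n f) = (\<Sum>l\<le>n. smul (1 / fact l) (C (?P l n f)))"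
    by (simp add: series_exp_def lin_apply[OF C])
  also have "\<dots> = series_exp A n (C f) +
      (\<Sum>l\<le>n. if k0 \<le> n \<and> l > 0 then smul (of_nat l * \<alpha> / fact l) (?P (l - 1) (n - k0) f) else 0)"
    unfolding series_pow_commutator[OF C A CA] series_exp_def
    by (subst sum.distrib[symmetric]) (auto intro!: sum.cong simp: smul.scale_right_distrib)
  also have "(\<Sum>l\<le>n. if k0 \<le> n \<and> l > 0 then smul (of_nat l * \<alpha> / fact l) (?P (l - 1) (n - k0) f) else 0)
      = (if k0 \<le> n then smul \<alpha> (series_exp A (n - k0) f) else 0)"
  proof (cases "k0 \<le> n")
    case True
    \<comment> \<open>After the shift from \<open>l\<close> to \<open>l - 1\<close> the sum ends at
      \<open>n' = n - 1\<close>. Because of \<open>k0 > 0\<close> this is at least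
      \<open>n - k0\<close>, so the shorter exponential is complete.\<close>
    then obtain n' where n: "n = Suc n'" using k0 by (cases n) auto
    have "(\<Sum>l\<le>n. if k0 \<le> n \<and> l > 0 then smul (of_nat l * \<alpha> / fact l) (?P (l - 1) (n - k0) f) else 0)
      = (\<Sum>l\<le>n'. smul (of_nat (Suc l) * \<alpha> / fact (Suc l)) (?P l (n - k0) f))"
      unfolding n sum.atMost_Suc_shift using True n by simp
    also have "\<dots> = smul \<alpha> (series_exp A (n - k0) f)"
      using n k0 by (subst series_exp_superset[where A = A and m = n', OF A A0])
        (auto simp: smul_sum simp del: of_nat_Suc intro!: sum.cong)
    finally show ?thesis using True by simp
  qed auto
  finally show ?thesis .
qed

text \<open>The Euler operator \<open>w d/dw\<close> applied to a power. Commuting coefficients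
  allow the \<open>Suc l\<close> Leibniz terms to be collected into one.\<close>

lemma series_pow_derivative:
  assumes A: "\<And>k. lin (A k)" and comm: "\<And>j k f. A j (A k f) = A k (A j f)"
  shows "smul (of_nat n) (series_pow A (Suc l) n f)
    = smul (of_nat (Suc l)) (\<Sum>k\<le>n. smul (of_nat k) (A k (series_pow A l (n - k) f)))"
proof (induction l arbitrary: n)
  case 0
  then show ?case
    by (simp add: smul_sum) (rule sum.cong, auto simp: lin_apply[OF A])
next
  case (Suc l)
  let ?P = "series_pow A"
  have "smul (of_nat n) (?P (Suc (Suc l)) n f) = (\<Sum>k\<le>n. smul (of_nat k + of_nat (n - k)) (A k (?P (Suc l) (n - k) f)))"
    unfolding series_pow.simps(2)[of A "Suc l"] smul_sum by (rule sum.cong) (auto simp del: series_pow.simps(2) simp flip: of_nat_add)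
  also have "\<dots> = (\<Sum>k\<le>n. smul (of_nat k) (A k (?P (Suc l) (n - k) f))) +
      (\<Sum>k\<le>n. A k (smul (of_nat (n - k)) (?P (Suc l) (n - k) f)))"
    by (subst sum.distrib[symmetric]) (auto intro!: sum.cong simp: lin_smul[OF A] simp del: series_pow.simps(2) simp flip: smul.scale_left_distrib)
  also have "(\<Sum>k\<le>n. A k (smul (of_nat (n - k)) (?P (Suc l) (n - k) f)))
     = (\<Sum>k\<le>n. \<Sum>j\<le>n - k. smul (of_nat (Suc l) * of_nat j) (A j (A k (?P l (n - k - j) f))))"
    unfolding Suc by (simp add: lin_apply[OF A] smul_sum comm)
  also have "\<dots> = (\<Sum>j\<le>n. \<Sum>k\<le>n - j. smul (of_nat (Suc l) * of_nat j) (A j (A k (?P l (n - k - j) f))))"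
    by (rule sum_triangle_le)
  also have "\<dots> = (\<Sum>j\<le>n. smul (of_nat (Suc l) * of_nat j) (A j (?P (Suc l) (n - j) f)))"
    by (simp add: lin_apply[OF A] smul_sum add.commute)
  also have "\<dots> = smul (of_nat (Suc l)) (\<Sum>j\<le>n. smul (of_nat j) (A j (?P (Suc l) (n - j) f)))"
    by (simp only: smul_sum smul.scale_scale)
  finally show ?case
    by (simp only: of_nat_Suc[of "Suc l"] smul.scale_left_distrib smul.scale_one)
qed

text \<open>The chain rule for \<open>w d/dw exp A(w)\<close>. The summand \<open>k = 0\<close>
  vanishes, so each coefficient of the exponential is determined by earlier ones, which permits
  induction on \<open>n\<close> without expanding powers.\<close>

lemma series_exp_recursion:
  assumes A: "\<And>k. lin (A k)" and A0: "\<And>f. A 0 f = 0" and comm: "\<And>j k f. A j (A k f) = A k (A j f)"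
  shows "smul (of_nat n) (series_exp A n f) = (\<Sum>k\<le>n. smul (of_nat k) (A k (series_exp A (n - k) f)))"
proof (cases n)
  case 0
  then show ?thesis by simp
next
  case (Suc n')
  let ?P = "series_pow A"
  have "smul (of_nat n) (series_exp A n f) = (\<Sum>l\<le>n. smul (1 / fact l) (smul (of_nat n) (?P l n f)))"
    by (simp add: series_exp_def smul_sum mult.commute)
  also have "\<dots> = (\<Sum>l\<le>n'. smul (1 / fact (Suc l)) (smul (of_nat n) (?P (Suc l) n f)))"
    unfolding Suc sum.atMost_Suc_shift by simp
  also have "\<dots> = (\<Sum>l\<le>n'. \<Sum>k\<le>n. smul (of_nat k) (A k (smul (1 / fact l) (?P l (n - k) f))))"
    unfolding series_pow_derivative[OF A comm]
    by (simp add: smul_sum lin_smul[OF A] mult.commute del: of_nat_Suc)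
  also have "\<dots> = (\<Sum>k\<le>n. smul (of_nat k) (A k (\<Sum>l\<le>n'. smul (1 / fact l) (?P l (n - k) f))))"
    by (subst sum.swap) (simp add: lin_sum[OF A] smul_sum)
  also have "\<dots> = (\<Sum>k\<le>n. smul (of_nat k) (A k (series_exp A (n - k) f)))"
  proof (rule sum.cong[OF refl])
    fix k
    show "smul (of_nat k) (A k (\<Sum>l\<le>n'. smul (1 / fact l) (?P l (n - k) f))) = smul (of_nat k) (A k (series_exp A (n - k) f))"
      using Suc by (cases "k = 0") (auto simp: series_exp_superset[where A = A and m = n', OF A A0])
  qed
  finally show ?thesis .
qed

text \<open>The commutator with \<open>D\<close> acts on the series \<open>A(w)\<close> as
  \<open>\<gamma> w d/dw\<close>. Both are derivations, so the rule passes to powers and to the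
  exponential.\<close>

lemma series_exp_grading:
  assumes D: "lin D" and A: "\<And>k. lin (A k)"
    and DA: "\<And>k f. D (A k f) = A k (D f) + smul (\<gamma> * of_nat k) (A k f)"
  shows "D (series_exp A n f) = series_exp A n (D f) + smul (\<gamma> * of_nat n) (series_exp A n f)"
proof -
  have P: "D (series_pow A l n f) = series_pow A l n (D f) + smul (\<gamma> * of_nat n) (series_pow A l n f)" for l
  proof (induction l arbitrary: n)
    case 0 show ?case by (simp add: lin_0[OF D])
  next
    case (Suc l)
    have "D (series_pow A (Suc l) n f) = (\<Sum>k\<le>n. A k (series_pow A l (n - k) (D f))
        + smul (\<gamma> * of_nat (n - k) + \<gamma> * of_nat k) (A k (series_pow A l (n - k) f)))"
      by (simp add: lin_sum[OF D] DA Suc lin_apply[OF A] smul.scale_left_distrib add.assoc)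
    also have "\<dots> = (\<Sum>k\<le>n. A k (series_pow A l (n - k) (D f)) + smul (\<gamma> * of_nat n) (A k (series_pow A l (n - k) f)))"
      by (rule sum.cong) (auto simp flip: distrib_left of_nat_add)
    finally show ?case by (simp add: sum.distrib smul_sum)
  qed
  show ?thesis
    by (simp add: series_exp_def lin_apply[OF D] P smul.scale_right_distrib sum.distrib smul_sum mult.commute)
qed

lemma series_exp_closed:
  assumes U: "smul.subspace U" and A: "\<And>k f. f \<in> U \<Longrightarrow> A k f \<in> U" and f: "f \<in> U"
  shows "series_exp A n f \<in> U"
proof -
  have "series_pow A l n f \<in> U" for l
  proof (induction l arbitrary: n)
    case 0 then show ?case using f smul.subspace_0[OF U] by simp
  next
    case (Suc l) then show ?case by (auto intro!: smul.subspace_sum[OF U] A)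
  qed
  then show ?thesis
    unfolding series_exp_def by (auto intro!: smul.subspace_sum[OF U] smul.subspace_scale[OF U])
qed

section \<open>Vectors supported on a set of basis labels\<close>

definition supp :: "'a set \<Rightarrow> ('a \<Rightarrow>\<^sub>0 complex) set" where
  "supp A = {f. Poly_Mapping.keys f \<subseteq> A}"

lemma subspace_supp: "smul.subspace (supp A)"
proof (rule smul.subspaceI)
  show "0 \<in> supp A" by (simp add: supp_def)
  show "x + y \<in> supp A" if "x \<in> supp A" "y \<in> supp A" for x y
    using that Poly_Mapping.keys_add[of x y] by (auto simp: supp_def)
  show "smul c x \<in> supp A" if "x \<in> supp A" for c x
    using that by (auto simp: supp_def in_keys_iff subset_iff)
qed

lemma basis_vec_supp [simp]: "basis_vec a \<in> supp A \<longleftrightarrow> a \<in> A"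
  by (simp add: supp_def)

lemma lin_supp_mem:
  assumes U: "smul.subspace U" and "lin F" "f \<in> supp A" "\<And>a. a \<in> A \<Longrightarrow> F (basis_vec a) \<in> U"
  shows "F f \<in> U"
  using assms(3,4) by (subst lin_expand[OF assms(2)]) (auto simp: lin_ext_def intro!: smul.subspace_sum[OF U] smul.subspace_scale[OF U] simp: supp_def subset_iff)

lemma lin_eq_suppI:
  assumes "lin F" "lin F'" "f \<in> supp A" "\<And>a. a \<in> A \<Longrightarrow> F (basis_vec a) = F' (basis_vec a)"
  shows "F f = F' f"
  by (rule lin_eqI) (use assms in \<open>auto simp: supp_def\<close>)

lemma lookup_lin_ext_diag: "Poly_Mapping.lookup (lin_ext (\<lambda>a. smul (d a) (basis_vec a)) f) a = d a * Poly_Mapping.lookup f a"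
proof -
  have "Poly_Mapping.lookup (lin_ext (\<lambda>a. smul (d a) (basis_vec a)) f) a
      = (\<Sum>b\<in>Poly_Mapping.keys f. if b = a then d a * Poly_Mapping.lookup f a else 0)"
    unfolding lin_ext_def lookup_sum by (rule sum.cong) (auto simp: lookup_basis_vec)
  then show ?thesis by (simp add: in_keys_iff)
qed

lemma Fock_eq_supp: "Fock = supp {m. Poly_Mapping.keys m \<subseteq> {k \<in> half_odds. k > 0}}"
  by (auto simp: Fock_def supp_def)

lemma ext_alg_eq_supp: "ext_alg N = supp {S. finite S \<and> S \<subseteq> N}"
  by (auto simp: ext_alg_def supp_def)

subsection \<open>The Heisenberg modes\<close>

text \<open>Modes in \<open>\<int>/2\<close> are indexed by twice their value from here on.\<close>

abbreviation bt :: "int \<Rightarrow> fock \<Rightarrow> fock" where "bt N \<equiv> beta (of_int N / 2)"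
abbreviation fock_one :: fock where "fock_one \<equiv> basis_vec 0"

lemma beta_basis_vec:
  "beta k (basis_vec m) = (if k < 0 then basis_vec (Poly_Mapping.single (- k) 1 + m)
     else smul (of_rat (- k) * of_nat (Poly_Mapping.lookup m k)) (basis_vec (m - Poly_Mapping.single k 1)))"
  by (simp add: beta_def basis_vec_mult pderiv_var_def lin_ext_basis_vec)

lemma lin_beta [simp]: "lin (beta k)"
proof (cases "k < 0")
  case True
  then have "beta k = lin_ext (\<lambda>a. basis_vec (Poly_Mapping.single (- k) 1 + a))"
    by (simp add: fun_eq_iff beta_def mult_lin_ext)
  then show ?thesis by simp
next
  case False
  then show ?thesis
    by (intro linI) (simp_all add: beta_def pderiv_var_def lin_ext_add lin_ext_smul smul.scale_right_distrib mult.commute)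
qed

lemma half_odds_of_int: "of_int N / 2 \<in> half_odds \<longleftrightarrow> odd N"
proof -
  have "(of_int N / 2 :: rat) \<in> \<int> \<longleftrightarrow> even N"
  proof
    assume "(of_int N / 2 :: rat) \<in> \<int>"
    then obtain m where "of_int N / 2 = (of_int m :: rat)" by (auto elim: Ints_cases)
    then have "(of_int N :: rat) = of_int (2 * m)" by simp
    then have "N = 2 * m" by (simp only: of_int_eq_iff)
    then show "even N" by simp
  qed auto
  then show ?thesis by (auto simp: half_odds_def half_ints_def)
qed

lemma half_oddsE:
  assumes "k \<in> half_odds" obtains N where "k = of_int N / 2" "odd N"
proof -
  obtain N where N: "2 * k = of_int N" using assms by (auto simp: half_odds_def half_ints_def elim: Ints_cases)
  then have "k = of_int N / 2" by simp
  with assms show ?thesis using that half_odds_of_int by blast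
qed

lemma bt_commutator:
  assumes "odd N" "odd L"
  shows "bt N (bt L f) = bt L (bt N f) + (if N + L = 0 then smul (- of_int N / 2) f else 0)"
proof -
  have "(of_int N / 2 + of_int L / 2 = (0::rat)) \<longleftrightarrow> N + L = 0"
    by (simp flip: add_divide_distrib of_int_add)
  then show ?thesis
    using Heisenberg[of "of_int N / 2" "of_int L / 2" f] assms
    by (auto simp: half_odds_of_int diff_eq_eq add.commute of_rat_divide of_rat_minus)
qed

lemma creation_alt: "creation_exponent n f = (if odd n then smul (2 / of_nat n) (bt (- int n) f) else 0)"
  by (simp add: creation_exponent_def of_rat_divide)

lemma annihilation_alt: "annihilation_exponent n f = (if odd n then smul (- 2 / of_nat n) (bt (int n) f) else 0)"
  by (simp add: annihilation_exponent_def of_rat_divide)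

lemma creation_0: "creation_exponent 0 f = 0" and annihilation_0: "annihilation_exponent 0 f = 0"
  by (simp_all add: creation_alt annihilation_alt)

lemma lin_creation [simp]: "lin (creation_exponent n)"
  by (rule linI) (simp_all add: creation_alt lin_apply[OF lin_beta] smul.scale_right_distrib mult.commute)

lemma lin_annihilation [simp]: "lin (annihilation_exponent n)"
  by (rule linI) (simp_all add: annihilation_alt lin_apply[OF lin_beta] smul.scale_right_distrib mult.commute)

abbreviation S_op :: "nat \<Rightarrow> fock \<Rightarrow> fock" where "S_op \<equiv> series_exp creation_exponent"
abbreviation T_op :: "nat \<Rightarrow> fock \<Rightarrow> fock" where "T_op \<equiv> series_exp annihilation_exponent"

lemma lin_S [simp]: "lin (S_op n)" and lin_T [simp]: "lin (T_op n)"
  by (simp_all add: lin_series_exp)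

text \<open>The Heisenberg commutator \<open>- N / 2\<close> and the coefficient
  \<open>2 / N\<close> of the exponent multiply to \<open>- 1\<close> for every positive odd
  \<open>N\<close>. This uniform value is why commuting with a mode merely shifts the index.\<close>

lemma bt_S:
  assumes N: "odd N"
  shows "bt N (S_op a f) = S_op a (bt N f) - (if 0 < N \<and> N \<le> int a then S_op (a - nat N) f else 0)"
proof (cases "N > 0")
  case True
  have "bt N (creation_exponent k f) = creation_exponent k (bt N f) + (if k = nat N then smul (- 1) f else 0)" for k f
    using bt_commutator[OF N, of "- int k" f] True N by (auto simp: creation_alt lin_apply[OF lin_beta] even_nat_iff smul.scale_right_distrib smul.scale_right_diff_distrib)
  from series_exp_commutator[OF lin_beta lin_creation _ _ this, of a] show ?thesis
    using True by (auto simp: creation_0 nat_le_iff)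
next
  case False
  \<comment> \<open>Negative modes commute with all creation modes. The index 1 with
    \<open>\<alpha> = 0\<close> only serves to fit the shape of
    \<open>series_exp_commutator\<close>.\<close>
  have "bt N (creation_exponent k f) = creation_exponent k (bt N f) + (if k = 1 then smul 0 f else 0)" for k f
    using bt_commutator[OF N, of "- int k" f] False N by (auto simp: creation_alt lin_apply[OF lin_beta])
  from series_exp_commutator[OF lin_beta lin_creation _ _ this, of a] show ?thesis
    using False by (auto simp: creation_0)
qed

lemma bt_T:
  assumes N: "odd N"
  shows "bt N (T_op b f) = T_op b (bt N f) - (if N < 0 \<and> - N \<le> int b then T_op (b - nat (- N)) f else 0)"
proof (cases "N < 0")
  case True
  have "bt N (annihilation_exponent k f) = annihilation_exponent k (bt N f) + (if k = nat (- N) then smul (- 1) f else 0)" for k f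
    using bt_commutator[OF N, of "int k" f] True N by (auto simp: annihilation_alt lin_apply[OF lin_beta] even_nat_iff smul.scale_right_distrib smul.scale_right_diff_distrib)
  from series_exp_commutator[OF lin_beta lin_annihilation _ _ this, of b] show ?thesis
    using True by (auto simp: annihilation_0 nat_le_iff)
next
  case False
  have "bt N (annihilation_exponent k f) = annihilation_exponent k (bt N f) + (if k = 1 then smul 0 f else 0)" for k f
    using bt_commutator[OF N, of "int k" f] False N by (auto simp: annihilation_alt lin_apply[OF lin_beta])
  from series_exp_commutator[OF lin_beta lin_annihilation _ _ this, of b] show ?thesis
    using False by (auto simp: annihilation_0)
qed

subsection \<open>The grading of the Fock space\<close>

text \<open>Variables of index \<open>k \<le> 0\<close> exist as labels but count 0. Thus weights
  are nonnegative on all monomials, and the grading can be used outside \<open>Fock\<close> as well: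
  \<open>beta k\<close> with \<open>k \<noteq> 0\<close> only adds or removes variables of positive
  index.\<close>

definition wt :: "(rat \<Rightarrow>\<^sub>0 nat) \<Rightarrow> rat" where
  "wt m = (\<Sum>k\<in>Poly_Mapping.keys m. if k > 0 then of_nat (Poly_Mapping.lookup m k) * k else 0)"

lemma wt_add: "wt (m + m') = wt m + wt m'"
  unfolding wt_def by (rule setsum_keys_plus_distrib) (auto simp: algebra_simps)

lemma wt_single: "wt (Poly_Mapping.single k (Suc 0)) = (if k > 0 then k else 0)"
  by (simp add: wt_def)

lemma wt_nonneg: "wt m \<ge> 0"
  unfolding wt_def by (rule sum_nonneg) auto

lemma wt_0 [simp]: "wt 0 = 0"
  by (simp add: wt_def)

lemma minus_single_add:
  assumes "Poly_Mapping.lookup m k > 0"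
  shows "Poly_Mapping.single k 1 + (m - Poly_Mapping.single k 1) = (m :: rat \<Rightarrow>\<^sub>0 nat)"
  using assms by (intro poly_mapping_eqI) (auto simp: lookup_add lookup_minus lookup_single when_def)

definition Wt :: "fock \<Rightarrow> fock" where
  "Wt = lin_ext (\<lambda>m. smul (of_rat (wt m)) (basis_vec m))"

lemma lin_Wt [simp]: "lin Wt" by (simp add: Wt_def)

lemma Wt_basis_vec: "Wt (basis_vec m) = smul (of_rat (wt m)) (basis_vec m)"
  by (simp add: Wt_def lin_ext_basis_vec)

lemma Wt_eigenvector:
  assumes "Wt f = smul (of_rat c) f" "m \<in> Poly_Mapping.keys f" shows "wt m = c"
proof -
  have "of_rat (wt m) * Poly_Mapping.lookup f m = of_rat c * Poly_Mapping.lookup f m"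
    using arg_cong[OF assms(1), of "\<lambda>f. Poly_Mapping.lookup f m"] by (simp add: Wt_def lookup_lin_ext_diag)
  then show ?thesis using assms(2) by (simp add: in_keys_iff)
qed

lemma Wt_beta: "k \<noteq> 0 \<Longrightarrow> Wt (beta k f) = beta k (Wt f) + smul (of_rat (- k)) (beta k f)"
proof (rule lin_eqI[where F = "\<lambda>f. Wt (beta k f)"])
  show "lin (\<lambda>f. Wt (beta k f))" "lin (\<lambda>f. beta k (Wt f) + smul (of_rat (- k)) (beta k f))"
    by (rule linI; simp add: lin_apply[OF lin_beta] lin_apply[OF lin_Wt] smul.scale_right_distrib mult.commute)+
  fix m assume k: "k \<noteq> 0"
  show "Wt (beta k (basis_vec m)) = beta k (Wt (basis_vec m)) + smul (of_rat (- k)) (beta k (basis_vec m))"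
  proof (cases "k < 0 \<or> Poly_Mapping.lookup m k = 0")
    case True
    then show ?thesis using k
      by (auto simp: Wt_basis_vec lin_apply[OF lin_beta] lin_apply[OF lin_Wt] beta_basis_vec wt_add wt_single of_rat_add of_rat_diff of_rat_minus
          smul.scale_left_distrib smul.scale_left_diff_distrib)
  next
    case False
    then have "wt m = k + wt (m - Poly_Mapping.single k 1)"
      using minus_single_add[of m k] k by (metis wt_add wt_single One_nat_def neq0_conv linorder_neqE_linordered_idom)
    then show ?thesis using False k
      by (simp add: Wt_basis_vec lin_apply[OF lin_beta] lin_apply[OF lin_Wt] beta_basis_vec of_rat_add of_rat_minus algebra_simps
          flip: smul.scale_left_distrib smul.scale_left_diff_distrib)
  qed
qed

lemma Wt_S: "Wt (S_op n f) = S_op n (Wt f) + smul (of_nat n / 2) (S_op n f)"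
proof -
  have "Wt (creation_exponent k f) = creation_exponent k (Wt f) + smul (1 / 2 * of_nat k) (creation_exponent k f)" for k f
    by (auto simp: creation_alt lin_apply[OF lin_Wt] Wt_beta smul.scale_right_distrib of_rat_divide of_rat_minus)
  from series_exp_grading[OF lin_Wt lin_creation this] show ?thesis by simp
qed

lemma Wt_T: "Wt (T_op n f) = T_op n (Wt f) - smul (of_nat n / 2) (T_op n f)"
proof -
  have "Wt (annihilation_exponent k f) = annihilation_exponent k (Wt f) + smul (- (1 / 2) * of_nat k) (annihilation_exponent k f)" for k f
    by (auto simp: annihilation_alt lin_apply[OF lin_Wt] Wt_beta smul.scale_right_distrib smul.scale_right_diff_distrib of_rat_divide of_rat_minus)
  from series_exp_grading[OF lin_Wt lin_annihilation this] show ?thesis by simp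
qed

text \<open>\<open>T_op b\<close> lowers the weight by \<open>b / 2\<close>, and no monomial has
  negative weight.\<close>

lemma T_basis_vec_eq_0:
  assumes "wt m < of_nat b / 2" shows "T_op b (basis_vec m) = 0"
proof (rule ccontr)
  assume "T_op b (basis_vec m) \<noteq> 0"
  then obtain m' where m': "m' \<in> Poly_Mapping.keys (T_op b (basis_vec m))" by (metis keys_eq_empty ex_in_conv)
  have "Wt (T_op b (basis_vec m)) = smul (of_rat (wt m - of_nat b / 2)) (T_op b (basis_vec m))"
    by (simp add: Wt_T Wt_basis_vec lin_smul[OF lin_T] of_rat_diff of_rat_divide smul.scale_left_diff_distrib)
  from Wt_eigenvector[OF this m'] have "wt m' = wt m - of_nat b / 2" .
  then show False using wt_nonneg[of m'] assms by simp
qed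

lemma T_one: "T_op b fock_one = (if b = 0 then fock_one else 0)"
  by (auto simp: series_exp_0 intro: T_basis_vec_eq_0)

text \<open>Local finiteness: on a fixed vector the annihilation exponential is a polynomial, so
  every coefficient of the vertex operator is a finite sum.\<close>

lemma T_eventually_0: "\<exists>B. \<forall>b\<ge>B. T_op b f = 0"
proof (intro exI allI impI)
  fix b assume b: "Suc (\<Sum>m\<in>Poly_Mapping.keys f. nat \<lceil>2 * wt m\<rceil>) \<le> b"
  have "T_op b (basis_vec m) = 0" if "m \<in> Poly_Mapping.keys f" for m
  proof (rule T_basis_vec_eq_0)
    have "nat \<lceil>2 * wt m\<rceil> \<le> (\<Sum>m\<in>Poly_Mapping.keys f. nat \<lceil>2 * wt m\<rceil>)"
      by (rule member_le_sum) (use that in auto)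
    with b have "nat \<lceil>2 * wt m\<rceil> < b" by simp
    then have "2 * wt m < of_nat b" by linarith
    then show "wt m < of_nat b / 2" by simp
  qed
  then show "T_op b f = 0"
    by (subst lin_expand[OF lin_T]) (simp add: lin_ext_def)
qed

subsection \<open>Vacuum expectation values\<close>

lemma lookup_bt_neg_0:
  assumes "k < 0" shows "Poly_Mapping.lookup (beta k f) 0 = 0"
proof -
  have "Poly_Mapping.single (- k) 1 + a \<noteq> 0" for a :: "rat \<Rightarrow>\<^sub>0 nat"
    by (metis lookup_add lookup_single_eq lookup_zero add_is_0 one_neq_zero)
  then show ?thesis using assms
    by (simp add: beta_def mult_lin_ext lin_ext_def lookup_sum lookup_basis_vec)
qed

lemma creation_commute: "creation_exponent j (creation_exponent k f) = creation_exponent k (creation_exponent j f)"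
  using bt_commutator[of "- int j" "- int k" f]
  by (cases "odd j"; cases "odd k") (auto simp: creation_alt lin_apply[OF lin_beta] mult.commute)

lemma S_recursion: "smul (of_nat n) (S_op n f) = (\<Sum>k\<le>n. if odd k then smul 2 (bt (- int k) (S_op (n - k) f)) else 0)"
  using series_exp_recursion[of creation_exponent n f] creation_commute
  by (auto simp: creation_alt if_distrib[of "smul _"] intro!: sum.cong cong: if_cong)

text \<open>By the recursion, every term of \<open>S_op n\<close> with \<open>n > 0\<close> ends in
  the application of a creation mode, which leaves no constant term.\<close>

lemma lookup_S_0: "Poly_Mapping.lookup (S_op n f) 0 = (if n = 0 then Poly_Mapping.lookup f 0 else 0)"
proof (cases "n = 0")
  case False
  have "of_nat n * Poly_Mapping.lookup (S_op n f) 0 = 0"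
    using arg_cong[OF S_recursion[of n f], of "\<lambda>f. Poly_Mapping.lookup f 0"]
    by (simp add: lookup_sum if_distrib[of "\<lambda>f. Poly_Mapping.lookup f 0"])
      (auto intro!: sum.neutral lookup_bt_neg_0 odd_pos)
  with False show ?thesis by simp
qed (simp add: series_exp_0)

lemma sum_odd: "(\<Sum>k<a. if odd k then 4 else 0) = (4 * of_nat (a div 2) :: complex)"
  by (induction a) (auto elim!: oddE evenE)

text \<open>The values are the coefficients of \<open>(1 + t) / (1 - t)\<close>, the contraction of two factors
  \<open>Y\<^sub>t\<^sub>w(e\<^sup>\<beta>, z)\<close>.\<close>

lemma lookup_T_S_one:
  "Poly_Mapping.lookup (T_op b (S_op a fock_one)) 0 = (if a = b then if a = 0 then 1 else 2 else 0)"
proof (induction a arbitrary: b rule: less_induct)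
  case (less a)
  let ?v = "\<lambda>f. Poly_Mapping.lookup f (0 :: rat \<Rightarrow>\<^sub>0 nat)"
  show ?case
  proof (cases "a = 0")
    case True
    then show ?thesis by (auto simp: series_exp_0 T_one lookup_basis_vec)
  next
    case False
    have T: "?v (T_op b (bt (- int k) f)) = (if k \<le> b then ?v (T_op (b - k) f) else 0)" if "odd k" for k f
    proof -
      have "T_op b (bt (- int k) f) = bt (- int k) (T_op b f) + (if k \<le> b then T_op (b - k) f else 0)"
        using bt_T[of "- int k" b f] that by (auto simp: odd_pos)
      moreover have "?v (bt (- int k) (T_op b f)) = 0" by (rule lookup_bt_neg_0) (use that odd_pos in auto)
      ultimately show ?thesis by (auto simp: lookup_add)
    qed
    have "of_nat a * ?v (T_op b (S_op a fock_one)) = ?v (T_op b (smul (of_nat a) (S_op a fock_one)))"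
      by (simp add: lin_smul[OF lin_T])
    also have "\<dots> = (\<Sum>k\<le>a. if odd k then 2 * (if k \<le> b then ?v (T_op (b - k) (S_op (a - k) fock_one)) else 0) else 0)"
      unfolding S_recursion lin_sum[OF lin_T] lookup_sum
      by (intro sum.cong refl) (auto simp: lin_apply[OF lin_T] T[simplified])
    \<comment> \<open>By the induction hypothesis the remaining expectation is 2, or 1 when
      \<open>k = a\<close>. The factor 2 of the recursion turns these into 4 and 2.\<close>
    also have "\<dots> = (\<Sum>k\<le>a. if odd k \<and> a = b then if k = a then 2 else 4 else 0)"
      by (intro sum.cong refl) (use False in \<open>auto simp: less odd_pos\<close>)
    also have "\<dots> = (if a = b then 2 * of_nat a else 0)"
    proof (cases "a = b")
      case True
      have "(\<Sum>k\<le>a. if odd k then if k = a then 2 else 4 else 0) = (\<Sum>k<a. if odd k then 4 else 0) + (if odd a then 2 else (0::complex))"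
        unfolding lessThan_Suc_atMost[symmetric] sum.lessThan_Suc by (intro arg_cong2[of _ _ _ _ "(+)"] sum.cong) auto
      also have "\<dots> = 2 * of_nat a" unfolding sum_odd by (cases "odd a") (auto elim!: oddE evenE)
      finally show ?thesis using True by simp
    qed simp
    finally show ?thesis using False by (auto simp: mult.commute)
  qed
qed

subsection \<open>The vertex operator\<close>

definition S' :: "int \<Rightarrow> fock \<Rightarrow> fock" where "S' n f = (if n < 0 then 0 else S_op (nat n) f)"

text \<open>The index \<open>p\<close> counts powers of \<open>z^(1/2)\<close> beyond the prefactor
  \<open>z^(1/2)\<close>, so that \<open>S_op a\<close> and \<open>T_op b\<close> meet in
  \<open>p = a - b\<close>.\<close>

definition YY :: "nat \<Rightarrow> int \<Rightarrow> fock \<Rightarrow> fock" where "YY j p = Ytw j (1 / 2 + of_int p / 2)"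

definition cY :: "nat \<Rightarrow> complex" where "cY j = - (2 * \<i>) * (- 1) ^ j"

lemma cY_nonzero [simp]: "cY j \<noteq> 0" by (simp add: cY_def)

lemma lin_S' [simp]: "lin (S' n)"
  by (rule linI) (simp_all add: S'_def lin_apply[OF lin_S])

text \<open>The bound \<open>B\<close> is left free so that several vectors can be expanded over one
  common range and compared term by term.\<close>

lemma YY_eq:
  assumes B: "\<And>b. b \<ge> B \<Longrightarrow> T_op b f = 0"
  shows "YY j p f = smul (cY j) (\<Sum>b<B. S' (p + int b) (T_op b f))"
proof -
  let ?g = "\<lambda>(a, b). S_op a (T_op b f) when 1 / 2 + of_nat a / 2 - of_nat b / 2 = 1 / 2 + (of_int p / 2 :: rat)"
  have cond: "1 / 2 + of_nat a / 2 - of_nat b / 2 = 1 / 2 + (of_int p / 2 :: rat) \<longleftrightarrow> int a = p + int b" for a b :: nat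
  proof -
    have "1 / 2 + of_nat a / 2 - of_nat b / 2 = 1 / 2 + (of_int p / 2 :: rat) \<longleftrightarrow> (of_int (int a) :: rat) = of_int (p + int b)"
      unfolding of_int_of_nat_eq of_int_add by (intro iffI; linarith)
    then show ?thesis by (simp only: of_int_eq_iff)
  qed
  let ?I = "{b. b < B \<and> p + int b \<ge> 0}"
  have "Sum_any ?g = sum ?g ((\<lambda>b. (nat (p + int b), b)) ` ?I)"
  proof (rule Sum_any.expand_superset)
    show "{a. ?g a \<noteq> 0} \<subseteq> (\<lambda>b. (nat (p + int b), b)) ` ?I"
    proof
      fix x assume x: "x \<in> {a. ?g a \<noteq> 0}"
      obtain a b where ab: "x = (a, b)" by force
      have "int a = p + int b" "T_op b f \<noteq> 0" using x ab by (auto simp: cond when_def lin_0[OF lin_S] split: if_splits)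
      moreover from this(2) have "b < B" using B[of b] by (meson not_le)
      ultimately show "x \<in> (\<lambda>b. (nat (p + int b), b)) ` ?I" using ab by (auto intro!: image_eqI[of _ _ b])
    qed
  qed auto
  also have "\<dots> = (\<Sum>b\<in>?I. S' (p + int b) (T_op b f))"
    by (subst sum.reindex) (auto simp: inj_on_def S'_def cond intro!: sum.cong)
  also have "\<dots> = (\<Sum>b<B. S' (p + int b) (T_op b f))"
    by (rule sum.mono_neutral_left) (auto simp: S'_def)
  finally show ?thesis by (simp add: YY_def Ytw_def cY_def)
qed

lemma lin_YY [simp]: "lin (YY j p)"
proof (rule linI)
  fix f g
  obtain B C where B: "\<And>b. b \<ge> B \<Longrightarrow> T_op b f = 0" and C: "\<And>b. b \<ge> C \<Longrightarrow> T_op b g = 0"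
    using T_eventually_0 by metis
  let ?M = "max B C"
  have 1: "T_op b f = 0" "T_op b g = 0" "T_op b (f + g) = 0" if "b \<ge> ?M" for b
    using that B C by (simp_all add: lin_apply[OF lin_T])
  have "YY j p h = smul (cY j) (\<Sum>b<?M. S' (p + int b) (T_op b h))" if "h \<in> {f, g, f + g}" for h
    by (rule YY_eq) (use 1 that in blast)
  then show "YY j p (f + g) = YY j p f + YY j p g"
    by (simp add: lin_apply[OF lin_T] lin_apply[OF lin_S'] sum.distrib smul.scale_right_distrib)
next
  fix c f
  obtain B where B: "\<And>b. b \<ge> B \<Longrightarrow> T_op b f = 0" using T_eventually_0 by metis
  then have "\<And>b. b \<ge> B \<Longrightarrow> T_op b (smul c f) = 0" by (simp add: lin_apply[OF lin_T])
  then show "YY j p (smul c f) = smul c (YY j p f)"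
    by (simp add: YY_eq[of B] B lin_apply[OF lin_T] lin_apply[OF lin_S'] smul_sum mult_ac)
qed

lemma bt_S':
  assumes N: "odd N"
  shows "bt N (S' n f) = S' n (bt N f) - (if 0 < N then S' (n - N) f else 0)"
  using bt_S[OF N, of "nat n" f] by (auto simp: S'_def lin_0[OF lin_beta] nat_diff_distrib)

text \<open>A positive mode is contracted with the creation exponential only, a negative one with
  the annihilation exponential only. Both contractions yield the same shift of \<open>p\<close> with
  the same sign.\<close>

lemma bt_YY:
  assumes N: "odd N"
  shows "bt N (YY j p f) = YY j p (bt N f) - YY j (p - N) f"
proof -
  obtain B C where B: "\<And>b. b \<ge> B \<Longrightarrow> T_op b f = 0" and C: "\<And>b. b \<ge> C \<Longrightarrow> T_op b (bt N f) = 0"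
    using T_eventually_0 by metis
  \<comment> \<open>For \<open>N < 0\<close> the contraction replaces \<open>b\<close> by
    \<open>b + N\<close> in the annihilation part. The slack \<open>nat (- N)\<close> keeps the
    shifted sum complete.\<close>
  define M where "M = max B C + nat (- N)"
  have 1: "\<And>b. b \<ge> M \<Longrightarrow> T_op b f = 0" "\<And>b. b \<ge> M \<Longrightarrow> T_op b (bt N f) = 0" 
    using B C by (auto simp: M_def)
  show ?thesis
  proof (cases "N > 0")
    case True
    then show ?thesis using N
      by (simp add: YY_eq[of M] 1 lin_apply[OF lin_beta] bt_S' bt_T sum_subtractf smul.scale_right_diff_distrib add_diff_eq diff_add_eq)
  next
    case False
    with N have neg: "N < 0" by (cases "N = 0") auto
    define k where "k = nat (- N)"
    have k: "N = - int k" "k > 0" using neg by (auto simp: k_def)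
    have "(\<Sum>b<M. if k \<le> b then S' (p + int b) (T_op (b - k) f) else 0)
        = (\<Sum>b\<in>{k..<M}. S' (p + int b) (T_op (b - k) f))"
      by (rule sum.mono_neutral_cong_right) auto
    also have "\<dots> = (\<Sum>b<M - k. S' (p + int k + int b) (T_op b f))"
      by (rule sum.reindex_bij_witness[of _ "\<lambda>b. b + k" "\<lambda>b. b - k"]) auto
    also have "\<dots> = (\<Sum>b<M. S' (p + int k + int b) (T_op b f))"
      by (rule sum.mono_neutral_left) (auto simp: M_def k_def B lin_apply[OF lin_S'])
    finally have *: "(\<Sum>b<M. if k \<le> b then S' (p + int b) (T_op (b - k) f) else 0) = (\<Sum>b<M. S' (p + int k + int b) (T_op b f))" .
    have "bt N (S' (p + int b) (T_op b f)) = S' (p + int b) (T_op b (bt N f)) -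
        (if k \<le> b then S' (p + int b) (T_op (b - k) f) else 0)" for b
      using N neg by (auto simp: bt_S' bt_T lin_apply[OF lin_S'] k_def nat_le_iff)
    then have "bt N (YY j p f) = smul (cY j) (\<Sum>b<M. S' (p + int b) (T_op b (bt N f)) -
        (if k \<le> b then S' (p + int b) (T_op (b - k) f) else 0))"
      by (simp add: YY_eq[of M] 1 lin_apply[OF lin_beta])
    also have "\<dots> = YY j p (bt N f) - YY j (p - N) f"
      unfolding sum_subtractf * using YY_eq[of M "bt N f", OF 1(2)] YY_eq[of M f j "p + int k", OF 1(1)]
      by (simp add: smul.scale_right_diff_distrib k(1))
    finally show ?thesis .
  qed
qed

lemma Wt_YY: "Wt (YY j p f) = YY j p (Wt f) + smul (of_int p / 2) (YY j p f)"
proof -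
  obtain B where B: "\<And>b. b \<ge> B \<Longrightarrow> T_op b f = 0" using T_eventually_0 by metis
  have B': "T_op b (Wt f) = 0" if "b \<ge> B" for b
    using Wt_T[of b f] B[OF that] by (simp add: lin_apply[OF lin_Wt])
  have "Wt (S' (p + int b) (T_op b f)) = S' (p + int b) (T_op b (Wt f)) + smul (of_int p / 2) (S' (p + int b) (T_op b f))" for b
  proof (cases "p + int b < 0")
    case False
    then have "(of_nat (nat (p + int b)) :: complex) = of_int p + of_nat b" by (metis not_less of_int_add of_int_of_nat_eq of_nat_nat)
    with False show ?thesis
      by (simp add: S'_def Wt_S Wt_T lin_apply[OF lin_S] add_divide_distrib smul.scale_left_distrib)
  qed (simp add: S'_def lin_apply[OF lin_Wt])
  then show ?thesis
    by (simp add: YY_eq[of B] B B' lin_apply[OF lin_Wt] sum.distrib smul.scale_right_distrib smul_sum mult.commute)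
qed

lemma beta_Fock:
  assumes "f \<in> Fock" "k \<in> half_odds" shows "beta k f \<in> Fock"
proof (rule lin_supp_mem[OF _ lin_beta assms(1)[unfolded Fock_eq_supp]])
  show "smul.subspace Fock" unfolding Fock_eq_supp by (rule subspace_supp)
  fix m :: "rat \<Rightarrow>\<^sub>0 nat" assume m: "m \<in> {m. Poly_Mapping.keys m \<subseteq> {k \<in> half_odds. k > 0}}"
  have "- k \<in> half_odds" using assms(2) by (auto simp: half_odds_def half_ints_def)
  moreover have "Poly_Mapping.keys (m - Poly_Mapping.single k 1) \<subseteq> Poly_Mapping.keys m"
    by (auto simp: in_keys_iff lookup_minus)
  moreover have "Poly_Mapping.keys (Poly_Mapping.single (- k) 1 + m) \<subseteq> insert (- k) (Poly_Mapping.keys m)"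
    using Poly_Mapping.keys_add[of "Poly_Mapping.single (- k) (1::nat)" m] by auto
  ultimately show "beta k (basis_vec m) \<in> Fock"
    using m by (auto simp: beta_basis_vec Fock_eq_supp simp del: One_nat_def intro!: smul.subspace_scale[OF subspace_supp])
qed

lemma subspace_Fock: "smul.subspace Fock"
  unfolding Fock_eq_supp by (rule subspace_supp)

lemma S_Fock: "f \<in> Fock \<Longrightarrow> S_op n f \<in> Fock"
  by (rule series_exp_closed[OF subspace_Fock])
    (auto simp: creation_alt half_odds_of_int intro!: smul.subspace_scale[OF subspace_Fock] smul.subspace_0[OF subspace_Fock] beta_Fock simp del: of_int_minus of_int_of_nat_eq)

lemma T_Fock: "f \<in> Fock \<Longrightarrow> T_op n f \<in> Fock"
  by (rule series_exp_closed[OF subspace_Fock])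
    (auto simp: annihilation_alt half_odds_of_int intro!: smul.subspace_scale[OF subspace_Fock] smul.subspace_0[OF subspace_Fock] smul.subspace_neg[OF subspace_Fock] beta_Fock simp del: of_int_minus of_int_of_nat_eq)

lemma YY_Fock:
  assumes "f \<in> Fock" shows "YY j p f \<in> Fock"
proof -
  obtain B where B: "\<And>b. b \<ge> B \<Longrightarrow> T_op b f = 0" using T_eventually_0 by metis
  show ?thesis
    by (subst YY_eq[of B, OF B]) (auto simp: S'_def intro!: smul.subspace_scale[OF subspace_Fock] smul.subspace_sum[OF subspace_Fock]
        smul.subspace_0[OF subspace_Fock] S_Fock T_Fock assms)
qed

lemma YY_one: "YY j p fock_one = smul (cY j) (S' p fock_one)"
  by (subst YY_eq[of 1]) (auto simp: T_one)

text \<open>Only the term in which the creation exponential contributes its constant 1 has a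
  constant component; this leaves the contraction coefficient times \<open>cY j\<close>.\<close>

lemma lookup_YY_S:
  "Poly_Mapping.lookup (YY j p (S_op a fock_one)) 0 = (if p = - int a then cY j * (if a = 0 then 1 else 2) else 0)"
proof -
  obtain B where B: "\<And>b. b \<ge> B \<Longrightarrow> T_op b (S_op a fock_one) = 0" using T_eventually_0 by metis
  have B': "T_op b (S_op a fock_one) = 0" if "b \<ge> Suc (max B a)" for b using that B by simp
  have "Poly_Mapping.lookup (YY j p (S_op a fock_one)) 0
      = cY j * (\<Sum>b<Suc (max B a). if a = b then if p = - int a then if a = 0 then 1 else 2 else 0 else 0)"
    by (subst YY_eq[of "Suc (max B a)", OF B'], assumption, unfold lookup_smul lookup_sum, intro arg_cong[of _ _ "(*) (cY j)"] sum.cong) (auto simp: S'_def lookup_S_0 lookup_T_S_one)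
  moreover have "a < Suc (max B a)" by simp
  ultimately show ?thesis by (simp add: sum.delta' del: sum.lessThan_Suc)
qed

subsection \<open>Tensor products\<close>

lemma tensor_add_left: "(f + f') \<otimes>\<^sub>v g = f \<otimes>\<^sub>v g + f' \<otimes>\<^sub>v g"
  and tensor_smul_left: "smul c f \<otimes>\<^sub>v g = smul c (f \<otimes>\<^sub>v g)"
  by (simp_all add: tensor_def lin_ext_add lin_ext_smul)

lemma tensor_add_right: "f \<otimes>\<^sub>v (g + g') = f \<otimes>\<^sub>v g + f \<otimes>\<^sub>v g'"
  and tensor_smul_right: "f \<otimes>\<^sub>v smul c g = smul c (f \<otimes>\<^sub>v g)"
  by (simp_all add: tensor_def lin_ext_add lin_ext_smul lin_ext_def[of _ f] smul.scale_right_distrib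
      sum.distrib smul_sum mult.commute)

lemma lin_tensor_left: "lin (\<lambda>f. f \<otimes>\<^sub>v g)" and lin_tensor_right: "lin (\<lambda>g. f \<otimes>\<^sub>v g)"
  by (auto intro!: linI simp: tensor_add_left tensor_smul_left tensor_add_right tensor_smul_right)

lemmas tensor_simps = lin_apply[OF lin_tensor_left] lin_apply[OF lin_tensor_right]

lemma tensor_basis_vec: "basis_vec a \<otimes>\<^sub>v basis_vec b = basis_vec (a, b)"
  by (simp add: tensor_def lin_ext_basis_vec)

lemma lin_tensor_map [simp]: "lin (tensor_map A B)"
  by (simp add: tensor_map_def)

lemma tensor_map_tensor:
  assumes A: "lin A" and B: "lin B"
  shows "tensor_map A B (f \<otimes>\<^sub>v g) = A f \<otimes>\<^sub>v B g"
proof -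
  have "tensor_map A B (f \<otimes>\<^sub>v g) = lin_ext (\<lambda>a. lin_ext (\<lambda>b. A (basis_vec a) \<otimes>\<^sub>v B (basis_vec b)) g) f"
    by (simp add: tensor_map_def tensor_def[of f g] lin_ext_lin_ext lin_ext_basis_vec)
  also have "\<dots> = lin_ext (\<lambda>a. A (basis_vec a) \<otimes>\<^sub>v B g) f"
    by (subst lin_expand[OF B, of g]) (simp add: lin_ext_def tensor_simps)
  also have "\<dots> = A f \<otimes>\<^sub>v B g"
    by (subst lin_expand[OF A, of f]) (simp add: lin_ext_def tensor_simps)
  finally show ?thesis .
qed

lemma tensor_supp:
  assumes "f \<in> supp A" "g \<in> supp B" shows "f \<otimes>\<^sub>v g \<in> supp (A \<times> B)"
proof (rule lin_supp_mem[OF subspace_supp lin_tensor_left assms(1)])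
  fix a assume a: "a \<in> A"
  show "basis_vec a \<otimes>\<^sub>v g \<in> supp (A \<times> B)"
    by (rule lin_supp_mem[OF subspace_supp lin_tensor_right assms(2)]) (simp add: a tensor_basis_vec)
qed

lemma tensor_space_supp: "tensor_space (supp A) (supp B) = supp (A \<times> B)"
proof
  show "tensor_space (supp A) (supp B) \<subseteq> supp (A \<times> B)"
    unfolding tensor_space_def by (rule smul.span_minimal[OF _ subspace_supp]) (auto intro: tensor_supp)
  show "supp (A \<times> B) \<subseteq> tensor_space (supp A) (supp B)"
  proof
    fix t assume "t \<in> supp (A \<times> B)"
    then show "t \<in> tensor_space (supp A) (supp B)"
    proof (rule lin_supp_mem[where F = "\<lambda>x. x", rotated 2])
      show "lin (\<lambda>x. x)" by (rule linI) auto
      show "smul.subspace (tensor_space (supp A) (supp B))" by (simp add: tensor_space_def)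
      fix x assume "x \<in> A \<times> B"
      then obtain a b where "x = (a, b)" "a \<in> A" "b \<in> B" by auto
      then have "basis_vec x \<in> {f \<otimes>\<^sub>v g |f g. f \<in> supp A \<and> g \<in> supp B}"
        by (auto simp flip: tensor_basis_vec intro!: exI[of _ "basis_vec a"] exI[of _ "basis_vec b"])
      then show "basis_vec x \<in> tensor_space (supp A) (supp B)"
        unfolding tensor_space_def by (rule smul.span_base)
    qed
  qed
qed

text \<open>Finitely many basis vectors occur in \<open>t\<close>, so one finite index set
  \<open>R\<close> contains the supports of all the sums involved.\<close>

lemma Sum_any_lin:
  assumes F: "\<And>r. lin (F r)" and t: "t \<in> supp A" and fin: "\<And>a. a \<in> A \<Longrightarrow> finite {r. F r (basis_vec a) \<noteq> 0}"
  shows "Sum_any (\<lambda>r. F r t) = lin_ext (\<lambda>a. Sum_any (\<lambda>r. F r (basis_vec a))) t"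
proof -
  define R where "R = (\<Union>a\<in>Poly_Mapping.keys t. {r. F r (basis_vec a) \<noteq> 0})"
  have R: "finite R" unfolding R_def using t fin by (auto simp: supp_def)
  have F': "F r t = (\<Sum>a\<in>Poly_Mapping.keys t. smul (Poly_Mapping.lookup t a) (F r (basis_vec a)))" for r
    by (subst lin_expand[OF F]) (simp add: lin_ext_def)
  have "{r. F r t \<noteq> 0} \<subseteq> R"
    unfolding F' by (force simp: R_def elim: sum.not_neutral_contains_not_neutral)
  then have "Sum_any (\<lambda>r. F r t) = (\<Sum>r\<in>R. F r t)"
    by (rule Sum_any.expand_superset[OF R])
  also have "\<dots> = (\<Sum>a\<in>Poly_Mapping.keys t. smul (Poly_Mapping.lookup t a) (\<Sum>r\<in>R. F r (basis_vec a)))"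
    unfolding F' by (subst sum.swap) (simp add: smul_sum)
  also have "\<dots> = lin_ext (\<lambda>a. Sum_any (\<lambda>r. F r (basis_vec a))) t"
    unfolding lin_ext_def
    by (intro sum.cong refl arg_cong[of _ _ "smul _"] Sum_any.expand_superset[OF R, symmetric]) (auto simp: R_def)
  finally show ?thesis .
qed

text \<open>Injectivity of \<open>d\<close> at \<open>a\<close> means that no other basis vector
  contributes to the coefficient at \<open>d a\<close>, so nothing can cancel.\<close>

lemma lookup_lowering:
  assumes F: "lin F" "\<And>b. b \<in> Poly_Mapping.keys f \<Longrightarrow> F (basis_vec b) = smul (c b) (basis_vec (d b))"
    and inj: "\<And>b. b \<in> Poly_Mapping.keys f \<Longrightarrow> c b \<noteq> 0 \<Longrightarrow> d b = d a \<Longrightarrow> b = a"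
    and a: "a \<in> Poly_Mapping.keys f"
  shows "Poly_Mapping.lookup (F f) (d a) = c a * Poly_Mapping.lookup f a"
proof -
  have "Poly_Mapping.lookup (F f) (d a)
      = (\<Sum>b\<in>Poly_Mapping.keys f. Poly_Mapping.lookup f b * (c b * (if d b = d a then 1 else 0)))"
    by (subst lin_expand[OF F(1)]) (simp add: lin_ext_def lookup_sum F(2) lookup_basis_vec mult.assoc)
  also have "\<dots> = (\<Sum>b\<in>Poly_Mapping.keys f. if b = a then c a * Poly_Mapping.lookup f a else 0)"
    by (rule sum.cong) (use inj in auto)
  finally show ?thesis using a by simp
qed

lemma keys_lowering:
  assumes "lin F" "\<And>b. b \<in> Poly_Mapping.keys f \<Longrightarrow> F (basis_vec b) = smul (c b) (basis_vec (d b))"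
  shows "Poly_Mapping.keys (F f) \<subseteq> d ` {b \<in> Poly_Mapping.keys f. c b \<noteq> 0}"
proof
  fix x assume "x \<in> Poly_Mapping.keys (F f)"
  then have "(\<Sum>b\<in>Poly_Mapping.keys f. Poly_Mapping.lookup f b * (c b * (if d b = x then 1 else 0))) \<noteq> 0"
    by (subst (asm) lin_expand[OF assms(1)]) (simp add: lin_ext_def lookup_sum assms(2) lookup_basis_vec in_keys_iff mult.assoc)
  then show "x \<in> d ` {b \<in> Poly_Mapping.keys f. c b \<noteq> 0}"
    by (rule sum.not_neutral_contains_not_neutral) (auto split: if_splits)
qed

text \<open>Used twice: for positive Heisenberg modes, which remove a variable from a monomial, and
  for positive fermionic modes, which remove an index from a set. As long as some label of the
  vector is not killed by some \<open>F x\<close>, applying that operator gives a nonzero vector of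
  smaller total size.\<close>

lemma lowering_induct:
  fixes sz :: "'a \<Rightarrow> nat"
  assumes F: "\<And>x. x \<in> I \<Longrightarrow> lin (F x)"
    and step: "\<And>x b. x \<in> I \<Longrightarrow> b \<in> A \<Longrightarrow> F x (basis_vec b) = smul (c x b) (basis_vec (d x b))"
    and inj: "\<And>x a b. x \<in> I \<Longrightarrow> a \<in> A \<Longrightarrow> b \<in> A \<Longrightarrow> c x a \<noteq> 0 \<Longrightarrow> c x b \<noteq> 0 \<Longrightarrow> d x a = d x b \<Longrightarrow> a = b"
    and sz: "\<And>x b. x \<in> I \<Longrightarrow> b \<in> A \<Longrightarrow> c x b \<noteq> 0 \<Longrightarrow> sz (d x b) < sz b"
    and U: "U \<subseteq> supp A" "\<And>x u. x \<in> I \<Longrightarrow> u \<in> U \<Longrightarrow> F x u \<in> U"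
    and f: "f \<in> U" "f \<noteq> 0"
  obtains g where "g \<in> U" "g \<noteq> 0" "\<And>a x. a \<in> Poly_Mapping.keys g \<Longrightarrow> x \<in> I \<Longrightarrow> c x a = 0"
proof -
  have "\<exists>g\<in>U. g \<noteq> 0 \<and> (\<forall>a\<in>Poly_Mapping.keys g. \<forall>x\<in>I. c x a = 0)"
    using f
  proof (induction "\<Sum>a\<in>Poly_Mapping.keys f. sz a" arbitrary: f rule: less_induct)
    case less
    have A: "b \<in> A" if "b \<in> Poly_Mapping.keys f" for b using U(1) less.prems(1) that by (auto simp: supp_def)
    show ?case
    proof (cases "\<forall>a\<in>Poly_Mapping.keys f. \<forall>x\<in>I. c x a = 0")
      case True then show ?thesis using less.prems by blast
    next
      case False
      then obtain a x where ax: "a \<in> Poly_Mapping.keys f" "x \<in> I" "c x a \<noteq> 0" by blast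
      let ?K = "{b \<in> Poly_Mapping.keys f. c x b \<noteq> 0}"
      have "Poly_Mapping.lookup (F x f) (d x a) = c x a * Poly_Mapping.lookup f a"
        by (rule lookup_lowering[OF F[OF ax(2)]]) (use ax A step inj in blast)+
      then have nz: "F x f \<noteq> 0" using ax by (auto simp: in_keys_iff)
      have "(\<Sum>b\<in>Poly_Mapping.keys (F x f). sz b) \<le> (\<Sum>b\<in>d x ` ?K. sz b)"
        by (rule sum_mono2) (use keys_lowering[OF F[OF ax(2)], of f "c x" "d x"] step[OF ax(2)] A in auto)
      also have "\<dots> = (\<Sum>b\<in>?K. sz (d x b))"
        by (subst sum.reindex) (use inj[OF ax(2)] A in \<open>auto simp: inj_on_def\<close>)
      also have "\<dots> < (\<Sum>b\<in>?K. sz b)"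
        by (rule sum_strict_mono) (use sz ax A in auto)
      also have "\<dots> \<le> (\<Sum>b\<in>Poly_Mapping.keys f. sz b)"
        by (rule sum_mono2) auto
      finally show ?thesis using less.hyps U(2)[OF ax(2) less.prems(1)] nz by blast
    qed
  qed
  then show ?thesis using that by blast
qed

subsection \<open>The fermionic modes\<close>

lemma lin_Phi [simp]: "lin (Phi i r)"
  by (simp add: Phi_def)

definition WtE :: "ext \<Rightarrow> ext" where
  "WtE = lin_ext (\<lambda>S. smul (of_rat (\<Sum>S)) (basis_vec S))"

lemma lin_WtE [simp]: "lin WtE" by (simp add: WtE_def)

lemma WtE_basis_vec: "WtE (basis_vec S) = smul (of_rat (\<Sum>S)) (basis_vec S)"
  by (simp add: WtE_def lin_ext_basis_vec)

lemma WtE_Phi: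
  assumes "f \<in> FT" shows "WtE (Phi i r f) = Phi i r (WtE f) + smul (of_rat r) (Phi i r f)"
proof (rule lin_eq_suppI[OF _ _ assms[unfolded FT_def ext_alg_eq_supp]])
  show "lin (\<lambda>f. WtE (Phi i r f))" "lin (\<lambda>f. Phi i r (WtE f) + smul (of_rat r) (Phi i r f))"
    by (rule linI; simp add: lin_apply[OF lin_Phi] lin_apply[OF lin_WtE] smul.scale_right_distrib mult.commute)+
  fix S assume S: "S \<in> {S. finite S \<and> S \<subseteq> {r \<in> half_ints. r < 0}}"
  have s: "\<Sum>(S - {- r}) = \<Sum>S + r" if "- r \<in> S" using S that by (simp add: sum_diff1)
  consider "r < 0" "r \<in> S" | "r < 0" "r \<notin> S" | "r = 0" | "r > 0" "- r \<in> S" | "r > 0" "- r \<notin> S" by linarith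
  then show "WtE (Phi i r (basis_vec S)) = Phi i r (WtE (basis_vec S)) + smul (of_rat r) (Phi i r (basis_vec S))"
    by cases (use S s in \<open>simp_all add: WtE_basis_vec lin_apply[OF lin_Phi] lin_apply[OF lin_WtE] Phi_lin Phi_basis_alt of_rat_add mult_ac
        flip: smul.scale_left_distrib\<close>, simp_all add: algebra_simps of_rat_add)
qed

lemma Phi_eventually_0:
  assumes "f \<in> FT" shows "\<exists>hi. \<forall>n>hi. Phi i (of_int n / 2) f = 0"
proof (intro exI allI impI)
  let ?T = "\<Union>(Poly_Mapping.keys f)"
  fix n assume n: "n > (\<Sum>s\<in>?T. int (nat \<lceil>- 2 * s\<rceil>))"
  have fin: "finite ?T" using assms by (auto simp: FT_def ext_alg_def)
  have "(0::int) \<le> (\<Sum>s\<in>?T. int (nat \<lceil>- 2 * s\<rceil>))" by (rule sum_nonneg) auto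
  with n have "n > 0" by linarith
  have "- (of_int n / 2) \<notin> S" if S: "S \<in> Poly_Mapping.keys f" for S
  proof
    assume "- (of_int n / 2) \<in> S"
    then have "int (nat \<lceil>- 2 * (- (of_int n / 2) :: rat)\<rceil>) \<le> (\<Sum>s\<in>?T. int (nat \<lceil>- 2 * s\<rceil>))"
      using S fin by (intro member_le_sum) auto
    then show False using n \<open>n > 0\<close> by simp
  qed
  then show "Phi i (of_int n / 2) f = 0" using \<open>n > 0\<close>
    by (simp add: Phi_def lin_ext_def Phi_basis_alt)
qed

lemma half_ints_of_int: "of_int n / 2 \<in> half_ints"
  by (simp add: half_ints_def)

lemma half_intsE:
  assumes "r \<in> half_ints" obtains n where "r = of_int n / 2"
proof -
  obtain n where "2 * r = of_int n" using assms by (auto simp: half_ints_def elim: Ints_cases)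
  then have "r = of_int n / 2" by simp
  then show ?thesis by (rule that)
qed

section \<open>The twisted module\<close>

lemma YY_below_0: "\<exists>lo. \<forall>p<lo. YY j p g = 0"
proof -
  obtain B where B: "\<And>b. b \<ge> B \<Longrightarrow> T_op b g = 0" using T_eventually_0 by metis
  have "YY j p g = 0" if "p < - int B" for p
    using that by (simp add: YY_eq[of B] B) (rule sum.neutral, auto simp: S'_def)
  then show ?thesis by blast
qed

text \<open>The sign \<open>(-1)^(2r)\<close> of the Clifford relation at the mode
  \<open>r = n / 2\<close>.\<close>

definition sg :: "int \<Rightarrow> complex" where "sg n = (if even n then 1 else - 1)"

lemma lin_ext_zero_coeff_tensor: "lin_ext (\<lambda>(S, m). if m = 0 then basis_vec S else 0) (f \<otimes>\<^sub>v g) = smul (Poly_Mapping.lookup g 0) f"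
  for f :: "'a \<Rightarrow>\<^sub>0 complex" and g :: "'b::zero \<Rightarrow>\<^sub>0 complex"
proof -
  have "lin_ext (\<lambda>(S, m). if m = 0 then basis_vec S else 0) (f \<otimes>\<^sub>v g)
    = lin_ext (\<lambda>a. lin_ext (\<lambda>b. if b = 0 then basis_vec a else 0) g) f"
    by (simp add: tensor_def lin_ext_lin_ext lin_ext_basis_vec)
  also have "(\<lambda>a. lin_ext (\<lambda>b. if b = 0 then basis_vec a else 0) g) = (\<lambda>a::'a. smul (Poly_Mapping.lookup g 0) (basis_vec a))"
  proof
    fix a :: 'a
    have "lin_ext (\<lambda>b. if b = 0 then basis_vec a else 0) g
      = (\<Sum>b\<in>Poly_Mapping.keys g. if b = 0 then smul (Poly_Mapping.lookup g 0) (basis_vec a) else 0)"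
      unfolding lin_ext_def by (rule sum.cong) auto
    then show "lin_ext (\<lambda>b. if b = 0 then basis_vec a else 0) g = smul (Poly_Mapping.lookup g 0) (basis_vec a)"
      by (simp add: in_keys_iff)
  qed
  finally show ?thesis by (simp add: lin_ext_id)
qed

definition Ev :: "tens \<Rightarrow> ext" where "Ev = lin_ext (\<lambda>(S, m). if m = 0 then basis_vec S else 0)"

lemma lin_Ev [simp]: "lin Ev" by (simp add: Ev_def)

lemma Ev_tensor: "Ev (f \<otimes>\<^sub>v g) = smul (Poly_Mapping.lookup g 0) f"
  unfolding Ev_def by (rule lin_ext_zero_coeff_tensor)

text \<open>Indices in the exterior factor are mode numbers already, whereas the variable of index
  \<open>k\<close> stands for a mode \<open>- k\<close>; hence the minus sign at
  \<open>wt\<close>.\<close>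

definition Deg :: "tens \<Rightarrow> tens" where
  "Deg = lin_ext (\<lambda>(S, m). smul (of_rat (\<Sum>S - wt m)) (basis_vec (S, m)))"

lemma lin_Deg [simp]: "lin Deg" by (simp add: Deg_def)

lemma Deg_basis_vec: "Deg (basis_vec (S, m)) = smul (of_rat (\<Sum>S - wt m)) (basis_vec (S, m))"
  by (simp add: Deg_def lin_ext_basis_vec)

lemma lin_id [simp]: "lin id" by (rule linI) auto

lemma Deg_tensor: "Deg (f \<otimes>\<^sub>v g) = WtE f \<otimes>\<^sub>v g - f \<otimes>\<^sub>v Wt g"
proof -
  have "Deg t = tensor_map WtE id t - tensor_map id Wt t" for t
  proof (rule lin_eqI[where F = Deg])
    show "lin (\<lambda>t. tensor_map WtE id t - tensor_map id Wt t)"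
      by (rule linI) (simp_all add: lin_apply[OF lin_tensor_map] smul.scale_right_diff_distrib)
    fix a :: "rat set \<times> (rat \<Rightarrow>\<^sub>0 nat)"
    obtain S m where a: "a = (S, m)" by force
    show "Deg (basis_vec a) = tensor_map WtE id (basis_vec a) - tensor_map id Wt (basis_vec a)"
      unfolding a Deg_basis_vec unfolding tensor_basis_vec[symmetric]
      by (simp add: tensor_map_tensor tensor_simps WtE_basis_vec Wt_basis_vec of_rat_diff smul.scale_left_diff_distrib)
  qed simp
  then show ?thesis by (simp add: tensor_map_tensor)
qed

lemma Deg_eigenvector:
  assumes "Deg t = smul (of_rat c) t" "(S, m) \<in> Poly_Mapping.keys t" shows "\<Sum>S - wt m = c"
proof -
  have D: "Deg = lin_ext (\<lambda>x. smul (of_rat (\<Sum>(fst x) - wt (snd x))) (basis_vec x))"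
    by (simp add: Deg_def case_prod_unfold)
  have "of_rat (\<Sum>S - wt m) * Poly_Mapping.lookup t (S, m) = of_rat c * Poly_Mapping.lookup t (S, m)"
    using arg_cong[OF assms(1), of "\<lambda>f. Poly_Mapping.lookup f (S, m)"] by (simp add: D lookup_lin_ext_diag)
  then show ?thesis using assms(2) by (simp add: in_keys_iff)
qed

abbreviation Bt :: "int \<Rightarrow> tens \<Rightarrow> tens" where "Bt N \<equiv> tensor_map id (bt N)"

lemma Bt_tensor: "Bt N (f \<otimes>\<^sub>v g) = f \<otimes>\<^sub>v bt N g"
  by (simp add: tensor_map_tensor)

lemma Bt_commutator:
  assumes "odd M" "odd N"
  shows "Bt M (Bt N t) = Bt N (Bt M t) + (if M + N = 0 then smul (- of_int M / 2) t else 0)"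
proof (rule lin_eqI[where F = "\<lambda>t. Bt M (Bt N t)"])
  show "lin (\<lambda>t. Bt M (Bt N t))" "lin (\<lambda>t. Bt N (Bt M t) + (if M + N = 0 then smul (- of_int M / 2) t else 0))"
    by (rule linI; simp add: lin_apply[OF lin_tensor_map] smul.scale_right_distrib smul.scale_right_diff_distrib mult.commute)+
  fix a :: "rat set \<times> (rat \<Rightarrow>\<^sub>0 nat)" 
  obtain S m where a: "a = (S, m)" by force
  show "Bt M (Bt N (basis_vec a)) = Bt N (Bt M (basis_vec a)) + (if M + N = 0 then smul (- of_int M / 2) (basis_vec a) else 0)"
    using bt_commutator[OF assms, of "basis_vec m"]
    by (simp add: a Bt_tensor tensor_simps flip: tensor_basis_vec)
qed

lemma Deg_Bt:
  assumes "odd N" shows "Deg (Bt N t) = Bt N (Deg t) + smul (of_int N / 2) (Bt N t)"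
proof (rule lin_eqI[where F = "\<lambda>t. Deg (Bt N t)"])
  show "lin (\<lambda>t. Deg (Bt N t))" "lin (\<lambda>t. Bt N (Deg t) + smul (of_int N / 2) (Bt N t))"
    by (rule linI; simp add: lin_apply[OF lin_tensor_map] lin_apply[OF lin_Deg] smul.scale_right_distrib mult.commute)+
  fix a :: "rat set \<times> (rat \<Rightarrow>\<^sub>0 nat)" 
  obtain S m where a: "a = (S, m)" by force
  have "N \<noteq> 0" using assms by auto
  then show "Deg (Bt N (basis_vec a)) = Bt N (Deg (basis_vec a)) + smul (of_int N / 2) (Bt N (basis_vec a))"
    by (simp add: a Bt_tensor Deg_tensor tensor_simps lin_apply[OF lin_tensor_map] Wt_beta of_rat_minus of_rat_divide flip: tensor_basis_vec)
qed

definition good :: "(rat \<Rightarrow>\<^sub>0 nat) set" where "good = {m. Poly_Mapping.keys m \<subseteq> {k \<in> half_odds. k > 0}}"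

lemma Fock_supp_good: "Fock = supp good" by (simp add: Fock_eq_supp good_def)

lemma one_Fock [simp]: "fock_one \<in> Fock" by (simp add: Fock_supp_good good_def)

section \<open>The modes of \<open>X\<^sub>+(z)\<close> as operators\<close>

locale twisted_module =
  fixes i j :: nat and l :: rat
  assumes l_half_int: "l \<in> half_ints" and l_less: "l < 1 / 2"
begin

definition GG :: "int \<Rightarrow> ext \<Rightarrow> ext" where "GG n = G i l (of_int n / 2)"

definition neg_modes :: "rat set" where "neg_modes = {n \<in> half_ints. n < 0 \<and> n \<noteq> l - 1 / 2}"

definition "ext_basis = {S. finite S \<and> S \<subseteq> neg_modes}"

text \<open>The tensor product is given by its basis labels so that identities can be checked on
  basis vectors; \<open>tensor_space_eq\<close> identifies the two descriptions.\<close>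

definition V :: "tens set" where "V = supp (ext_basis \<times> good)"

text \<open>\<open>X_coeff\<close> is a linear map only where the sum over modes is finite: \<open>Sum_any\<close> is \<open>0\<close> on an
  infinite support, which does occur at basis vectors indexed by infinite sets.\<close>

definition X :: "int \<Rightarrow> tens \<Rightarrow> tens" where
  "X N = lin_ext (\<lambda>a. X_coeff i j l (of_int N / 2) (basis_vec a))"

text \<open>The scalar \<open>{G(n/2), G(-n/2)}\<close>: the Clifford constant times the product of
  \<open>l - 1/2 - n/2\<close> and \<open>l - 1/2 + n/2\<close>.\<close>

definition cg :: "int \<Rightarrow> complex" where
  "cg n = - sg n * (of_rat (l - 1 / 2) ^ 2 - of_int n ^ 2 / 4)"

lemma lin_GG [simp]: "lin (GG n)"
  by (rule linI) (simp_all add: GG_def G_def lin_apply[OF lin_Phi] smul.scale_right_distrib mult.commute)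

lemma lin_X [simp]: "lin (X N)" by (simp add: X_def)

lemma X_coeff_Sum_any:
  "X_coeff i j l (of_int N / 2) t = smul (1 / of_real (sqrt 2)) (Sum_any (\<lambda>r. tensor_map (GG r) (YY j (r - N)) t))"
proof -
  let ?g = "\<lambda>r. tensor_map (G i l r) (Ytw j (r + 1 / 2 - of_int N / 2)) t when r \<in> half_ints"
  let ?h = "\<lambda>r. tensor_map (GG r) (YY j (r - N)) t"
  have gh: "?g (of_int n / 2) = ?h n" for n
  proof -
    have "YY j (n - N) = Ytw j (of_int n / 2 + 1 / 2 - of_int N / 2)"
      unfolding YY_def by (rule arg_cong[of _ _ "Ytw j"]) (simp add: diff_divide_distrib)
    then show ?thesis by (simp add: half_ints_of_int GG_def)
  qed
  have "{r. ?g r \<noteq> 0} = (\<lambda>n. of_int n / 2) ` {n. ?h n \<noteq> 0}"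
  proof safe
    fix r assume "?g r \<noteq> 0"
    then have "r \<in> half_ints" by (auto simp: when_def split: if_splits)
    then obtain n where n: "r = of_int n / 2" by (rule half_intsE)
    then have "?h n \<noteq> 0" using \<open>?g r \<noteq> 0\<close> gh by metis
    then show "r \<in> (\<lambda>n. of_int n / 2) ` {n. ?h n \<noteq> 0}" using n by blast
  next
    fix n assume "?h n \<noteq> 0" "?g (of_int n / 2) = 0"
    then show False using gh by metis
  qed
  then have "Sum_any ?g = Sum_any ?h"
    unfolding Sum_any.expand_set
    by (subst sum.reindex_cong[where l = "\<lambda>n. of_int n / 2" and B = "{n. ?h n \<noteq> 0}" and h = ?h]) (auto simp: inj_on_def gh)
  then show ?thesis by (simp add: X_coeff_def)
qed

lemma GG_eventually_0:
  assumes "f \<in> FT" shows "\<exists>hi. \<forall>n>hi. GG n f = 0"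
  using Phi_eventually_0[OF assms, of i] by (auto simp: GG_def G_def)

text \<open>\<open>GG r\<close> kills \<open>f\<close> for large \<open>r\<close>, and
  \<open>YY j (r - N)\<close> kills \<open>g\<close> for very negative \<open>r\<close>.\<close>

lemma finite_modes:
  assumes "f \<in> FT" shows "finite {r. GG r f \<otimes>\<^sub>v YY j (r - N) g \<noteq> 0}"
proof -
  obtain hi lo where "\<And>n. n > hi \<Longrightarrow> GG n f = 0" "\<And>p. p < lo \<Longrightarrow> YY j p g = 0"
    using GG_eventually_0[OF assms] YY_below_0 by metis
  then have "{r. GG r f \<otimes>\<^sub>v YY j (r - N) g \<noteq> 0} \<subseteq> {lo + N..hi}"
    by (force simp: tensor_simps not_less[symmetric])
  then show ?thesis by (rule finite_subset) simp
qed

lemma X_coeff_eq_X: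
  assumes t: "t \<in> supp ({S. finite S \<and> S \<subseteq> {r \<in> half_ints. r < 0}} \<times> UNIV)"
  shows "X_coeff i j l (of_int N / 2) t = X N t"
proof -
  have "Sum_any (\<lambda>r. tensor_map (GG r) (YY j (r - N)) t)
      = lin_ext (\<lambda>a. Sum_any (\<lambda>r. tensor_map (GG r) (YY j (r - N)) (basis_vec a))) t"
  proof (rule Sum_any_lin[OF _ t])
    fix a assume a: "a \<in> {S. finite S \<and> S \<subseteq> {r \<in> half_ints. r < 0}} \<times> (UNIV :: (rat \<Rightarrow>\<^sub>0 nat) set)"
    obtain S m where "a = (S, m)" by force
    with a show "finite {r. tensor_map (GG r) (YY j (r - N)) (basis_vec a) \<noteq> 0}"
      using finite_modes[of "basis_vec S" N "basis_vec m"]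
      by (simp add: FT_def ext_alg_eq_supp tensor_map_tensor flip: tensor_basis_vec)
  qed simp
  then show ?thesis
    by (simp add: X_def X_coeff_Sum_any) (simp add: lin_ext_def smul_sum mult.commute)
qed

lemma X_tensor_Sum_any:
  assumes f: "f \<in> FT"
  shows "X N (f \<otimes>\<^sub>v g) = smul (1 / of_real (sqrt 2)) (Sum_any (\<lambda>r. GG r f \<otimes>\<^sub>v YY j (r - N) g))"
proof -
  have "g \<in> supp UNIV" by (simp add: supp_def)
  then have "f \<otimes>\<^sub>v g \<in> supp ({S. finite S \<and> S \<subseteq> {r \<in> half_ints. r < 0}} \<times> UNIV)"
    using f by (intro tensor_supp) (auto simp: FT_def ext_alg_eq_supp)
  from X_coeff_eq_X[OF this, of N] show ?thesis by (simp add: X_coeff_Sum_any tensor_map_tensor)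
qed

lemma X_tensor:
  assumes f: "f \<in> FT" and I: "finite I" "\<And>r. r \<notin> I \<Longrightarrow> GG r f \<otimes>\<^sub>v YY j (r - N) g = 0"
  shows "X N (f \<otimes>\<^sub>v g) = smul (1 / of_real (sqrt 2)) (\<Sum>r\<in>I. GG r f \<otimes>\<^sub>v YY j (r - N) g)"
  unfolding X_tensor_Sum_any[OF f] using I by (subst Sum_any.expand_superset[of I]) auto

lemma ext_basis_FT: "S \<in> ext_basis \<Longrightarrow> basis_vec S \<in> FT"
  by (auto simp: ext_basis_def neg_modes_def FT_def ext_alg_eq_supp)

lemma supp_ext_basis_FT: "f \<in> supp ext_basis \<Longrightarrow> f \<in> FT"
  by (auto simp: ext_basis_def neg_modes_def FT_def ext_alg_eq_supp supp_def)

lemma V_eqI: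
  assumes "lin F" "lin F'" "t \<in> V"
    and "\<And>S m. S \<in> ext_basis \<Longrightarrow> m \<in> good \<Longrightarrow> F (basis_vec S \<otimes>\<^sub>v basis_vec m) = F' (basis_vec S \<otimes>\<^sub>v basis_vec m)"
  shows "F t = F' t"
  by (rule lin_eq_suppI[OF assms(1,2) assms(3)[unfolded V_def]]) (use assms(4) in \<open>auto simp: tensor_basis_vec\<close>)

lemma subspace_V: "smul.subspace V" unfolding V_def by (rule subspace_supp)

lemma V_memI:
  assumes "lin F" "t \<in> V"
    and "\<And>S m. S \<in> ext_basis \<Longrightarrow> m \<in> good \<Longrightarrow> F (basis_vec S \<otimes>\<^sub>v basis_vec m) \<in> V"
  shows "F t \<in> V"
  by (rule lin_supp_mem[OF subspace_V assms(1) assms(2)[unfolded V_def]]) (use assms(3) in \<open>auto simp: tensor_basis_vec\<close>)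

lemma Bt_X:
  assumes N: "odd N" and t: "t \<in> V"
  shows "Bt N (X M t) = X M (Bt N t) - X (M + N) t"
proof (rule V_eqI[where F = "\<lambda>t. Bt N (X M t)", OF _ _ t])
  show "lin (\<lambda>t. Bt N (X M t))" "lin (\<lambda>t. X M (Bt N t) - X (M + N) t)"
    by (rule linI; simp add: lin_apply[OF lin_tensor_map] lin_apply[OF lin_X] smul.scale_right_diff_distrib)+
  fix S and m :: "rat \<Rightarrow>\<^sub>0 nat" assume "S \<in> ext_basis"
  let ?f = "basis_vec S" and ?g = "basis_vec m"
  have f: "?f \<in> FT" by (rule ext_basis_FT) fact
  \<comment> \<open>One index set containing all three supports, so that the three sums can be
    compared term by term.\<close>
  define I where "I = {r. GG r ?f \<otimes>\<^sub>v YY j (r - M) ?g \<noteq> 0} \<union> {r. GG r ?f \<otimes>\<^sub>v YY j (r - M) (bt N ?g) \<noteq> 0}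
    \<union> {r. GG r ?f \<otimes>\<^sub>v YY j (r - (M + N)) ?g \<noteq> 0}"
  have I: "finite I" unfolding I_def using finite_modes[OF f] by simp
  have X: "X M (?f \<otimes>\<^sub>v ?g) = smul (1 / of_real (sqrt 2)) (\<Sum>r\<in>I. GG r ?f \<otimes>\<^sub>v YY j (r - M) ?g)"
      "X M (?f \<otimes>\<^sub>v bt N ?g) = smul (1 / of_real (sqrt 2)) (\<Sum>r\<in>I. GG r ?f \<otimes>\<^sub>v YY j (r - M) (bt N ?g))"
      "X (M + N) (?f \<otimes>\<^sub>v ?g) = smul (1 / of_real (sqrt 2)) (\<Sum>r\<in>I. GG r ?f \<otimes>\<^sub>v YY j (r - (M + N)) ?g)"
    by (rule X_tensor[OF f I]; simp add: I_def)+
  show "Bt N (X M (?f \<otimes>\<^sub>v ?g)) = X M (Bt N (?f \<otimes>\<^sub>v ?g)) - X (M + N) (?f \<otimes>\<^sub>v ?g)"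
    unfolding Bt_tensor X
    by (simp add: lin_apply[OF lin_tensor_map] Bt_tensor bt_YY[OF N] tensor_simps sum_subtractf smul.scale_right_diff_distrib diff_diff_eq)
qed

lemma WtE_GG:
  assumes "f \<in> FT" shows "WtE (GG n f) = GG n (WtE f) + smul (of_int n / 2) (GG n f)"
  by (simp add: GG_def G_def lin_apply[OF lin_WtE] WtE_Phi[OF assms] smul.scale_right_distrib of_rat_divide mult.commute)

lemma Deg_X:
  assumes t: "t \<in> V" shows "Deg (X N t) = X N (Deg t) + smul (of_int N / 2) (X N t)"
proof (rule V_eqI[where F = "\<lambda>t. Deg (X N t)", OF _ _ t])
  show "lin (\<lambda>t. Deg (X N t))" "lin (\<lambda>t. X N (Deg t) + smul (of_int N / 2) (X N t))"
    by (rule linI; simp add: lin_apply[OF lin_Deg] lin_apply[OF lin_X] smul.scale_right_distrib mult.commute)+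
  fix S and m :: "rat \<Rightarrow>\<^sub>0 nat" assume "S \<in> ext_basis"
  let ?f = "basis_vec S" and ?g = "basis_vec m"
  have f: "?f \<in> FT" by (rule ext_basis_FT) fact
  let ?I = "{r. GG r ?f \<otimes>\<^sub>v YY j (r - N) ?g \<noteq> 0}"
  have X: "X N (?f \<otimes>\<^sub>v ?g) = smul (1 / of_real (sqrt 2)) (\<Sum>r\<in>?I. GG r ?f \<otimes>\<^sub>v YY j (r - N) ?g)"
    by (rule X_tensor[OF f finite_modes[OF f]]) simp
  have D: "Deg (GG r ?f \<otimes>\<^sub>v YY j (r - N) ?g) = smul (of_rat (\<Sum>S - wt m) + of_int N / 2) (GG r ?f \<otimes>\<^sub>v YY j (r - N) ?g)" for r
    by (simp add: Deg_tensor WtE_GG[OF f] WtE_basis_vec Wt_YY Wt_basis_vec lin_apply[OF lin_GG] lin_apply[OF lin_YY] tensor_simps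
        of_rat_diff diff_divide_distrib flip: smul.scale_left_distrib smul.scale_left_diff_distrib)
  have "Deg (X N (?f \<otimes>\<^sub>v ?g)) = smul (of_rat (\<Sum>S - wt m) + of_int N / 2) (X N (?f \<otimes>\<^sub>v ?g))"
    unfolding X by (simp add: lin_apply[OF lin_Deg] D smul_sum mult.commute)
  then show "Deg (X N (?f \<otimes>\<^sub>v ?g)) = X N (Deg (?f \<otimes>\<^sub>v ?g)) + smul (of_int N / 2) (X N (?f \<otimes>\<^sub>v ?g))"
    by (simp add: tensor_basis_vec Deg_basis_vec lin_apply[OF lin_X] smul.scale_left_distrib)
qed

text \<open>The only mode that could create the omitted index is \<open>n / 2 = l - 1 / 2\<close>,
  and there the scalar factor \<open>l - n / 2 - 1 / 2\<close> of \<open>G\<close> is 0.\<close>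

lemma GG_ext_basis:
  assumes "f \<in> supp ext_basis" shows "GG n f \<in> supp ext_basis"
proof (rule lin_supp_mem[OF subspace_supp lin_GG assms])
  fix S assume S: "S \<in> ext_basis"
  show "GG n (basis_vec S) \<in> supp ext_basis"
  proof (cases "of_int n / 2 = l - 1 / 2")
    case True
    then have 0: "l - of_int n / 2 - 1 / 2 = 0" by linarith
    show ?thesis unfolding GG_def G_def 0 by (simp add: smul.subspace_0[OF subspace_supp])
  next
    case False
    then have "n < 0 \<Longrightarrow> of_int n / 2 \<in> neg_modes"
      by (auto simp: neg_modes_def half_ints_of_int)
    then show ?thesis using S by (auto simp: GG_def G_def Phi_lin Phi_basis_alt ext_basis_def smul.subspace_0[OF subspace_supp] intro!: smul.subspace_scale[OF subspace_supp] smul.subspace_neg[OF subspace_supp])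
  qed
qed

lemma tensor_V: "f \<in> supp ext_basis \<Longrightarrow> g \<in> Fock \<Longrightarrow> f \<otimes>\<^sub>v g \<in> V"
  unfolding V_def Fock_supp_good by (rule tensor_supp)

lemma Bt_V:
  assumes "odd N" "t \<in> V" shows "Bt N t \<in> V"
proof (rule V_memI[OF lin_tensor_map assms(2)])
  fix S and m :: "rat \<Rightarrow>\<^sub>0 nat" assume "S \<in> ext_basis" "m \<in> good"
  then show "Bt N (basis_vec S \<otimes>\<^sub>v basis_vec m) \<in> V"
    unfolding Bt_tensor by (intro tensor_V beta_Fock) (auto simp: half_odds_of_int assms(1) Fock_supp_good)
qed

lemma X_V:
  assumes "t \<in> V" shows "X N t \<in> V"
proof (rule V_memI[OF lin_X assms])
  fix S and m :: "rat \<Rightarrow>\<^sub>0 nat" assume Sm: "S \<in> ext_basis" "m \<in> good"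
  have "basis_vec m \<in> Fock" using Sm by (simp add: Fock_supp_good)
  then have "GG r (basis_vec S) \<otimes>\<^sub>v YY j (r - N) (basis_vec m) \<in> V" for r
    using Sm by (intro tensor_V GG_ext_basis YY_Fock) auto
  then show "X N (basis_vec S \<otimes>\<^sub>v basis_vec m) \<in> V"
    by (subst X_tensor[OF ext_basis_FT[OF Sm(1)] finite_modes[OF ext_basis_FT[OF Sm(1)]]]) (simp, intro smul.subspace_scale[OF subspace_V] smul.subspace_sum[OF subspace_V])
qed

lemma GG_anticommutator:
  assumes "f \<in> FT"
  shows "GG r (GG s f) = (if r + s = 0 then smul (cg s) f else 0) - GG s (GG r f)"
proof -
  let ?c = "\<lambda>r. of_rat (l - of_int r / 2 - 1 / 2) :: complex"
  have P: "Phi i (of_int r / 2) (Phi i (of_int s / 2) f) + Phi i (of_int s / 2) (Phi i (of_int r / 2) f)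
    = smul (if r + s = 0 then - sg s else 0) f"
  proof -
    have "of_int r / 2 + of_int s / 2 = (0::rat) \<longleftrightarrow> r + s = 0" by (simp flip: add_divide_distrib of_int_add)
    moreover have "r + s = 0 \<Longrightarrow> (- 1) powi r = sg s"
      by (auto simp: sg_def power_int_minus_one_minus dest!: eq_neg_iff_add_eq_0[THEN iffD2])
    ultimately show ?thesis
      using Phi_Clifford[OF assms half_ints_of_int[of r] half_ints_of_int[of s], of i] by (auto simp: when_def)
  qed
  have "GG r (GG s f) + GG s (GG r f) = smul (?c r * ?c s) (smul (if r + s = 0 then - sg s else 0) f)"
    unfolding P[symmetric] by (simp add: GG_def G_def lin_apply[OF lin_Phi] smul.scale_right_distrib mult.commute)
  also have "\<dots> = (if r + s = 0 then smul (cg s) f else 0)"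
  proof (cases "r + s = 0")
    case True
    then have r: "r = - s" by simp
    have "?c s = of_rat l - of_int s / 2 - 1 / 2" "?c (- s) = of_rat l + of_int s / 2 - 1 / 2"
      "of_rat (l - 1 / 2) = (of_rat l - 1 / 2 :: complex)"
      by (simp_all add: of_rat_diff of_rat_add of_rat_divide)
    moreover have "(of_rat l + of_int s / 2 - 1 / 2) * (of_rat l - of_int s / 2 - 1 / 2)
        = (of_rat l - 1 / 2)^2 - (of_int s :: complex)^2 / 4"
      by (simp add: power2_eq_square algebra_simps)
    ultimately show ?thesis unfolding r
      by (simp add: cg_def mult.commute)
  qed simp
  finally show ?thesis by (simp add: eq_diff_eq)
qed

text \<open>Each induction step adds the terms at \<open>M + 1\<close> and \<open>- M\<close>. These
  have opposite parity, so their contributions of \<open>(l - 1 / 2)^2\<close> cancel and only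
  squares of integers remain.\<close>

lemma sum_cg: "(\<Sum>s\<in>{- M<..M}. cg s) = sg M * of_int M / 4" if "M \<ge> 0"
  using that
proof (induction M rule: int_ge_induct)
  case (step M)
  have "{- (M + 1)<..M + 1} = insert (M + 1) (insert (- M) {- M<..M})" using step.hyps by auto
  moreover have "M + 1 \<notin> insert (- M) {- M<..M}" "- M \<notin> {- M<..M}" using step.hyps by auto
  ultimately show ?case using step.IH
    by (simp add: cg_def sg_def power2_eq_square field_simps)
qed simp

end

lemma good_0 [simp]: "0 \<in> good" by (simp add: good_def)

lemma minus_single_inj:
  "m - Poly_Mapping.single k 1 = m' - Poly_Mapping.single k 1 \<Longrightarrow> Poly_Mapping.lookup m k > 0 \<Longrightarrow>
    Poly_Mapping.lookup m' k > 0 \<Longrightarrow> m = m'" for m m' :: "rat \<Rightarrow>\<^sub>0 nat"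
  using minus_single_add by metis

lemma sum_keys_minus_single:
  fixes m :: "rat \<Rightarrow>\<^sub>0 nat"
  assumes k: "k \<in> Poly_Mapping.keys m"
  shows "(\<Sum>q\<in>Poly_Mapping.keys (m - Poly_Mapping.single k 1). Poly_Mapping.lookup (m - Poly_Mapping.single k 1) q)
    < (\<Sum>q\<in>Poly_Mapping.keys m. Poly_Mapping.lookup m q)"
proof -
  let ?m = "m - Poly_Mapping.single k 1"
  have "(\<Sum>k\<in>Poly_Mapping.keys ?m. Poly_Mapping.lookup ?m k) = (\<Sum>k\<in>Poly_Mapping.keys m. Poly_Mapping.lookup ?m k)"
    by (rule sum.mono_neutral_left) (auto simp: in_keys_iff lookup_minus)
  also have "\<dots> < (\<Sum>k\<in>Poly_Mapping.keys m. Poly_Mapping.lookup m k)"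
    by (rule sum_strict_mono_ex1) (use k in \<open>auto simp: lookup_minus in_keys_iff intro!: bexI[of _ k]\<close>)
  finally show ?thesis .
qed

lemma Bt_pos_basis:
  assumes "N > 0"
  shows "Bt N (basis_vec x) = smul (- (of_int N / 2) * of_nat (Poly_Mapping.lookup (snd x) (of_int N / 2)))
    (basis_vec (fst x, snd x - Poly_Mapping.single (of_int N / 2) 1))"
proof -
  obtain S m where x: "x = (S, m)" by force
  show ?thesis
    unfolding x tensor_basis_vec[symmetric] Bt_tensor
    using assms by (simp add: beta_basis_vec tensor_simps tensor_basis_vec of_rat_minus of_rat_divide)
qed

section \<open>Commutators of the modes \<open>X N\<close>\<close>

context twisted_module
begin

lemma X_one:
  assumes f: "f \<in> FT" and hi: "\<And>s. s > hi \<Longrightarrow> GG s f = 0"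
  shows "X N (f \<otimes>\<^sub>v fock_one) = smul (cY j / of_real (sqrt 2)) (\<Sum>s\<in>{N..hi}. GG s f \<otimes>\<^sub>v S_op (nat (s - N)) fock_one)"
proof -
  have "X N (f \<otimes>\<^sub>v fock_one) = smul (1 / of_real (sqrt 2)) (\<Sum>s\<in>{N..hi}. GG s f \<otimes>\<^sub>v YY j (s - N) fock_one)"
  proof (rule X_tensor[OF f])
    fix r assume "r \<notin> {N..hi}"
    then show "GG r f \<otimes>\<^sub>v YY j (r - N) fock_one = 0"
      using hi[of r] by (cases "r > hi") (auto simp: YY_one S'_def tensor_simps)
  qed simp
  also have "(\<Sum>s\<in>{N..hi}. GG s f \<otimes>\<^sub>v YY j (s - N) fock_one) = smul (cY j) (\<Sum>s\<in>{N..hi}. GG s f \<otimes>\<^sub>v S_op (nat (s - N)) fock_one)"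
    unfolding smul_sum by (rule sum.cong) (auto simp: YY_one S'_def tensor_simps)
  finally show ?thesis by (simp add: mult.commute)
qed

text \<open>The expectation is nonzero only if the vertex operator removes exactly what
  \<open>S_op a\<close> created, which selects the single fermionic mode
  \<open>M - a\<close>.\<close>

lemma Ev_X_S:
  assumes f: "f \<in> FT"
  shows "Ev (X M (f \<otimes>\<^sub>v S_op a fock_one)) = smul (cY j / of_real (sqrt 2) * (if a = 0 then 1 else 2)) (GG (M - int a) f)"
proof -
  define I where "I = insert (M - int a) {r. GG r f \<otimes>\<^sub>v YY j (r - M) (S_op a fock_one) \<noteq> 0}"
  have I: "finite I" unfolding I_def using finite_modes[OF f] by simp
  have "X M (f \<otimes>\<^sub>v S_op a fock_one) = smul (1 / of_real (sqrt 2)) (\<Sum>r\<in>I. GG r f \<otimes>\<^sub>v YY j (r - M) (S_op a fock_one))"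
    by (rule X_tensor[OF f I]) (simp add: I_def)
  then have "Ev (X M (f \<otimes>\<^sub>v S_op a fock_one)) = smul (1 / of_real (sqrt 2))
      (\<Sum>r\<in>I. smul (Poly_Mapping.lookup (YY j (r - M) (S_op a fock_one)) 0) (GG r f))"
    by (simp add: lin_apply[OF lin_Ev] Ev_tensor)
  also have "(\<Sum>r\<in>I. smul (Poly_Mapping.lookup (YY j (r - M) (S_op a fock_one)) 0) (GG r f))
      = (\<Sum>r\<in>I. if r = M - int a then smul (cY j * (if a = 0 then 1 else 2)) (GG (M - int a) f) else 0)"
    by (rule sum.cong) (auto simp: lookup_YY_S)
  also have "\<dots> = smul (cY j * (if a = 0 then 1 else 2)) (GG (M - int a) f)"
    using I by (simp add: I_def)
  finally show ?thesis by (simp add: mult.commute)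
qed

text \<open>The commutator that the bracket relations prescribe for \<open>X M\<close> and \<open>X N\<close>.\<close>

definition bracket_op :: "int \<Rightarrow> int \<Rightarrow> tens \<Rightarrow> tens" where
  "bracket_op M N t = (if M + N = 0 then smul (- sg M * of_int M / 2) t
     else if odd (M + N) then smul (sg M) (Bt (M + N) t) else 0)"

text \<open>Commuting with a Heisenberg mode turns a defect into a combination of defects.  Hence defects
  vanish as soon as they vanish on the vectors \<open>f \<otimes> 1\<close>; there, by downward induction on \<open>M + N\<close>, the
  defect is annihilated by all positive Heisenberg modes and is determined by its component \<open>Ev\<close>.\<close>

definition defect :: "int \<Rightarrow> int \<Rightarrow> tens \<Rightarrow> tens" where
  "defect M N t = X M (X N t) - X N (X M t) - bracket_op M N t"

lemma lin_bracket_op [simp]: "lin (bracket_op M N)"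
  by (rule linI) (auto simp: bracket_op_def lin_apply[OF lin_tensor_map] smul.scale_right_distrib mult_ac)

lemma lin_defect [simp]: "lin (defect M N)"
  by (rule linI) (simp_all add: defect_def lin_apply[OF lin_X] lin_apply[OF lin_bracket_op] smul.scale_right_diff_distrib)

text \<open>The compatibility with a Heisenberg mode that a commutator of two \<open>X\<close> has.
  An odd shift flips \<open>sg\<close>: for even \<open>M + M'\<close> the two shifted terms cancel,
  and for odd \<open>M + M'\<close> they differ by exactly the central term of the Heisenberg
  commutator.\<close>

lemma Bt_bracket_op:
  assumes N: "odd N"
  shows "Bt N (bracket_op M M' t) = bracket_op M M' (Bt N t) - bracket_op (M + N) M' t - bracket_op M (M' + N) t"
proof -
  have s: "sg (M + N) = - sg M" using N by (simp add: sg_def)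
  consider "M + M' = 0" | "M + M' \<noteq> 0" "even (M + M')" | "odd (M + M')" by blast
  then show ?thesis
  proof cases
    case 1
    then have e: "M + N + M' = N" "M + (M' + N) = N" and "N \<noteq> 0" using N by auto
    then show ?thesis using N 1 s unfolding bracket_op_def e by (simp add: lin_apply[OF lin_tensor_map])
  next
    case 2
    then have "odd (M + M' + N)" using N by simp
    moreover from this have "M + M' + N \<noteq> 0" by (metis dvd_0_right)
    moreover have e: "M + N + M' = M + M' + N" "M + (M' + N) = M + M' + N" by simp_all
    ultimately show ?thesis using 2 s unfolding bracket_op_def e by (simp add: lin_apply[OF lin_tensor_map] del: even_add of_int_add)
  next
    case 3
    have e: "M + N + M' = M + M' + N" "M + (M' + N) = M + M' + N" by simp_all
    have "even (M + M' + N)" using 3 N by simp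
    moreover have "M + M' \<noteq> 0" using 3 by (metis dvd_0_right)
    ultimately show ?thesis using 3 s N Bt_commutator[OF N 3, of t]
      unfolding bracket_op_def e
      by (auto simp: lin_apply[OF lin_tensor_map] add.commute[of N] smul.scale_right_distrib
         smul.scale_right_diff_distrib add_divide_distrib distrib_left smul.scale_left_distrib
         smul.scale_left_diff_distrib  simp del: even_add)
  qed
qed

lemma Bt_defect:
  assumes N: "odd N" and t: "t \<in> V"
  shows "Bt N (defect M M' t) = defect M M' (Bt N t) - defect (M + N) M' t - defect M (M' + N) t"
  using t X_V[OF t] Bt_V[OF N t]
  by (simp add: defect_def lin_apply[OF lin_tensor_map] Bt_X[OF N] lin_apply[OF lin_X] Bt_bracket_op[OF N] algebra_simps)

lemma bracket_op_V: "t \<in> V \<Longrightarrow> bracket_op M N t \<in> V"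
  by (auto simp: bracket_op_def intro!: smul.subspace_neg[OF subspace_V] smul.subspace_scale[OF subspace_V] smul.subspace_0[OF subspace_V] Bt_V
      simp del: of_int_add)

lemma defect_V: "t \<in> V \<Longrightarrow> defect M N t \<in> V"
  unfolding defect_def by (intro smul.subspace_diff[OF subspace_V] X_V bracket_op_V)

lemma Deg_V: "t \<in> V \<Longrightarrow> Deg t \<in> V"
  by (rule V_memI[OF lin_Deg])
    (auto simp: tensor_basis_vec Deg_basis_vec V_def intro!: smul.subspace_scale[OF subspace_supp])

lemma Deg_defect:
  assumes t: "t \<in> V" shows "Deg (defect M N t) = defect M N (Deg t) + smul (of_int (M + N) / 2) (defect M N t)"
proof -
  have XX: "Deg (X M (X N t)) = X M (X N (Deg t)) + smul (of_int (M + N) / 2) (X M (X N t))" for M N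
    by (simp add: Deg_X t X_V lin_apply[OF lin_X] add_divide_distrib smul.scale_left_distrib)
  have "Deg (bracket_op M N t) = bracket_op M N (Deg t) + smul (of_int (M + N) / 2) (bracket_op M N t)"
    by (auto simp: bracket_op_def lin_apply[OF lin_Deg] Deg_Bt smul.scale_right_distrib mult.commute add.commute eq_neg_iff_add_eq_0[symmetric]
        simp del: even_add of_int_add)
  then show ?thesis
    unfolding defect_def lin_apply[OF lin_Deg] XX smul.scale_right_diff_distrib by (simp add: add.commute)
qed

lemma defect_swap: "defect N M t = - defect M N t"
proof -
  have "bracket_op N M t = - bracket_op M N t"
  proof (cases "M + N = 0")
    case True
    then have "N = - M" by simp
    then show ?thesis by (simp add: bracket_op_def sg_def)
  next
    case False
    then show ?thesis by (auto simp: bracket_op_def sg_def add.commute)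
  qed
  then show ?thesis by (simp add: defect_def)
qed

text \<open>The weights 1, 2, 2, ... are the contraction coefficients of two vertex operators, and
  \<open>- 2\<close> is the square of \<open>cY j / sqrt 2\<close>.\<close>

lemma Ev_X_X:
  assumes f: "f \<in> supp ext_basis" and hi: "\<And>s. s > hi \<Longrightarrow> GG s f = 0"
  shows "Ev (X M (X N (f \<otimes>\<^sub>v fock_one)))
    = smul (- 2) (\<Sum>s\<in>{N..hi}. smul (if s = N then 1 else 2) (GG (M + N - s) (GG s f)))"
proof -
  have c: "cY j / of_real (sqrt 2) * (cY j / of_real (sqrt 2)) = - 2"
    by (simp add: cY_def flip: of_real_mult power_add)
  have e: "M - int (nat (s - N)) = M + N - s" "nat (s - N) = 0 \<longleftrightarrow> s = N" if "s \<in> {N..hi}" for s using that by auto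
  have FT: "GG s f \<in> FT" for s by (intro supp_ext_basis_FT GG_ext_basis f)
  have "Ev (X M (X N (f \<otimes>\<^sub>v fock_one))) = smul (cY j / of_real (sqrt 2)) (\<Sum>s\<in>{N..hi}.
      smul (cY j / of_real (sqrt 2) * (if s = N then 1 else 2)) (GG (M + N - s) (GG s f)))"
    by (subst X_one[OF supp_ext_basis_FT[OF f] hi], assumption, unfold lin_apply[OF lin_Ev] lin_apply[OF lin_X], intro arg_cong[of _ _ "smul _"] sum.cong refl) (simp only: Ev_X_S[OF FT] e)
  also have "\<dots> = smul (cY j / of_real (sqrt 2) * (cY j / of_real (sqrt 2)))
      (\<Sum>s\<in>{N..hi}. smul (if s = N then 1 else 2) (GG (M + N - s) (GG s f)))"
    by (simp only: smul_sum smul.scale_scale mult.assoc)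
  finally show ?thesis unfolding c .
qed

lemma Ev_Bt_one: "odd N \<Longrightarrow> Ev (Bt N (f \<otimes>\<^sub>v fock_one)) = 0"
proof -
  assume N: "odd N"
  then have "N \<noteq> 0" by auto
  have "Poly_Mapping.lookup (bt N fock_one) 0 = 0"
  proof (cases "N < 0")
    case True then show ?thesis by (intro lookup_bt_neg_0) simp
  next
    case False then show ?thesis by (simp add: beta_basis_vec)
  qed
  then show ?thesis by (simp add: Bt_tensor Ev_tensor)
qed

text \<open>The end terms are reflections of each other and together give \<open>cg M\<close> once.
  Doubling the interior sum pairs each \<open>s\<close> with its reflection and gives
  \<open>cg s\<close> for every interior \<open>s\<close>. The total is the sum of \<open>cg\<close>
  over the half-open interval of \<open>sum_cg\<close>.\<close>

lemma sum_cg_reflected: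
  assumes "M \<ge> 0" "M \<noteq> 0" "\<And>s. h s + h (- s) = smul (cg s) f"
  shows "h M + h (- M) + smul 2 (\<Sum>s\<in>{- M<..<M}. h s) = smul (sg M * of_int M / 4) f"
proof -
  have "(\<Sum>s\<in>{- M<..<M}. h (- s)) = (\<Sum>s\<in>{- M<..<M}. h s)"
    by (rule sum.reindex_bij_witness[of _ uminus uminus]) auto
  then have "smul 2 (\<Sum>s\<in>{- M<..<M}. h s) = (\<Sum>s\<in>{- M<..<M}. h s + h (- s))"
    using smul.scale_left_distrib[of 1 1 "\<Sum>s\<in>{- M<..<M}. h s"] by (simp add: sum.distrib)
  also have "\<dots> = smul (\<Sum>s\<in>{- M<..<M}. cg s) f" by (simp add: assms smul.scale_sum_left)
  finally have "h M + h (- M) + smul 2 (\<Sum>s\<in>{- M<..<M}. h s) = smul (cg M + (\<Sum>s\<in>{- M<..<M}. cg s)) f"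
    by (simp add: assms(3) smul.scale_left_distrib)
  moreover have "{- M<..M} = insert M {- M<..<M}" using assms by auto
  ultimately show ?thesis using sum_cg[OF assms(1)] by simp
qed

text \<open>The two products are sums over \<open>s \<ge> N\<close> and over \<open>s \<ge> M\<close> of the same terms, so only \<open>N \<le> s \<le> M\<close>
  survives in the difference; the reflection \<open>s \<mapsto> M + N - s\<close> evaluates what is left.\<close>

lemma Ev_defect_one:
  assumes f: "f \<in> supp ext_basis"
  shows "Ev (defect M N (f \<otimes>\<^sub>v fock_one)) = 0"
proof -
  have *: "Ev (defect M N (f \<otimes>\<^sub>v fock_one)) = 0" if NM: "N < M" for M N
  proof -
    obtain hi0 where hi0: "\<And>s. s > hi0 \<Longrightarrow> GG s f = 0" using GG_eventually_0[OF supp_ext_basis_FT[OF f]] by blast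
    \<comment> \<open>Raised above \<open>M\<close> and \<open>N\<close> so that both sums contain
      their lower end, the one term of weight 1.\<close>
    define hi where "hi = max hi0 (max M N)"
    have hi: "\<And>s. s > hi \<Longrightarrow> GG s f = 0" "N < hi \<or> N = hi" "M \<le> hi" using hi0 by (auto simp: hi_def)
    define h where "h = (\<lambda>s. GG (M + N - s) (GG s f))"
    have h: "h s + h (M + N - s) = (if M + N = 0 then smul (cg s) f else 0)" for s
      using GG_anticommutator[OF supp_ext_basis_FT[OF f], of "M + N - s" s] by (simp add: h_def)
    have split: "(\<Sum>s\<in>{P..hi}. smul (if s = P then 1 else 2) (h s)) = h P + smul 2 (\<Sum>s\<in>{P<..hi}. h s)" if "P \<le> hi" for P
    proof -
      have "{P..hi} = insert P {P<..hi}" using that by auto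
      then have "(\<Sum>s\<in>{P..hi}. smul (if s = P then 1 else 2) (h s)) = h P + (\<Sum>s\<in>{P<..hi}. smul (if s = P then 1 else 2) (h s))"
        by simp
      also have "(\<Sum>s\<in>{P<..hi}. smul (if s = P then 1 else 2) (h s)) = smul 2 (\<Sum>s\<in>{P<..hi}. h s)"
        unfolding smul_sum by (rule sum.cong) auto
      finally show ?thesis .
    qed
    have "{N<..hi} = {N<..<M} \<union> insert M {M<..hi}" using NM hi by auto
    then have mid: "(\<Sum>s\<in>{N<..hi}. h s) = (\<Sum>s\<in>{N<..<M}. h s) + (h M + (\<Sum>s\<in>{M<..hi}. h s))"
      by (simp add: sum.union_disjoint disjoint_iff)
    have h': "(\<lambda>s. GG (N + M - s) (GG s f)) = h" by (simp add: h_def add.commute)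
    have "Ev (X M (X N (f \<otimes>\<^sub>v fock_one))) - Ev (X N (X M (f \<otimes>\<^sub>v fock_one)))
        = smul (- 2) ((h N + smul 2 (\<Sum>s\<in>{N<..hi}. h s)) - (h M + smul 2 (\<Sum>s\<in>{M<..hi}. h s)))"
    proof -
      have "Ev (X M (X N (f \<otimes>\<^sub>v fock_one))) = smul (- 2) (\<Sum>s\<in>{N..hi}. smul (if s = N then 1 else 2) (h s))"
        unfolding h_def by (rule Ev_X_X[OF f]) (rule hi(1))
      moreover have "Ev (X N (X M (f \<otimes>\<^sub>v fock_one))) = smul (- 2) (\<Sum>s\<in>{M..hi}. smul (if s = M then 1 else 2) (h s))"
        unfolding h'[symmetric] by (rule Ev_X_X[OF f]) (rule hi(1))
      ultimately show ?thesis using split[of N] split[of M] hi(2,3) NM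
        by (simp only: smul.scale_right_diff_distrib)
    qed
    also have "\<dots> = smul (- 2) (h N + h M + smul 2 (\<Sum>s\<in>{N<..<M}. h s))"
    proof -
      have "smul 2 (h M) = h M + h M" using smul.scale_left_distrib[of 1 1 "h M"] by simp
      then show ?thesis by (simp add: mid smul.scale_right_distrib)
    qed
    also have "\<dots> = Ev (bracket_op M N (f \<otimes>\<^sub>v fock_one))"
    proof (cases "M + N = 0")
      case True
      then have N: "N = - M" by simp
      have M: "M \<ge> 0" "M \<noteq> 0" using NM N by auto
      have "h N + h M + smul 2 (\<Sum>s\<in>{N<..<M}. h s) = smul (sg M * of_int M / 4) f"
        using sum_cg_reflected[OF M, of h f] h True N by (simp add: add.commute)
      then show ?thesis using True by (simp add: bracket_op_def lin_apply[OF lin_Ev] Ev_tensor lookup_basis_vec)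
    next
      case False
      have "(\<Sum>s\<in>{N<..<M}. h s) = (\<Sum>s\<in>{N<..<M}. h (M + N - s))"
        by (rule sum.reindex_bij_witness[of _ "\<lambda>s. M + N - s" "\<lambda>s. M + N - s"]) auto
      then have "smul 2 (\<Sum>s\<in>{N<..<M}. h s) = (\<Sum>s\<in>{N<..<M}. h s + h (M + N - s))"
        using smul.scale_left_distrib[of 1 1 "\<Sum>s\<in>{N<..<M}. h s"] by (simp add: sum.distrib)
      then have "h N + h M + smul 2 (\<Sum>s\<in>{N<..<M}. h s) = 0" using h[of N] False by (simp add: h)
      then show ?thesis using False
        by (simp add: bracket_op_def lin_apply[OF lin_Ev] Ev_Bt_one del: even_add of_int_add)
    qed
    finally show ?thesis by (simp add: defect_def lin_apply[OF lin_Ev])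
  qed
  have "defect M M t = 0" for t
  proof -
    have "M + M = 0 \<Longrightarrow> M = 0" by simp
    then show ?thesis by (auto simp: defect_def bracket_op_def)
  qed
  then show ?thesis
    using *[of N M] *[of M N] defect_swap[of M N "f \<otimes>\<^sub>v fock_one"]
    by (cases M N rule: linorder_cases) (auto simp: lin_apply[OF lin_Ev])
qed

text \<open>If a monomial containing the variable \<open>k\<close> occurred in \<open>t\<close>, the
  mode \<open>k\<close> would not kill \<open>t\<close>: removing a variable is injective on the
  monomials that contain it, so its coefficient survives.\<close>

lemma V_vacuum:
  assumes t: "t \<in> V" and b: "\<And>N. odd N \<Longrightarrow> N > 0 \<Longrightarrow> Bt N t = 0"
  shows "t = Ev t \<otimes>\<^sub>v fock_one"
proof -
  have m0: "m = 0" if Sm: "(S, m) \<in> Poly_Mapping.keys t" for S m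
  proof (rule ccontr)
    assume "m \<noteq> 0"
    then obtain k where k: "k \<in> Poly_Mapping.keys m" by (metis keys_eq_empty ex_in_conv)
    have "m \<in> good" using t Sm by (auto simp: V_def supp_def)
    then have kk: "k \<in> half_odds" "k > 0" using k by (auto simp: good_def)
    then obtain N where N: "k = of_int N / 2" "odd N" by (auto elim: half_oddsE)
    let ?c = "\<lambda>x. - (of_int N / 2) * of_nat (Poly_Mapping.lookup (snd x) k) :: complex"
    let ?d = "\<lambda>x. (fst x, snd x - Poly_Mapping.single k 1)"
    have "N > 0" using N(1) kk by simp
    have "Poly_Mapping.lookup (Bt N t) (?d (S, m)) = ?c (S, m) * Poly_Mapping.lookup t (S, m)"
    proof (rule lookup_lowering[OF lin_tensor_map _ _ Sm])
      fix x :: "rat set \<times> (rat \<Rightarrow>\<^sub>0 nat)"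
      obtain S' m' where x: "x = (S', m')" by force
      show "Bt N (basis_vec x) = smul (?c x) (basis_vec (?d x))"
        unfolding N(1) by (rule Bt_pos_basis) fact
      assume "?c x \<noteq> 0" "?d x = ?d (S, m)"
      then show "x = (S, m)" using k minus_single_inj[of m' k m] by (auto simp: x in_keys_iff)
    qed
    moreover have "Bt N t = 0" using b N kk by simp
    ultimately show False using kk k Sm \<open>N > 0\<close> by (simp add: in_keys_iff)
  qed
  have "lin (\<lambda>t. Ev t \<otimes>\<^sub>v fock_one)"
    by (rule linI) (simp_all add: lin_apply[OF lin_Ev] tensor_simps)
  then show ?thesis
  proof (rule lin_eqI[where F = "\<lambda>t. t", rotated])
    show "lin (\<lambda>t :: tens. t)" by (rule linI) auto
    fix a assume "a \<in> Poly_Mapping.keys t"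
    moreover obtain S m where "a = (S, m)" by force
    ultimately have "basis_vec a = basis_vec S \<otimes>\<^sub>v fock_one" using m0 by (auto simp: tensor_basis_vec)
    then show "basis_vec a = Ev (basis_vec a) \<otimes>\<^sub>v fock_one" by (simp add: Ev_tensor lookup_basis_vec)
  qed
qed

lemma bt_one: "N > 0 \<Longrightarrow> bt N fock_one = 0"
  by (simp add: beta_basis_vec)

lemma defect_one:
  assumes S: "S \<in> ext_basis" shows "defect M N (basis_vec S \<otimes>\<^sub>v fock_one) = 0"
proof -
  let ?v = "basis_vec S \<otimes>\<^sub>v fock_one"
  have v: "?v \<in> V" using S by (intro tensor_V) auto
  \<comment> \<open>Degrees in \<open>V\<close> are at most 0, while the defect has degree
    \<open>\<Sum>S + (M + N) / 2\<close>. This is positive for \<open>M + N \<ge> hi\<close>, so the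
    downward induction has a start.\<close>
  obtain hi :: int where hi: "- 2 * \<Sum>S < of_int hi" using ex_less_of_int by blast
  show ?thesis
  proof (induction "nat (hi - (M + N))" arbitrary: M N rule: less_induct)
    case less
    have "Deg ?v = smul (of_rat (\<Sum>S)) ?v"
      by (simp add: tensor_basis_vec Deg_basis_vec)
    then have D: "Deg (defect M N ?v) = smul (of_rat (\<Sum>S + of_int (M + N) / 2)) (defect M N ?v)"
      by (simp add: Deg_defect[OF v] lin_apply[OF lin_defect] of_rat_add of_rat_divide smul.scale_left_distrib)
    show ?case
    proof (cases "M + N \<ge> hi")
      case True
      show ?thesis
      proof (rule ccontr)
        assume "defect M N ?v \<noteq> 0"
        then obtain T m where Tm: "(T, m) \<in> Poly_Mapping.keys (defect M N ?v)"
          by (metis keys_eq_empty ex_in_conv surj_pair)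
        from Deg_eigenvector[OF D this] have "\<Sum>T - wt m = \<Sum>S + of_int (M + N) / 2" .
        moreover have "T \<in> ext_basis" using Tm defect_V[OF v, of M N] by (auto simp: V_def supp_def)
        then have "\<Sum>T \<le> 0" by (auto simp: ext_basis_def neg_modes_def intro!: sum_nonpos)
        moreover have "of_int (M + N) \<ge> (of_int hi :: rat)" using True by (simp only: of_int_le_iff)
        moreover have "a - w = s + q / 2 \<Longrightarrow> a \<le> 0 \<Longrightarrow> h \<le> q \<Longrightarrow> 0 \<le> w \<Longrightarrow> - 2 * s < h \<Longrightarrow> False" for a w s q h :: rat
          by linarith
        ultimately show False using wt_nonneg[of m] hi by blast
      qed
    next
      case False
      have "Bt P (defect M N ?v) = 0" if P: "odd P" "P > 0" for P
        using Bt_defect[OF P(1) v, of M N] less[of "M + P" N] less[of M "N + P"] P False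
        by (simp add: Bt_tensor bt_one tensor_simps lin_apply[OF lin_defect])
      from V_vacuum[OF defect_V[OF v] this] show ?thesis
        using Ev_defect_one[of "basis_vec S" M N] S by (simp add: tensor_simps)
    qed
  qed
qed

text \<open>One step adds one variable, which is the effect of the creation mode
  \<open>Bt (- N)\<close>; properties thus spread from the Fock vacuum to all monomials.\<close>

lemma good_induct [consumes 1, case_names 0 add]:
  assumes "m \<in> good" "P 0"
    and "\<And>N m. odd N \<Longrightarrow> N > 0 \<Longrightarrow> m \<in> good \<Longrightarrow> P m \<Longrightarrow> P (Poly_Mapping.single (of_int N / 2) 1 + m)"
  shows "P m"
  using assms(1)
proof (induction "\<Sum>k\<in>Poly_Mapping.keys m. Poly_Mapping.lookup m k" arbitrary: m rule: less_induct)
  case less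
  show ?case
  proof (cases "m = 0")
    case False
    then obtain k where k: "k \<in> Poly_Mapping.keys m" by (metis keys_eq_empty ex_in_conv)
    then have kk: "k \<in> half_odds" "k > 0" using less.prems by (auto simp: good_def)
    then obtain N where N: "k = of_int N / 2" "odd N" by (auto elim: half_oddsE)
    let ?m = "m - Poly_Mapping.single k 1"
    have "Poly_Mapping.lookup m k > 0" using k by (simp add: in_keys_iff)
    note m = minus_single_add[OF this]
    have sub: "Poly_Mapping.keys ?m \<subseteq> Poly_Mapping.keys m" by (auto simp: in_keys_iff lookup_minus)
    then have "P ?m" using less sum_keys_minus_single[OF k] by (auto simp: good_def)
    moreover have "?m \<in> good" using sub less.prems by (auto simp: good_def)
    moreover have "N > 0" using N(1) kk by simp
    ultimately have "P (Poly_Mapping.single k 1 + ?m)" unfolding N(1) by (intro assms(3) N(2))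
    then show ?thesis unfolding m .
  qed (use assms in simp)
qed

lemma Bt_neg_basis:
  "N > 0 \<Longrightarrow> Bt (- N) (f \<otimes>\<^sub>v basis_vec m) = f \<otimes>\<^sub>v basis_vec (Poly_Mapping.single (of_int N / 2) 1 + m)"
  unfolding Bt_tensor by (simp add: beta_basis_vec)

lemma X_commutator:
  assumes t: "t \<in> V" shows "X M (X N t) - X N (X M t) = bracket_op M N t"
proof -
  have "defect M N t = 0"
  proof (rule V_eqI[OF lin_defect _ t])
    show "lin (\<lambda>t :: tens. 0 :: tens)" by (rule linI) auto
    fix S and m :: "rat \<Rightarrow>\<^sub>0 nat" assume S: "S \<in> ext_basis" and m: "m \<in> good"
    show "defect M N (basis_vec S \<otimes>\<^sub>v basis_vec m) = 0"
      using m
    proof (induction m arbitrary: M N rule: good_induct)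
      case 0 show ?case by (rule defect_one[OF S])
    next
      case (add P m)
      have v: "basis_vec S \<otimes>\<^sub>v basis_vec m \<in> V" using S add by (auto intro!: tensor_V simp: Fock_supp_good)
      show ?case unfolding Bt_neg_basis[OF add(2), symmetric]
        using Bt_defect[of "- P", OF _ v, of M N] add by (simp add: lin_apply[OF lin_tensor_map])
    qed
  qed
  then show ?thesis by (simp add: defect_def)
qed

end

text \<open>Every nonzero bracket is a multiple of one generator, so the sum in the module axiom
  collapses. For \<open>c = 0\<close> the set of keys is empty and both sides are 0.\<close>

lemma sum_single_keys:
  "(\<Sum>g\<in>Poly_Mapping.keys (Poly_Mapping.single x c). smul (Poly_Mapping.lookup (Poly_Mapping.single x c) g) (r g)) = smul c (r x)"
  by (cases "c = 0") auto

lemma basis_cases: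
  assumes "x \<in> basis"
  obtains "x = K" | N where "x = H (of_int N / 2)" "odd N" | N where "x = Xminus (of_int N / 2)" "odd N"
    | N where "x = Xplus (of_int N / 2)" "even N"
proof -
  consider "x = K" | m where "x = H m" "m \<in> half_odds" | m where "x = Xminus m" "m \<in> half_odds" | m where "x = Xplus m" "m \<in> \<int>"
    using assms by (auto simp: basis_def)
  then show ?thesis
  proof cases
    case 4
    then obtain c where "m = of_int c" by (auto elim: Ints_cases)
    then have "x = Xplus (of_int (2 * c) / 2)" using 4 by simp
    then show ?thesis using that(4)[of "2 * c"] by simp
  qed (auto elim: half_oddsE intro: that)
qed

lemma of_int_half_Ints [simp]: "even N \<Longrightarrow> of_int N / 2 \<in> (\<int> :: rat set)"
  by (auto elim!: evenE)

section \<open>Irreducibility\<close>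

context twisted_module
begin

lemma Phi_coeff_nonzero:
  assumes "f \<in> supp ext_basis" "r \<in> half_ints" "r \<noteq> l - 1 / 2"
  obtains n c where "r = of_int n / 2" "c \<noteq> 0" "Phi i r f = smul c (GG n f)"
proof -
  obtain n where n: "r = of_int n / 2" using assms(2) by (rule half_intsE)
  have "l - r - 1 / 2 \<noteq> 0" using assms(3) by linarith
  then have "(of_rat (l - r - 1 / 2) :: complex) \<noteq> 0" by (simp only: of_rat_eq_0_iff not_False_eq_True)
  then have "Phi i r f = smul (1 / of_rat (l - r - 1 / 2)) (GG n f)" "1 / of_rat (l - r - 1 / 2) \<noteq> (0::complex)"
    unfolding GG_def G_def n[symmetric] smul.scale_scale by simp_all
  with n that show ?thesis by blast
qed

definition vac :: tens where "vac = basis_vec {} \<otimes>\<^sub>v fock_one"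

lemma empty_ext_basis [simp]: "{} \<in> ext_basis" by (simp add: ext_basis_def)

lemma vac_V: "vac \<in> V" unfolding vac_def by (rule tensor_V) auto

lemma vac_nonzero: "vac \<noteq> 0" by (simp add: vac_def tensor_basis_vec)

lemma invariant_subspace_eq:
  assumes U: "smul.subspace U" "U \<subseteq> V" "U \<noteq> {0}"
    and XU: "\<And>N t. t \<in> U \<Longrightarrow> X N t \<in> U" and BU: "\<And>N t. odd N \<Longrightarrow> t \<in> U \<Longrightarrow> Bt N t \<in> U"
  shows "U = V"
proof -
  define U0 where "U0 = {f \<in> supp ext_basis. f \<otimes>\<^sub>v fock_one \<in> U}"
  note subU = smul.subspace_0[OF U(1)] smul.subspace_add[OF U(1)] smul.subspace_scale[OF U(1)]
  have U0: "smul.subspace U0"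
    unfolding U0_def
    by (rule smul.subspaceI) (auto simp: tensor_simps subU smul.subspace_0[OF subspace_supp]
        smul.subspace_add[OF subspace_supp] smul.subspace_scale[OF subspace_supp])
  have Fock: "f \<otimes>\<^sub>v g \<in> U" if f: "f \<in> U0" and g: "g \<in> Fock" for f g
  proof (rule lin_supp_mem[OF U(1) lin_tensor_right g[unfolded Fock_supp_good]])
    fix m assume "m \<in> good"
    then show "f \<otimes>\<^sub>v basis_vec m \<in> U"
    proof (induction rule: good_induct)
      case 0 then show ?case using f by (simp add: U0_def)
    next
      case (add N m)
      have "odd (- N)" using add(1) by simp
      from BU[OF this add(4)] show ?case unfolding Bt_neg_basis[OF add(2)] .
    qed
  qed
  \<comment> \<open>Downward induction on \<open>N\<close>: apart from
    \<open>GG N f \<otimes> 1\<close>, the terms of \<open>X N (f \<otimes> 1)\<close> involve only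
    \<open>GG s f\<close> with \<open>s > N\<close>. These lie in \<open>U0\<close>, so by
    \<open>Fock\<close> the corresponding terms lie in \<open>U\<close>.\<close>
  have GG: "GG N f \<in> U0" if f: "f \<in> U0" for f N
  proof -
    have f': "f \<in> supp ext_basis" "f \<otimes>\<^sub>v fock_one \<in> U" using f by (auto simp: U0_def)
    obtain hi where hi: "\<And>s. s > hi \<Longrightarrow> GG s f = 0" using GG_eventually_0[OF supp_ext_basis_FT[OF f'(1)]] by blast
    show ?thesis
    proof (induction "nat (hi + 1 - N)" arbitrary: N rule: less_induct)
      case less
      show ?case
      proof (cases "N > hi")
        case True
        then show ?thesis using hi smul.subspace_0[OF U0] by simp
      next
        case False
        have "X N (f \<otimes>\<^sub>v fock_one) = smul (cY j / of_real (sqrt 2)) (\<Sum>s\<in>{N..hi}. GG s f \<otimes>\<^sub>v S_op (nat (s - N)) fock_one)"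
          by (rule X_one[OF supp_ext_basis_FT[OF f'(1)]]) (rule hi)
        moreover have "{N..hi} = insert N {N<..hi}" using False by auto
        ultimately have "GG N f \<otimes>\<^sub>v fock_one = smul (of_real (sqrt 2) / cY j) (X N (f \<otimes>\<^sub>v fock_one))
            - (\<Sum>s\<in>{N<..hi}. GG s f \<otimes>\<^sub>v S_op (nat (s - N)) fock_one)"
          by (simp add: series_exp_0)
        also have "\<dots> \<in> U"
          using f f' less False
          by (intro smul.subspace_diff[OF U(1)] subU XU smul.subspace_sum[OF U(1)] Fock S_Fock one_Fock) auto
        finally show ?thesis using GG_ext_basis[OF f'(1)] by (simp add: U0_def)
      qed
    qed
  qed
  have Phi: "Phi i r f \<in> U0" if f: "f \<in> U0" and r: "r \<in> half_ints" "r \<noteq> l - 1 / 2" for f r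
  proof -
    have "f \<in> supp ext_basis" using f by (simp add: U0_def)
    from Phi_coeff_nonzero[OF this r] obtain n c where "Phi i r f = smul c (GG n f)" by metis
    then show ?thesis using GG[OF f] smul.subspace_scale[OF U0] by simp
  qed
  \<comment> \<open>A nonzero vector of \<open>U\<close> is lowered by positive Heisenberg modes
    until all of them kill it; by \<open>V_vacuum\<close> it then has the form
    \<open>f \<otimes> 1\<close>.\<close>
  obtain f0 where f0: "f0 \<in> U0" "f0 \<noteq> 0"
  proof -
    obtain t where t: "t \<in> U" "t \<noteq> 0" using U(3) subU(1) by blast
    let ?c = "\<lambda>N x. - (of_int N / 2) * of_nat (Poly_Mapping.lookup (snd x) (of_int N / 2)) :: complex"
    let ?d = "\<lambda>N x. (fst x, snd x - Poly_Mapping.single (of_int N / 2) (1::nat))"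
    let ?sz = "\<lambda>x. \<Sum>q\<in>Poly_Mapping.keys (snd x). Poly_Mapping.lookup (snd x) q"
    obtain g where g: "g \<in> U" "g \<noteq> 0" "\<And>a N. a \<in> Poly_Mapping.keys g \<Longrightarrow> N \<in> {N. odd N \<and> N > 0} \<Longrightarrow> ?c N a = 0"
    proof (rule lowering_induct[where I = "{N. odd N \<and> N > 0}" and F = Bt and A = "ext_basis \<times> good" and c = ?c and d = ?d
          and sz = ?sz and U = U and f = t], goal_cases)
      case (2 N b)
      then show ?case by (intro Bt_pos_basis) auto
    next
      case (3 N a b)
      then show ?case using minus_single_inj[of "snd a" "of_int N / 2" "snd b"] by (auto simp: prod_eq_iff)
    next
      case (4 N b)
      then show ?case using sum_keys_minus_single[of "of_int N / 2" "snd b"] by (auto simp: in_keys_iff)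
    qed (use U(2) t BU in \<open>auto simp: V_def\<close>)
    have "Bt N g = 0" if N: "odd N" "N > 0" for N
    proof -
      have "Poly_Mapping.keys (Bt N g) \<subseteq> ?d N ` {b \<in> Poly_Mapping.keys g. ?c N b \<noteq> 0}"
        by (rule keys_lowering[OF lin_tensor_map]) (rule Bt_pos_basis[OF N(2)])
      moreover have "{b \<in> Poly_Mapping.keys g. ?c N b \<noteq> 0} = {}" using g(3) N by blast
      ultimately show ?thesis by (metis image_empty keys_eq_empty subset_empty)
    qed
    from V_vacuum[OF _ this] g(1) U(2) have "g = Ev g \<otimes>\<^sub>v fock_one" by blast
    moreover have "Ev g \<in> supp ext_basis"
    proof (rule lin_supp_mem[OF subspace_supp lin_Ev])
      show "g \<in> supp (ext_basis \<times> good)" using g(1) U(2) by (auto simp: V_def)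
      show "Ev (basis_vec x) \<in> supp ext_basis" if "x \<in> ext_basis \<times> good" for x
        using that by (auto simp: Ev_tensor intro!: smul.subspace_scale[OF subspace_supp] simp flip: tensor_basis_vec)
    qed
    moreover have "Ev g \<noteq> 0" using calculation(1) g(2) by (metis tensor_simps(3))
    ultimately show ?thesis using that[of "Ev g"] g(1) by (simp add: U0_def)
  qed
  \<comment> \<open>\<open>- s\<close> is positive and \<open>l - 1 / 2\<close> is negative, so
    \<open>U0\<close> is stable under all annihilation modes \<open>\<Phi>(- s)\<close>.\<close>
  have neg: "- s \<in> half_ints" "- s \<noteq> l - 1 / 2" "s < 0" if "s \<in> neg_modes" for s
    using that l_less by (auto simp: neg_modes_def half_ints_def)
  have vac: "basis_vec {} \<in> U0"
  proof -
    let ?c = "\<lambda>s S. if s \<in> S then - ((- 1) powi \<lfloor>2 * - s\<rfloor>) * eps s S else 0"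
    obtain g where g: "g \<in> U0" "g \<noteq> 0" "\<And>S s. S \<in> Poly_Mapping.keys g \<Longrightarrow> s \<in> neg_modes \<Longrightarrow> ?c s S = 0"
    proof (rule lowering_induct[where I = neg_modes and F = "\<lambda>s. Phi i (- s)" and A = ext_basis and c = ?c
          and d = "\<lambda>s S. S - {s}" and sz = card and U = U0 and f = f0], goal_cases)
      case (2 s b)
      then show ?case using neg[OF 2(2)] by (simp add: Phi_lin Phi_basis_alt)
    next
      case (3 s a b)
      then show ?case by (auto split: if_splits)
    next
      case (4 s b)
      then have "s \<in> b" "finite b" by (auto split: if_splits simp: ext_basis_def)
      then show ?case by (metis card_Diff1_less)
    qed (use f0 neg Phi in \<open>auto simp: U0_def\<close>)
    have "S = {}" if "S \<in> Poly_Mapping.keys g" for S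
    proof -
      have "S \<subseteq> neg_modes" using g(1) that by (auto simp: U0_def supp_def ext_basis_def)
      moreover have "s \<notin> S" if s: "s \<in> neg_modes" for s
        using g(3)[OF \<open>S \<in> Poly_Mapping.keys g\<close> s] by (auto simp: eps_def split: if_splits)
      ultimately show ?thesis by blast
    qed
    moreover have "Poly_Mapping.keys g \<noteq> {}" using g(2) by simp
    ultimately have k: "Poly_Mapping.keys g = {{}}" by blast
    have "g = smul (Poly_Mapping.lookup g {}) (basis_vec {})" "Poly_Mapping.lookup g {} \<noteq> 0"
      using expand_basis[of g] k by (auto simp flip: in_keys_iff)
    then have "basis_vec {} = smul (1 / Poly_Mapping.lookup g {}) g"
      by (metis smul.scale_scale smul.scale_one nonzero_eq_divide_eq)
    then show ?thesis using smul.subspace_scale[OF U0 g(1)] by metis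
  qed
  have ext: "basis_vec S \<in> U0" if "S \<in> ext_basis" for S
  proof -
    have "finite S" using that by (simp add: ext_basis_def)
    then show ?thesis using that
    proof (induction S rule: finite_induct)
      case empty show ?case by (rule vac)
    next
      case (insert s S)
      then have s: "s \<in> half_ints" "s \<noteq> l - 1 / 2" "s < 0" and S: "basis_vec S \<in> U0"
        by (auto simp: ext_basis_def neg_modes_def)
      have "smul (eps s S) (Phi i s (basis_vec S)) \<in> U0"
        by (intro smul.subspace_scale[OF U0] Phi S s)
      then show ?case using insert(2) s by (simp add: Phi_lin Phi_basis_alt eps_sq)
    qed
  qed
  have "V \<subseteq> U"
  proof
    fix t assume "t \<in> V"
    then show "t \<in> U"
      unfolding V_def
    proof (rule lin_supp_mem[where F = "\<lambda>x. x", rotated 2])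
      show "basis_vec x \<in> U" if "x \<in> ext_basis \<times> good" for x
        using that by (auto intro!: Fock ext simp: Fock_supp_good simp flip: tensor_basis_vec)
      show "lin (\<lambda>x :: tens. x)" by (rule linI) auto
    qed (rule U(1))
  qed
  with U(2) show ?thesis by blast
qed

section \<open>The action of the generators and the module axioms\<close>

lemma action_eq:
  assumes "t \<in> V"
  shows "action i j l (Xminus (of_int N / 2)) t = smul 2 (X N t)" "action i j l (Xplus (of_int N / 2)) t = smul 2 (X N t)"
proof -
  have "t \<in> supp ({S. finite S \<and> S \<subseteq> {r \<in> half_ints. r < 0}} \<times> UNIV)"
    using assms by (auto simp: V_def supp_def ext_basis_def neg_modes_def)
  from X_coeff_eq_X[OF this] show "action i j l (Xminus (of_int N / 2)) t = smul 2 (X N t)"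
    "action i j l (Xplus (of_int N / 2)) t = smul 2 (X N t)" by simp_all
qed

lemma action_H: "action i j l (H (of_int N / 2)) t = smul (- 2) (Bt N t)"
  by simp

lemma half_sum: "of_int M / 2 + of_int N / 2 = (of_int (M + N) / 2 :: rat)"
  by (simp add: add_divide_distrib)

text \<open>With doubled modes, \<open>Xplus\<close> and \<open>Xminus\<close> differ only in the
  parity of the index. The identities \<open>HX\<close>, \<open>XH\<close>, \<open>XX\<close> and
  \<open>HH\<close> therefore settle all pairs of generators except those with the scalar
  \<open>K\<close>; the factor 4 in \<open>XX\<close> comes from the normalization of both
  generators as twice a mode of \<open>X\<close>.\<close>

lemma action_bracket:
  assumes x: "x \<in> basis" and y: "y \<in> basis" and v: "v \<in> V"
  shows "action i j l x (action i j l y v) - action i j l y (action i j l x v)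
    = (\<Sum>g\<in>Poly_Mapping.keys (bracket x y). smul (Poly_Mapping.lookup (bracket x y) g) (action i j l g v))"
proof -
  note sc = smul.subspace_scale[OF subspace_V]
  have half0: "of_int M / 2 + of_int N / 2 = (0::rat) \<longleftrightarrow> M + N = 0" for M N
    unfolding half_sum by (simp del: of_int_add)
  have HX: "smul (- 2) (Bt M (smul 2 (X N v))) - smul 2 (X N (smul (- 2) (Bt M v))) = smul 4 (X (M + N) v)" if "odd M" for M N
    using Bt_X[OF that v, of N]
    by (simp add: lin_smul[OF lin_X] lin_neg[OF lin_X] lin_smul[OF lin_tensor_map] smul.scale_right_diff_distrib add.commute)
  have XH: "smul 2 (X N (smul (- 2) (Bt M v))) - smul (- 2) (Bt M (smul 2 (X N v))) = smul (- 4) (X (M + N) v)" if "odd M" for M N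
    using HX[OF that, of N] by (metis minus_diff_eq smul.scale_minus_left)
  have XX: "smul 2 (X M (smul 2 (X N v))) - smul 2 (X N (smul 2 (X M v))) = smul 4 (bracket_op M N v)" for M N
    using X_commutator[OF v, of M N] by (simp add: lin_smul[OF lin_X] flip: smul.scale_right_diff_distrib)
  have HH: "smul (- 2) (Bt M (smul (- 2) (Bt N v))) - smul (- 2) (Bt N (smul (- 2) (Bt M v)))
      = (if M + N = 0 then smul (- 2 * of_int M) v else 0)" if "odd M" "odd N" for M N
    using Bt_commutator[OF that, of v]
    by (simp add: lin_smul[OF lin_tensor_map] lin_neg[OF lin_tensor_map] smul.scale_right_distrib smul.scale_right_diff_distrib del: of_int_add)
  have Bv: "odd N \<Longrightarrow> smul (- 2) (Bt N v) \<in> V" and Xv: "smul 2 (X N v) \<in> V" for N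
    using v by (intro sc Bt_V X_V; simp)+
  note acts = action_eq[OF v] action_eq[OF Bv] action_eq[OF Xv] action_H
  note sums = bracket.simps sum_single_keys half_sum half0
  show ?thesis
    using x
  proof (cases rule: basis_cases)
    case 1
    note K = 1
    show ?thesis using y
    proof (cases rule: basis_cases)
      case 1 then show ?thesis using K by simp
    next
      case (2 N)
      then show ?thesis using K by (simp add: lin_smul[OF lin_tensor_map] lin_neg[OF lin_tensor_map])
    next
      case (3 N)
      show ?thesis unfolding K 3(1) action.simps(1) acts action_eq[OF sc[OF v]] by (simp add: lin_smul[OF lin_X] lin_neg[OF lin_X])
    next
      case (4 N)
      show ?thesis unfolding K 4(1) action.simps(1) acts action_eq[OF sc[OF v]] by (simp add: lin_smul[OF lin_X] lin_neg[OF lin_X])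
    qed
  next
    case M: (2 M)
    show ?thesis using y
    proof (cases rule: basis_cases)
      case 1 then show ?thesis using M by (simp add: lin_smul[OF lin_tensor_map] lin_neg[OF lin_tensor_map])
    next
      case (2 N)
      show ?thesis unfolding M(1) 2(1) sums acts HH[OF M(2) 2(2)] by (simp add: when_def of_rat_mult)
    next
      case (3 N)
      show ?thesis unfolding M(1) 3(1) sums acts acts(3)[OF M(2)] HX[OF M(2)] by simp
    next
      case (4 N)
      show ?thesis unfolding M(1) 4(1) sums acts acts(4)[OF M(2)] HX[OF M(2)] by simp
    qed
  next
    case M: (3 M)
    show ?thesis using y
    proof (cases rule: basis_cases)
      case 1 then show ?thesis unfolding M(1) 1 action.simps(1) acts action_eq[OF sc[OF v]] by (simp add: lin_smul[OF lin_X] lin_neg[OF lin_X])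
    next
      case (2 N)
      show ?thesis unfolding M(1) 2(1) sums acts acts(3)[OF 2(2)] XH[OF 2(2)] by (simp add: add.commute)
    next
      case (3 N)
      show ?thesis unfolding M(1) 3(1) sums acts XX using M(2) 3(2) by (simp add: when_def of_rat_mult of_rat_minus bracket_op_def sg_def)
    next
      case (4 N)
      have MN: "M + N \<noteq> 0" using M(2) 4(2) by (metis dvd_0_right even_add)
      show ?thesis unfolding M(1) 4(1) sums acts XX using MN M(2) 4(2) by (auto simp: bracket_op_def sg_def add.commute)
    qed
  next
    case M: (4 M)
    show ?thesis using y
    proof (cases rule: basis_cases)
      case 1 then show ?thesis unfolding M(1) 1 action.simps(1) acts action_eq[OF sc[OF v]] by (simp add: lin_smul[OF lin_X] lin_neg[OF lin_X])
    next
      case (2 N)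
      show ?thesis unfolding M(1) 2(1) sums acts acts(4)[OF 2(2)] XH[OF 2(2)] by (simp add: add.commute)
    next
      case (3 N)
      have MN: "M + N \<noteq> 0" using M(2) 3(2) by (metis dvd_0_right even_add)
      show ?thesis unfolding M(1) 3(1) sums acts XX using MN M(2) 3(2) by (auto simp: bracket_op_def sg_def add.commute)
    next
      case (4 N)
      show ?thesis unfolding M(1) 4(1) sums acts XX using M(2) 4(2) by (simp add: when_def of_rat_mult of_rat_minus bracket_op_def sg_def)
    qed
  qed
qed

lemma action_V:
  assumes "x \<in> basis" "t \<in> V" shows "action i j l x t \<in> V"
  using assms(1)
proof (cases rule: basis_cases)
  case 1 then show ?thesis using assms(2) by (auto intro: smul.subspace_scale[OF subspace_V] smul.subspace_neg[OF subspace_V])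
next
  case (2 N)
  then show ?thesis using Bt_V[OF 2(2) assms(2)] by (auto intro: smul.subspace_scale[OF subspace_V] smul.subspace_neg[OF subspace_V])
qed (use assms(2) in \<open>auto simp only: action_eq intro!: smul.subspace_scale[OF subspace_V] X_V\<close>)

text \<open>\<open>action\<close> is defined through \<open>Sum_any\<close>, which respects sums
  only where supports are finite. The operator \<open>F\<close> agrees with it on \<open>V\<close>
  and is linear everywhere.\<close>

lemma action_lin:
  assumes "x \<in> basis"
  obtains F where "lin F" "\<And>t. t \<in> V \<Longrightarrow> action i j l x t = F t"
    "\<And>t. t \<in> V \<Longrightarrow> Deg (F t) = F (Deg t) + smul (of_rat (mode x)) (F t)"
proof -
  have lin: "lin (\<lambda>t. smul c (F t))" if "lin F" for c and F :: "tens \<Rightarrow> tens"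
    by (rule linI) (simp_all add: lin_apply[OF that] smul.scale_right_distrib mult.commute)
  have deg: "Deg (smul c (F t)) = smul c (F (Deg t)) + smul q (smul c (F t))"
    if "Deg (F t) = F (Deg t) + smul q (F t)" for c q t and F :: "tens \<Rightarrow> tens"
    by (simp add: lin_smul[OF lin_Deg] that smul.scale_right_distrib mult.commute)
  show ?thesis
    using assms
  proof (cases rule: basis_cases)
    case 1
    have "lin (smul (- 2))" by (rule linI) (simp_all only: smul.scale_right_distrib smul.scale_left_commute)
    then show ?thesis by (rule that) (simp_all add: 1 lin_apply[OF lin_Deg])
  next
    case (2 N)
    show ?thesis
    proof (rule that[of "\<lambda>t. smul (- 2) (Bt N t)"])
      show "Deg (smul (- 2) (Bt N t)) = smul (- 2) (Bt N (Deg t)) + smul (of_rat (mode x)) (smul (- 2) (Bt N t))" for t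
        by (rule deg[where F = "Bt N"]) (use Deg_Bt[OF 2(2), of t] in \<open>simp add: 2(1) of_rat_divide\<close>)
    qed (use 2 in \<open>simp_all only: action_H lin lin_tensor_map\<close>)
  next
    case (3 N)
    show ?thesis
    proof (rule that[of "\<lambda>t. smul 2 (X N t)"])
      show "Deg (smul 2 (X N t)) = smul 2 (X N (Deg t)) + smul (of_rat (mode x)) (smul 2 (X N t))" if "t \<in> V" for t
        by (rule deg) (simp add: 3 Deg_X[OF that] of_rat_divide)
    qed (use 3 in \<open>simp_all only: action_eq lin lin_X\<close>)
  next
    case (4 N)
    show ?thesis
    proof (rule that[of "\<lambda>t. smul 2 (X N t)"])
      show "Deg (smul 2 (X N t)) = smul 2 (X N (Deg t)) + smul (of_rat (mode x)) (smul 2 (X N t))" if "t \<in> V" for t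
        by (rule deg) (simp add: 4 Deg_X[OF that] of_rat_divide)
    qed (use 4 in \<open>simp_all only: action_eq lin lin_X\<close>)
  qed
qed

lemma twisted_sl2_module_V: "twisted_sl2_module smul V (action i j l)"
proof (unfold_locales, goal_cases)
  case 1 show ?case by (rule subspace_V)
next
  case (2 x v) then show ?case by (rule action_V)
next
  case (3 x v w)
  from 3(1) obtain F where F: "lin F" "\<And>t. t \<in> V \<Longrightarrow> action i j l x t = F t" by (rule action_lin) blast
  then show ?case using 3 smul.subspace_add[OF subspace_V] by (simp add: lin_apply[OF F(1)])
next
  case (4 x v c)
  from 4(1) obtain F where F: "lin F" "\<And>t. t \<in> V \<Longrightarrow> action i j l x t = F t" by (rule action_lin) blast
  then show ?case using 4 smul.subspace_scale[OF subspace_V] by (simp add: lin_apply[OF F(1)])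
next
  case (5 x y v) then show ?case by (rule action_bracket)
qed

lemma irreducible_V: "irreducible_module smul V (action i j l)"
  unfolding irreducible_module_def
proof (intro conjI allI impI)
  show "V \<noteq> {0}" using vac_V vac_nonzero by auto
  fix U assume "submodule smul V (action i j l) U"
  then have U: "U \<subseteq> V" "smul.subspace U" "\<And>x u. x \<in> basis \<Longrightarrow> u \<in> U \<Longrightarrow> action i j l x u \<in> U"
    by (auto simp: submodule_def)
  have BU: "Bt N t \<in> U" if "odd N" "t \<in> U" for N t
  proof -
    have "H (of_int N / 2) \<in> basis" using that by (auto simp: basis_def half_odds_of_int)
    from smul.subspace_scale[OF U(2) U(3)[OF this that(2)], of "- 1 / 2"] show ?thesis by simp
  qed
  have XU: "X N t \<in> U" if "t \<in> U" for N t
  proof -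
    have "smul 2 (X N t) \<in> U"
    proof (cases "odd N")
      case True
      then have "Xminus (of_int N / 2) \<in> basis" by (auto simp: basis_def half_odds_of_int)
      from U(3)[OF this that] show ?thesis using that U(1) by (simp only: action_eq subset_iff)
    next
      case False
      then have "Xplus (of_int N / 2) \<in> basis" by (auto simp: basis_def)
      from U(3)[OF this that] show ?thesis using that U(1) by (simp only: action_eq subset_iff)
    qed
    from smul.subspace_scale[OF U(2) this, of "1 / 2"] show ?thesis by simp
  qed
  show "U = {0} \<or> U = V" using invariant_subspace_eq[OF U(2,1) _ XU BU] by blast
qed (rule twisted_sl2_module_V)

section \<open>Highest weight, degree operator and identification of the space\<close>

lemma vac_FT: "basis_vec {} \<in> FT" by (rule ext_basis_FT) simp

lemma GG_vac: "n > 0 \<Longrightarrow> GG n (basis_vec {}) = 0"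
    "GG 0 (basis_vec {}) = smul (of_rat (l - 1 / 2) * kap i) (basis_vec {})"
  by (simp_all add: GG_def G_def Phi_vacuum kap_def)

lemma X_vac: "N > 0 \<Longrightarrow> X N vac = 0"
    "X 0 vac = smul (cY j / of_real (sqrt 2) * of_rat (l - 1 / 2) * kap i) vac"
  using X_one[OF vac_FT GG_vac(1), of N] X_one[OF vac_FT GG_vac(1), of 0]
  by (simp_all add: vac_def GG_vac series_exp_0 tensor_simps mult.assoc)

text \<open>The factors \<open>sqrt 2\<close> and \<open>\<i>\<close> cancel between
  \<open>cY j / sqrt 2\<close> and \<open>kap i\<close>. What remains is
  \<open>- 2 * (l - 1 / 2)\<close> with the sign \<open>(- 1) ^ (i + j)\<close>.\<close>

lemma highest_weight_vac:
  "highest_weight_vector smul V (action i j l) (of_rat (1 - 2 * l) * (- 1) ^ (i + j)) vac"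
  unfolding highest_weight_vector_def
proof (intro conjI ballI impI)
  fix x assume x: "x \<in> basis" "mode x > 0"
  from x(1) show "action i j l x vac = 0"
  proof (cases rule: basis_cases)
    case (2 N)
    then show ?thesis using x(2) unfolding 2(1) action_H by (simp add: vac_def Bt_tensor bt_one tensor_simps)
  qed (use x(2) X_vac(1) in \<open>simp_all add: action_eq[OF vac_V] del: action.simps(3,4)\<close>)
next
  have s: "of_real (sqrt 2) * of_real (sqrt 2) = (2 :: complex)" by (simp flip: of_real_mult)
  have "2 * (cY j / of_real (sqrt 2) * of_rat (l - 1 / 2) * kap i)
      = - (4 * of_rat (l - 1 / 2) / (of_real (sqrt 2) * of_real (sqrt 2)) * (- 1) ^ (i + j))"
    by (simp add: cY_def kap_def power_add field_simps del: of_real_mult)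
  also have "\<dots> = of_rat (1 - 2 * l) * (- 1) ^ (i + j)"
  proof -
    have "- (4 * (x - 1 / 2) / 2 * e) = (1 - 2 * x) * e" for x e :: complex by (simp add: field_simps)
    then show ?thesis unfolding s by (simp add: of_rat_diff of_rat_mult of_rat_divide)
  qed
  finally show "action i j l (Xplus 0) vac = smul (of_rat (1 - 2 * l) * (- 1) ^ (i + j)) vac"
    using action_eq(2)[OF vac_V, of 0] X_vac(2) by (simp add: mult.assoc)
qed (rule vac_V vac_nonzero)+

lemma degree_operator_V: "has_degree_operator smul V (action i j l) vac"
  unfolding has_degree_operator_def
proof (intro exI[of _ Deg] conjI ballI allI)
  fix x u assume x: "x \<in> basis" "u \<in> V"
  from x(1) obtain F where "\<And>t. t \<in> V \<Longrightarrow> action i j l x t = F t"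
    "\<And>t. t \<in> V \<Longrightarrow> Deg (F t) = F (Deg t) + smul (of_rat (mode x)) (F t)"
    by (rule action_lin) blast
  then show "Deg (action i j l x u) - action i j l x (Deg u) = smul (of_rat (mode x)) (action i j l x u)"
    using x Deg_V by simp
qed (simp_all add: Deg_V lin_apply[OF lin_Deg] vac_def tensor_basis_vec Deg_basis_vec)

lemma is_L_V:
  assumes "c\<^sub>0 = - 1 - of_rat (1 - 2 * l) * (- 1) ^ (i + j)" "c\<^sub>1 = - 1 + of_rat (1 - 2 * l) * (- 1) ^ (i + j)"
  shows "is_L c\<^sub>0 c\<^sub>1 smul V (action i j l)"
  unfolding is_L_def
proof (intro exI conjI)
  show "c\<^sub>0 = (- 2) / 2 - of_rat (1 - 2 * l) * (- 1) ^ (i + j)" "c\<^sub>1 = (- 2) / 2 + of_rat (1 - 2 * l) * (- 1) ^ (i + j)"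
    using assms by simp_all
  show "generated_by smul V (action i j l) vac"
    using vac_V vac_nonzero irreducible_V by (auto simp: generated_by_def irreducible_module_def)
qed (simp_all add: irreducible_V highest_weight_vac degree_operator_V)

text \<open>As \<open>1 / 2 - l > 0\<close>, the operator \<open>\<Phi>(1/2 - l)\<close> removes the
  index \<open>l - 1 / 2\<close> up to a nonzero factor. Removal is injective on the sets containing
  this index, so no cancellation can bring such a set into a vector of the kernel.\<close>

lemma FTbar_eq: "FTbar i l = ext_alg neg_modes"
proof -
  have r: "1 / 2 - l > 0" "- (1 / 2 - l) = l - 1 / 2" using l_less by simp_all
  have P: "Phi i (1 / 2 - l) (basis_vec S) = smul (if l - 1 / 2 \<in> S then - ((- 1) powi \<lfloor>2 * (1 / 2 - l)\<rfloor>) * eps (l - 1 / 2) S else 0)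
      (basis_vec (S - {l - 1 / 2}))" for S
    using r by (simp add: Phi_lin Phi_basis_alt)
  have ext: "ext_alg neg_modes = supp ext_basis" by (simp add: ext_alg_eq_supp ext_basis_def)
  show ?thesis
    unfolding ext
  proof
    show "supp ext_basis \<subseteq> FTbar i l"
    proof
      fix f assume f: "f \<in> supp ext_basis"
      have "Phi i (1 / 2 - l) f = (\<lambda>_. 0) f"
        by (rule lin_eq_suppI[OF lin_Phi _ f]) (auto simp: P ext_basis_def neg_modes_def intro!: linI)
      with supp_ext_basis_FT[OF f] show "f \<in> FTbar i l" by (simp add: FTbar_def)
    qed
    show "FTbar i l \<subseteq> supp ext_basis"
    proof
      fix f assume f: "f \<in> FTbar i l"
      have "l - 1 / 2 \<notin> S" if S: "S \<in> Poly_Mapping.keys f" for S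
      proof
        assume S': "l - 1 / 2 \<in> S"
        have "Poly_Mapping.lookup (Phi i (1 / 2 - l) f) (S - {l - 1 / 2})
          = (if l - 1 / 2 \<in> S then - ((- 1) powi \<lfloor>2 * (1 / 2 - l)\<rfloor>) * eps (l - 1 / 2) S else 0) * Poly_Mapping.lookup f S"
          by (rule lookup_lowering[OF lin_Phi P _ S]) (use S' in \<open>auto split: if_splits\<close>)
        with f S S' show False by (simp add: FTbar_def eps_def in_keys_iff)
      qed
      with f show "f \<in> supp ext_basis"
        by (auto simp: FTbar_def FT_def ext_alg_def supp_def ext_basis_def neg_modes_def)
    qed
  qed
qed

lemma tensor_space_eq: "tensor_space (FTbar i l) Fock = V"
  unfolding FTbar_eq Fock_supp_good V_def ext_alg_eq_supp tensor_space_supp by (simp add: ext_basis_def)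

end

theorem theorem6p3:
  fixes l :: rat and i j :: nat
  assumes "l \<in> half_ints" and "l < 1 / 2" and "i \<in> {1, 2}" and "j \<in> {1, 2}"
  shows "FTbar i l = ext_alg {n \<in> half_ints. n < 0 \<and> n \<noteq> l - 1 / 2}
    \<and> (i = j \<longrightarrow>
         is_L (of_rat (2 * l - 2)) (of_rat (- 2 * l))
           smul (tensor_space (FTbar i l) Fock) (action i j l)
         \<and> (\<forall>(sc :: complex \<Rightarrow> 'v::ab_group_add \<Rightarrow> 'v) V \<rho>.
              is_L (of_rat (2 * l - 2)) (of_rat (- 2 * l)) sc V \<rho> \<longrightarrow>
              module_iso smul (tensor_space (FTbar i l) Fock) (action i j l) sc V \<rho>))
    \<and> (i \<noteq> j \<longrightarrow>
         is_L (of_rat (- 2 * l)) (of_rat (2 * l - 2))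
           smul (tensor_space (FTbar i l) Fock) (action i j l)
         \<and> (\<forall>(sc :: complex \<Rightarrow> 'v::ab_group_add \<Rightarrow> 'v) V \<rho>.
              is_L (of_rat (- 2 * l)) (of_rat (2 * l - 2)) sc V \<rho> \<longrightarrow>
              module_iso smul (tensor_space (FTbar i l) Fock) (action i j l) sc V \<rho>))"
proof -
  interpret twisted_module i j l by unfold_locales fact+
  have FT: "FTbar i l = ext_alg {n \<in> half_ints. n < 0 \<and> n \<noteq> l - 1 / 2}"
    by (simp add: FTbar_eq neg_modes_def)
  have "is_L (of_rat (2 * l - 2)) (of_rat (- 2 * l)) smul (tensor_space (FTbar i l) Fock) (action i j l)" if "i = j"
    unfolding tensor_space_eq
    by (rule is_L_V) (use that in \<open>simp_all add: of_rat_diff of_rat_mult of_rat_minus flip: mult_2\<close>)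
  moreover have "is_L (of_rat (- 2 * l)) (of_rat (2 * l - 2)) smul (tensor_space (FTbar i l) Fock) (action i j l)" if "i \<noteq> j"
  proof -
    \<comment> \<open>Distinct elements of \<open>{1, 2}\<close> have an odd sum. This flips the
      sign of the eigenvalue and exchanges the two coefficients of the weight.\<close>
    have "odd (i + j)" using that assms(3,4) by auto
    then show ?thesis unfolding tensor_space_eq
      by (intro is_L_V) (simp_all add: of_rat_diff of_rat_mult of_rat_minus)
  qed
  ultimately show ?thesis using FT is_L_unique by blast
qed

end
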